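(* Assume Assumptions (A1) (analytic graph), (A2) (Borel prices), (A3) ($NA(\mathcal Q^T)$) and (A4) (integrability) below, and let $(U_n)_{n\ge1}$ be random utility functions satisfying (A5) and (A6) for some $x_0>0$. Let $G\in\mathcal W^{0,+}_T$ be such that it is not the case that $G=0$ $\mathcal Q^T$-q.s. Then for all $n\ge1$, $p_n(G,x_0)$ is well defined, and $\lim_{n\to\infty}p_n(G,x_0)=\pi(G)$.
   Context: Framework: $T\ge1$; Polish spaces $\Omega_1,\dots,\Omega_T$; $\Omega^t:=\Omega_1\times\cdots\times\Omega_t$ ($\Omega^0$ a singleton). $\mathfrak P(X)$: Borel probability measures on Polish $X$; $\mathcal B_c(X)$: universal $\sigma$-algebra (intersection of the completions), each $P$ extended to it; universally measurable = $\mathcal B_c$-measurable. $\mathcal SK_t$: universally measurable stochastic kernels on $\Omega_t$ given $\Omega^{t-1}$; $P\otimes p(A):=\int\int1_A(\omega^{t-1},\omega_t)p(d\omega_t,\omega^{t-1})P(d\omega^{t-1})$. Random sets $\mathcal Q_{t+1}:\Omega^t\twoheadrightarrow\mathfrak P(\Omega_{t+1})$, $0\le t\le T-1$, are given; $\mathcal Q^t:=\{Q_1\otimes q_2\otimes\cdots\otimes q_t:Q_1\in\mathcal Q_1,\ q_{s+1}\in\mathcal SK_{s+1},\ q_{s+1}(\cdot,\omega^s)\in\mathcal Q_{s+1}(\omega^s)\ Q_s\text{-a.s.},\ 1\le s\le t-1\}$, $Q_s:=Q_1\otimes\cdots\otimes q_s$. $N\subset\Omega^t$ is $\mathcal Q^t$-polar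 if for every $P\in\mathcal Q^t$ it is contained in a $P$-null set of $\mathcal B_c(\Omega^t)$; "$\mathcal Q^t$-q.s." = outside a polar set; full measure = complement polar. $\mathcal W^0_t$: universally measurable $X:\Omega^t\to\mathbb R\cup\{\pm\infty\}$; $\mathcal W^{0,+}_t$: nonnegative ones; for $r\in(0,\infty)$, $\mathcal W^r_t:=\{X\in\mathcal W^0_t:\sup_{P\in\mathcal Q^t}E_P|X|^r<\infty\}$, $\|X\|_r:=(\sup_{P\in\mathcal Q^T}E_P|X|^r)^{1/r}$ for $X$ on $\Omega^T$. (A1): each $\mathcal Q_{t+1}$ has nonempty convex values and analytic graph $\{(\omega^t,P):P\in\mathcal Q_{t+1}(\omega^t)\}\subset\Omega^t\times\mathfrak P(\Omega_{t+1})$. Prices: $S=(S_t)_{0\le t\le T}$ $\mathbb R^d$-valued, $S_t$ universally measurable on $\Omega^t$, $\Delta S_t:=S_t-S_{t-1}$. (A2): each $S_t$ is Borel measurable. $\Phi$: strategies $\phi=(\phi_t)_{1\le t\le T}$ with $\phi_t:\Omega^{t-1}\to\mathbb R^d$ universally measurable; $V_t^{x,\phi}:=x+\sum_{s=1}^t\phi_s\cdot\Delta S_s$. (A3): for all $\phi\in\Phi$, $V_T^{0,\phi}\ge0$ $\mathcal Q^T$-q.s. implies $V_T^{0,\phi}=0$ $\mathcal Q^T$-q.s. For $0\le t\le T-1$, $D^{t+1}(\omega^t)$ is the affine hull of the intersection of all closed $A\subset\mathbb R^d$ with $P(\Delta S_{t+1}(\omega^t,\cdot)\in A)=1$ for all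 $P\in\mathcal Q_{t+1}(\omega^t)$; one fixes $\mathcal Q^t$-full-measure sets $\Omega^t_{NA}\in\mathcal B_c(\Omega^t)$ and universally measurable $\alpha_t:\Omega^t\to(0,\infty)$ such that for $\omega^t\in\Omega^t_{NA}$, $D^{t+1}(\omega^t)$ is a vector space and for each $h\in D^{t+1}(\omega^t)\setminus\{0\}$ there is $P_h\in\mathcal Q_{t+1}(\omega^t)$ with $P_h(\frac h{|h|}\cdot\Delta S_{t+1}(\omega^t,\cdot)<-\alpha_t(\omega^t))>\alpha_t(\omega^t)$. (A4): for every $r\in(0,\infty)$, $\Delta S_t\in\mathcal W^r_t$ for $1\le t\le T$ and $1/\alpha_t\in\mathcal W^r_t$ for $1\le t\le T-1$. $\mathcal A(G,x):=\{\phi\in\Phi:V_T^{x,\phi}\ge G\ \mathcal Q^T\text{-q.s.}\}$; $\pi(G):=\inf\{z\in\mathbb R:\mathcal A(G,z)\ne\emptyset\}$ ($+\infty$ if none). A random utility function is $U:\Omega^T\times(0,\infty)\to\mathbb R$ with $U(\cdot,x)$ universally measurable and $U(\omega^T,\cdot)$ concave, strictly increasing, $C^2$ on $(0,\infty)$, extended by right-continuity at $0$ and by $-\infty$ on $(-\infty,0)$. For such $U_n$: $\mathcal A(U_n,G,x):=\{\phi\in\mathcal A(G,x):E_PU_n^+(\cdot,V_T^{x,\phi}-G)<\infty\ \forall P\in\mathcal Q^T\}$, $u_n(G,x):=\sup_{\phi\in\mathcal A(U_n,G,x)}\inf_{P\in\mathcal Q^T}E_PU_n(\cdot,V_T^{x,\phi}-G)$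 ($-\infty$ if the set is empty), $p_n(G,x):=\inf\{z\in\mathbb R:u_n(G,x+z)\ge u_n(0,x)\}$ ($+\infty$ if empty). (A5) at $x_0$: $\sup_n\|U_n^+(\cdot,x_0)\|_1<\infty$, $\sup_n\|U_n^-(\cdot,x_0)\|_1<\infty$, and $\sup_n\|U_n'(\cdot,x_0)\|_q<\infty$ for some $q>1$. (A6) at $x_0$: for all $0\le x<x_0$ and $M\ge0$, $\lim_{n}\inf_{P\in\mathcal Q^T}P(U_n(\cdot,x)\le-M)=1$. *)

theory Defs
  imports "HOL-Probability.Probability"
begin

text \<open>The Polish spaces Omega_1, ..., Omega_T are closed subsets Om s of a Polish type 'a.
  A point of Omega^t is an extensional function on {1..t}; Omega^0 is a singleton.\<close>

definition Mcoord :: "(nat \<Rightarrow> 'a::topological_space set) \<Rightarrow> nat \<Rightarrow> 'a measure" where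
  "Mcoord Om s = restrict_space borel (Om s)"

definition Omt :: "(nat \<Rightarrow> 'a::topological_space set) \<Rightarrow> nat \<Rightarrow> (nat \<Rightarrow> 'a) measure" where
  "Omt Om t = PiM {1..t} (Mcoord Om)"

definition probs :: "'b measure \<Rightarrow> 'b measure set" where
  "probs M = {P. prob_space P \<and> sets P = sets M}"

definition univ_sets :: "'b measure \<Rightarrow> 'b set set" where
  "univ_sets M = {A. A \<subseteq> space M \<and> (\<forall>P\<in>probs M. A \<in> sets (completion P))}"

definition univ_meas :: "'b measure \<Rightarrow> 'c measure \<Rightarrow> ('b \<Rightarrow> 'c) \<Rightarrow> bool" where
  "univ_meas M N f \<longleftrightarrow> f \<in> space M \<rightarrow> space N \<and> (\<forall>B\<in>sets N. f -` B \<inter> space M \<in> univ_sets M)"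

definition analytic :: "'b measure \<Rightarrow> 'b set \<Rightarrow> bool" where
  "analytic M A \<longleftrightarrow> (\<exists>B \<in> sets (M \<Otimes>\<^sub>M (borel :: real measure)). A = fst ` B)"

definition mixm :: "real \<Rightarrow> 'b measure \<Rightarrow> 'b measure \<Rightarrow> 'b measure" where
  "mixm l P Q = measure_of (space P) (sets P)
     (\<lambda>A. ennreal l * emeasure P A + ennreal (1 - l) * emeasure Q A)"

definition convex_probs :: "'b measure set \<Rightarrow> bool" where
  "convex_probs K \<longleftrightarrow> (\<forall>P\<in>K. \<forall>Q\<in>K. \<forall>l\<in>{0..1}. mixm l P Q \<in> K)"

definition is_kernel :: "'b measure \<Rightarrow> 'c measure \<Rightarrow> ('b \<Rightarrow> 'c measure) \<Rightarrow> bool" where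
  "is_kernel M N q \<longleftrightarrow> (\<forall>\<omega>\<in>space M. q \<omega> \<in> probs N) \<and>
     (\<forall>A\<in>sets N. univ_meas M borel (\<lambda>\<omega>. emeasure (q \<omega>) A))"

definition kcomp :: "(nat \<Rightarrow> 'a::topological_space set) \<Rightarrow> nat \<Rightarrow> (nat \<Rightarrow> 'a) measure
    \<Rightarrow> ((nat \<Rightarrow> 'a) \<Rightarrow> 'a measure) \<Rightarrow> (nat \<Rightarrow> 'a) measure" where
  "kcomp Om t P q = measure_of (space (Omt Om (Suc t))) (sets (Omt Om (Suc t)))
     (\<lambda>A. \<integral>\<^sup>+\<omega>. emeasure (q \<omega>) {x \<in> space (q \<omega>). fun_upd \<omega> (Suc t) x \<in> A} \<partial>(completion P))"

text \<open>Qr (Suc t) \<omega> is the random set Q_(t+1)(\<omega>^t).\<close>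
fun Qset :: "(nat \<Rightarrow> 'a::topological_space set) \<Rightarrow> (nat \<Rightarrow> (nat \<Rightarrow> 'a) \<Rightarrow> 'a measure set)
    \<Rightarrow> nat \<Rightarrow> (nat \<Rightarrow> 'a) measure set" where
  "Qset Om Qr 0 = probs (Omt Om 0)"
| "Qset Om Qr (Suc t) = {kcomp Om t P q | P q. P \<in> Qset Om Qr t \<and>
      is_kernel (Omt Om t) (Mcoord Om (Suc t)) q \<and>
      (AE \<omega> in completion P. q \<omega> \<in> Qr (Suc t) \<omega>)}"

definition polar :: "(nat \<Rightarrow> 'a::topological_space set) \<Rightarrow> (nat \<Rightarrow> (nat \<Rightarrow> 'a) \<Rightarrow> 'a measure set)
    \<Rightarrow> nat \<Rightarrow> (nat \<Rightarrow> 'a) set \<Rightarrow> bool" where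
  "polar Om Qr t N \<longleftrightarrow> (\<forall>P\<in>Qset Om Qr t. \<exists>A\<in>univ_sets (Omt Om t).
      N \<subseteq> A \<and> emeasure (completion P) A = 0)"

definition qs :: "(nat \<Rightarrow> 'a::topological_space set) \<Rightarrow> (nat \<Rightarrow> (nat \<Rightarrow> 'a) \<Rightarrow> 'a measure set)
    \<Rightarrow> nat \<Rightarrow> ((nat \<Rightarrow> 'a) \<Rightarrow> bool) \<Rightarrow> bool" where
  "qs Om Qr t Pr \<longleftrightarrow> (\<exists>N. polar Om Qr t N \<and> (\<forall>\<omega>\<in>space (Omt Om t) - N. Pr \<omega>))"

definition full :: "(nat \<Rightarrow> 'a::topological_space set) \<Rightarrow> (nat \<Rightarrow> (nat \<Rightarrow> 'a) \<Rightarrow> 'a measure set)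
    \<Rightarrow> nat \<Rightarrow> (nat \<Rightarrow> 'a) set \<Rightarrow> bool" where
  "full Om Qr t A \<longleftrightarrow> polar Om Qr t (space (Omt Om t) - A)"

definition abspow :: "real \<Rightarrow> ereal \<Rightarrow> ennreal" where
  "abspow r x = (case x of ereal y \<Rightarrow> ennreal (\<bar>y\<bar> powr r) | _ \<Rightarrow> \<infinity>)"

definition in_W :: "(nat \<Rightarrow> 'a::topological_space set) \<Rightarrow> (nat \<Rightarrow> (nat \<Rightarrow> 'a) \<Rightarrow> 'a measure set)
    \<Rightarrow> nat \<Rightarrow> real \<Rightarrow> ((nat \<Rightarrow> 'a) \<Rightarrow> ereal) \<Rightarrow> bool" where
  "in_W Om Qr t r X \<longleftrightarrow> univ_meas (Omt Om t) borel X \<and>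
     (SUP P\<in>Qset Om Qr t. \<integral>\<^sup>+\<omega>. abspow r (X \<omega>) \<partial>(completion P)) < \<infinity>"

definition strategies :: "(nat \<Rightarrow> 'a::topological_space set) \<Rightarrow> nat
    \<Rightarrow> (nat \<Rightarrow> (nat \<Rightarrow> 'a) \<Rightarrow> 'b::euclidean_space) set" where
  "strategies Om T = {\<phi>. \<forall>t\<in>{1..T}. univ_meas (Omt Om (t - 1)) borel (\<phi> t)}"

definition Vt :: "(nat \<Rightarrow> (nat \<Rightarrow> 'a) \<Rightarrow> 'b::euclidean_space) \<Rightarrow> nat \<Rightarrow> real
    \<Rightarrow> (nat \<Rightarrow> (nat \<Rightarrow> 'a) \<Rightarrow> 'b) \<Rightarrow> (nat \<Rightarrow> 'a) \<Rightarrow> real" where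
  "Vt S t x \<phi> \<omega> = x + (\<Sum>s\<in>{1..t}. \<phi> s (restrict \<omega> {1..s - 1}) \<bullet>
       (S s (restrict \<omega> {1..s}) - S (s - 1) (restrict \<omega> {1..s - 1})))"

definition Aset :: "(nat \<Rightarrow> 'a::topological_space set) \<Rightarrow> (nat \<Rightarrow> (nat \<Rightarrow> 'a) \<Rightarrow> 'a measure set)
    \<Rightarrow> (nat \<Rightarrow> (nat \<Rightarrow> 'a) \<Rightarrow> 'b::euclidean_space) \<Rightarrow> nat \<Rightarrow> ((nat \<Rightarrow> 'a) \<Rightarrow> ereal) \<Rightarrow> real
    \<Rightarrow> (nat \<Rightarrow> (nat \<Rightarrow> 'a) \<Rightarrow> 'b) set" where
  "Aset Om Qr S T G x = {\<phi> \<in> strategies Om T. qs Om Qr T (\<lambda>\<omega>. G \<omega> \<le> ereal (Vt S T x \<phi> \<omega>))}"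

text \<open>Superreplication price (an extended real; +\<infinity> if no superreplicating strategy).\<close>
definition superrep :: "(nat \<Rightarrow> 'a::topological_space set) \<Rightarrow> (nat \<Rightarrow> (nat \<Rightarrow> 'a) \<Rightarrow> 'a measure set)
    \<Rightarrow> (nat \<Rightarrow> (nat \<Rightarrow> 'a) \<Rightarrow> 'b::euclidean_space) \<Rightarrow> nat \<Rightarrow> ((nat \<Rightarrow> 'a) \<Rightarrow> ereal) \<Rightarrow> ereal" where
  "superrep Om Qr S T G = Inf (ereal ` {z. Aset Om Qr S T G z \<noteq> {}})"

definition Dset :: "(nat \<Rightarrow> (nat \<Rightarrow> 'a) \<Rightarrow> 'a measure set) \<Rightarrow> (nat \<Rightarrow> (nat \<Rightarrow> 'a) \<Rightarrow> 'b::euclidean_space)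
    \<Rightarrow> nat \<Rightarrow> (nat \<Rightarrow> 'a) \<Rightarrow> 'b set" where
  "Dset Qr S t \<omega> = affine hull (\<Inter>{A. closed A \<and> (\<forall>P\<in>Qr (Suc t) \<omega>.
      measure P {x \<in> space P. S (Suc t) (fun_upd \<omega> (Suc t) x) - S t \<omega> \<in> A} = 1)})"

definition NA_witness :: "(nat \<Rightarrow> 'a::topological_space set) \<Rightarrow> (nat \<Rightarrow> (nat \<Rightarrow> 'a) \<Rightarrow> 'a measure set)
    \<Rightarrow> (nat \<Rightarrow> (nat \<Rightarrow> 'a) \<Rightarrow> 'b::euclidean_space) \<Rightarrow> nat
    \<Rightarrow> (nat \<Rightarrow> (nat \<Rightarrow> 'a) set) \<Rightarrow> (nat \<Rightarrow> (nat \<Rightarrow> 'a) \<Rightarrow> real) \<Rightarrow> bool" where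
  "NA_witness Om Qr S T NA \<alpha> \<longleftrightarrow> (\<forall>t<T.
      NA t \<in> univ_sets (Omt Om t) \<and> full Om Qr t (NA t) \<and>
      univ_meas (Omt Om t) borel (\<alpha> t) \<and> (\<forall>\<omega>\<in>space (Omt Om t). 0 < \<alpha> t \<omega>) \<and>
      (\<forall>\<omega>\<in>NA t. subspace (Dset Qr S t \<omega>) \<and>
         (\<forall>h\<in>Dset Qr S t \<omega> - {0}. \<exists>Ph\<in>Qr (Suc t) \<omega>.
            measure Ph {x \<in> space Ph. (h /\<^sub>R norm h) \<bullet> (S (Suc t) (fun_upd \<omega> (Suc t) x) - S t \<omega>) < - \<alpha> t \<omega>}
              > \<alpha> t \<omega>)))"

definition C2_on :: "real set \<Rightarrow> (real \<Rightarrow> real) \<Rightarrow> bool" where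
  "C2_on S f \<longleftrightarrow> (\<exists>f' f''. (\<forall>x\<in>S. (f has_real_derivative f' x) (at x) \<and>
       (f' has_real_derivative f'' x) (at x)) \<and> continuous_on S f'')"

text \<open>u \<omega> is U(\<omega>, .) on (0,\<infinity>).\<close>
definition random_utility :: "(nat \<Rightarrow> 'a) measure \<Rightarrow> ((nat \<Rightarrow> 'a) \<Rightarrow> real \<Rightarrow> real) \<Rightarrow> bool" where
  "random_utility M u \<longleftrightarrow> (\<forall>x>0. univ_meas M borel (\<lambda>\<omega>. u \<omega> x)) \<and>
     (\<forall>\<omega>\<in>space M. concave_on {0<..} (u \<omega>) \<and> strict_mono_on {0<..} (u \<omega>) \<and> C2_on {0<..} (u \<omega>))"

definition Uext :: "('w \<Rightarrow> real \<Rightarrow> real) \<Rightarrow> 'w \<Rightarrow> ereal \<Rightarrow> ereal" where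
  "Uext u \<omega> y = (case y of
      ereal r \<Rightarrow> (if 0 < r then ereal (u \<omega> r)
                 else if r = 0 then Lim (at_right (0::real)) (\<lambda>z. ereal (u \<omega> z)) else - \<infinity>)
    | MInfty \<Rightarrow> - \<infinity>
    | PInfty \<Rightarrow> (SUP z\<in>{0<..}. ereal (u \<omega> z)))"

definition Eext :: "'w measure \<Rightarrow> ('w \<Rightarrow> ereal) \<Rightarrow> ereal" where
  "Eext P f = enn2ereal (\<integral>\<^sup>+\<omega>. e2ennreal (f \<omega>) \<partial>(completion P))
            - enn2ereal (\<integral>\<^sup>+\<omega>. e2ennreal (- f \<omega>) \<partial>(completion P))"

definition AUset :: "(nat \<Rightarrow> 'a::topological_space set) \<Rightarrow> (nat \<Rightarrow> (nat \<Rightarrow> 'a) \<Rightarrow> 'a measure set)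
    \<Rightarrow> (nat \<Rightarrow> (nat \<Rightarrow> 'a) \<Rightarrow> 'b::euclidean_space) \<Rightarrow> nat \<Rightarrow> ((nat \<Rightarrow> 'a) \<Rightarrow> real \<Rightarrow> real)
    \<Rightarrow> ((nat \<Rightarrow> 'a) \<Rightarrow> ereal) \<Rightarrow> real \<Rightarrow> (nat \<Rightarrow> (nat \<Rightarrow> 'a) \<Rightarrow> 'b) set" where
  "AUset Om Qr S T u G x = {\<phi> \<in> Aset Om Qr S T G x. \<forall>P\<in>Qset Om Qr T.
      (\<integral>\<^sup>+\<omega>. e2ennreal (Uext u \<omega> (ereal (Vt S T x \<phi> \<omega>) - G \<omega>)) \<partial>(completion P)) < \<infinity>}"

definition uval :: "(nat \<Rightarrow> 'a::topological_space set) \<Rightarrow> (nat \<Rightarrow> (nat \<Rightarrow> 'a) \<Rightarrow> 'a measure set)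
    \<Rightarrow> (nat \<Rightarrow> (nat \<Rightarrow> 'a) \<Rightarrow> 'b::euclidean_space) \<Rightarrow> nat \<Rightarrow> ((nat \<Rightarrow> 'a) \<Rightarrow> real \<Rightarrow> real)
    \<Rightarrow> ((nat \<Rightarrow> 'a) \<Rightarrow> ereal) \<Rightarrow> real \<Rightarrow> ereal" where
  "uval Om Qr S T u G x = (SUP \<phi>\<in>AUset Om Qr S T u G x. INF P\<in>Qset Om Qr T.
      Eext P (\<lambda>\<omega>. Uext u \<omega> (ereal (Vt S T x \<phi> \<omega>) - G \<omega>)))"

definition pval :: "(nat \<Rightarrow> 'a::topological_space set) \<Rightarrow> (nat \<Rightarrow> (nat \<Rightarrow> 'a) \<Rightarrow> 'a measure set)
    \<Rightarrow> (nat \<Rightarrow> (nat \<Rightarrow> 'a) \<Rightarrow> 'b::euclidean_space) \<Rightarrow> nat \<Rightarrow> ((nat \<Rightarrow> 'a) \<Rightarrow> real \<Rightarrow> real)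
    \<Rightarrow> ((nat \<Rightarrow> 'a) \<Rightarrow> ereal) \<Rightarrow> real \<Rightarrow> ereal" where
  "pval Om Qr S T u G x = Inf (ereal ` {z. uval Om Qr S T u (\<lambda>_. 0) x \<le> uval Om Qr S T u G (x + z)})"

end

(*
  Lower bound. If the prices p_n(G, x0) stayed below some c < pi(G) along a subsequence, near-optimal
  strategies phi_n would satisfy sup_P P(V_T(c + eps, phi_n) < G) -> 0: their positive utility is bounded
  uniformly in n and P, because V_T <= x * K with a process K that has all moments, while by (A6) any wealth
  below x0 - eps is punished arbitrarily hard. By Borel-Cantelli the phi_n eventually superreplicate G
  quasi-surely, and a measurable selection of cluster points, date by date along random subsequences, yields
  one strategy that superreplicates G from c + eps, a contradiction. The upper bound holds because adding a
  superreplicating strategy to any strategy for the zero claim does not lower the utility.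

  Both the bound by K and the passage to the limit need the quasi-sure inequalities at each local prior
  separately. This localisation rests on a measurable selection theorem for analytic graphs, proved with
  Souslin schemes and outer measures; local priors are coded by sequences of integers via quantile functions.
*)
theory Submission
  imports Defs
begin

subsection \<open>Measurable projection and selection\<close>

text \<open>The priors need not have a dominating measure, so the limit strategy cannot come from a
  compactness argument in one space of random variables; it is built history by history. Two
  obstacles shape this. First, positions may be unbounded even when wealth is bounded, because
  components orthogonal to the local price increments cost and earn nothing. Convergence is
  therefore measured by a local seminorm that ignores these components, so that the subspaces
  \<open>Dset\<close> never have to be treated as measurable objects. Second, strategies and wealth
  are only universally measurable, while selection works for measurable sets of pairs of a history
  and a local prior. Hence such functions are exchanged, under one prior \<open>P\<close> at a time,
  for Borel versions; the quasi-sure statement returns because \<open>P\<close> is arbitrary. The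
  random subsequences must also depend on the observed past alone, as their indices enter the
  positions. On the utility side the shortfall bounds hold uniformly over all priors, so one
  sequence of strategies, tuned to utility thresholds \<open>2 ^ k\<close>, has summable failure
  probabilities under every prior simultaneously.\<close>

lemma finite_bounded_lists: "finite {s :: nat list. length s = m \<and> (\<forall>i<m. s ! i \<le> b i)}"
proof (rule finite_subset)
  show "{s :: nat list. length s = m \<and> (\<forall>i<m. s ! i \<le> b i)} \<subseteq> {s. set s \<subseteq> {..sum b {..<m}} \<and> length s = m}"
  proof safe
    fix s :: "nat list" and x assume *: "\<forall>i<length s. s ! i \<le> b i" "x \<in> set s" "m = length s"
    then obtain i where i: "i < length s" "x = s ! i" by (auto simp: in_set_conv_nth)
    then have "x \<le> b i" using * by auto
    also have "b i \<le> sum b {..<length s}" using i by (intro member_le_sum) auto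
    finally show "x \<le> sum b {..<length s}" .
  qed
  show "finite {s :: nat list. set s \<subseteq> {..sum b {..<m}} \<and> length s = m}"
    by (rule finite_lists_length_eq) simp
qed

text \<open>Koenig's lemma with a parameter. \<open>T x\<close> is a tree with at most
  \<open>b i + 1\<close> children at level \<open>i\<close>, so nodes at every level force an
  infinite branch. The leftmost such branch depends measurably on \<open>x\<close>, because being
  extendable to level \<open>m\<close> is a finite disjunction of finite conjunctions of memberships
  in sets \<open>F s\<close>.\<close>

lemma bounded_tree_selection:
  fixes F :: "nat list \<Rightarrow> 'x set" and b :: "nat \<Rightarrow> nat"
  assumes F [measurable]: "\<And>s. F s \<in> sets M"
  defines "T \<equiv> \<lambda>x. {s. (\<forall>i<length s. s ! i \<le> b i) \<and> (\<forall>j\<le>length s. x \<in> F (take j s))}"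
  defines "E \<equiv> {x \<in> space M. \<forall>m. \<exists>s\<in>T x. length s = m}"
  shows "E \<in> sets M"
    and "\<exists>z. z \<in> M \<rightarrow>\<^sub>M PiM UNIV (\<lambda>_. count_space UNIV) \<and> (\<forall>x\<in>E. \<forall>k. x \<in> F (map (z x) [0..<k]))"
proof -
  define ext where "ext x s m \<longleftrightarrow> (\<exists>s'\<in>T x. length s' = m \<and> take (length s) s' = s)" for x s m
  define good where "good x s \<longleftrightarrow> (\<forall>m\<ge>length s. ext x s m)" for x s
  have fin: "finite {s :: nat list. length s = m \<and> (\<forall>i<m. s ! i \<le> b i)}" for m
    by (rule finite_bounded_lists)
  have ext_alt: "ext x s m \<longleftrightarrow> (\<exists>s'\<in>{s :: nat list. length s = m \<and> (\<forall>i<m. s ! i \<le> b i)}.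
      take (length s) s' = s \<and> (\<forall>j\<in>{..m}. x \<in> F (take j s')))" for x s m
    by (auto simp: ext_def T_def)
  have ext_meas [measurable]: "Measurable.pred M (\<lambda>x. ext x s m)" for s m
    unfolding ext_alt by (intro pred_intros_finite fin) (auto intro!: pred_intros_finite pred_intros_logic)
  have good_meas [measurable]: "Measurable.pred M (\<lambda>x. good x s)" for s
    unfolding good_def by measurable
  have E_good: "E = {x \<in> space M. good x []}"
    by (auto simp: E_def good_def ext_def)
  then show "E \<in> sets M"
    by simp
  have ext_mono: "ext x s m'" if "ext x s m" "m' \<le> m" "length s \<le> m'" for x s m m'
  proof -
    from that(1) obtain s' where s': "s' \<in> T x" "length s' = m" "take (length s) s' = s"
      by (auto simp: ext_def)
    have "take m' s' \<in> T x"
      using s' that(2) by (auto simp: T_def min_def)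
    then show ?thesis
      unfolding ext_def using s' that by (intro bexI[of _ "take m' s'"]) (auto simp: min_def)
  qed
  have good_step: "\<exists>i. good x (s @ [i])" if g: "good x s" for x s
  proof (rule ccontr)
    assume "\<nexists>i. good x (s @ [i])"
    then have "\<forall>i. \<exists>m\<ge>Suc (length s). \<not> ext x (s @ [i]) m"
      by (auto simp: good_def)
    then obtain m where m: "\<And>i. m i \<ge> Suc (length s)" "\<And>i. \<not> ext x (s @ [i]) (m i)"
      by metis
    \<comment> \<open>By level \<open>L\<close> every child allowed by \<open>b\<close> has died
      out, yet the node itself still has an extension there, which must pass through one of these
      children.\<close>
    define L where "L = Max (m ` {..b (length s)})"
    have L: "m i \<le> L" if "i \<le> b (length s)" for i
      using that by (auto simp: L_def)
    have "L \<ge> Suc (length s)"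
      using m(1)[of 0] L[of 0] by simp
    with g have "ext x s L" by (auto simp: good_def)
    then obtain s' where s': "s' \<in> T x" "length s' = L" "take (length s) s' = s"
      unfolding ext_def by blast
    define i where "i = s' ! length s"
    have tk: "take (Suc (length s)) s' = s @ [i]"
      using s' \<open>L \<ge> Suc (length s)\<close> by (simp add: take_Suc_conv_app_nth i_def)
    have "i \<le> b (length s)"
      using s' \<open>L \<ge> Suc (length s)\<close> by (auto simp: T_def i_def)
    have "ext x (s @ [i]) L"
      unfolding ext_def using s' tk by (intro bexI[of _ s']) auto
    then have "ext x (s @ [i]) (m i)"
      by (rule ext_mono) (use L[OF \<open>i \<le> b (length s)\<close>] m(1)[of i] in simp_all)
    with m(2) show False by blast
  qed
  define nd where "nd = (\<lambda>x. rec_nat [] (\<lambda>_ s. s @ [LEAST i. good x (s @ [i])]))"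
  have nd_0: "nd x 0 = []" and nd_Suc: "nd x (Suc k) = nd x k @ [LEAST i. good x (nd x k @ [i])]" for x k
    by (simp_all add: nd_def)
  have len: "length (nd x k) = k" for x k
    by (induction k) (simp_all add: nd_0 nd_Suc)
  have nd_meas [measurable]: "(\<lambda>x. nd x k) \<in> M \<rightarrow>\<^sub>M count_space UNIV" for k
  proof (induction k)
    case (Suc k)
    have "(\<lambda>x. s @ [LEAST i. good x (s @ [i])]) \<in> M \<rightarrow>\<^sub>M count_space UNIV" for s
      by measurable
    from measurable_compose_countable[of "\<lambda>s x. s @ [LEAST i. good x (s @ [i])]", OF this Suc]
    show ?case
      by (simp add: nd_Suc)
  qed (simp add: nd_0)
  define z where "z x = (\<lambda>k. nd x (Suc k) ! k)" for x
  have nd_z: "nd x k = map (z x) [0..<k]" for x k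
    by (induction k) (auto simp: nd_0 nd_Suc z_def nth_append len)
  have nd_good: "good x (nd x k)" if "x \<in> E" for x k
  proof (induction k)
    case 0
    then show ?case using that by (simp add: nd_0 E_good)
  next
    case (Suc k)
    from good_step[OF this] show ?case
      unfolding nd_Suc by (rule LeastI_ex)
  qed
  have "x \<in> F (nd x k)" if "x \<in> E" for x k
    using nd_good[OF that, of k] len[of x k] by (fastforce simp: good_def ext_def T_def)
  moreover have "z \<in> M \<rightarrow>\<^sub>M PiM UNIV (\<lambda>_. count_space UNIV)"
    unfolding z_def by (intro measurable_PiM_single') (auto simp: space_PiM)
  ultimately show "\<exists>z. z \<in> M \<rightarrow>\<^sub>M PiM UNIV (\<lambda>_. count_space UNIV) \<and> (\<forall>x\<in>E. \<forall>k. x \<in> F (map (z x) [0..<k]))"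
    by (auto simp: nd_z)
qed

text \<open>This is the capacitability argument. Outer measure is continuous along increasing
  sequences of arbitrary sets, so the entries of a branch can be bounded one after another by
  \<open>b 0\<close>, \<open>b 1\<close>, ..., at a total loss of at most \<open>e\<close>. What
  remains is finitely branching and falls to \<open>bounded_tree_selection\<close>.\<close>

lemma souslin_selection_approx:
  fixes F :: "nat list \<Rightarrow> 'x set"
  assumes F [measurable]: "\<And>s. F s \<in> sets M" and fin: "finite_measure M"
  defines "A \<equiv> {x \<in> space M. \<exists>z. \<forall>k. x \<in> F (map z [0..<k])}"
  assumes e: "0 < (e :: ennreal)"
  shows "\<exists>E z. E \<in> sets M \<and> z \<in> M \<rightarrow>\<^sub>M PiM UNIV (\<lambda>_. count_space UNIV) \<and>
    (\<forall>x\<in>E. \<forall>k. x \<in> F (map (z x) [0..<k])) \<and> outer_measure_of M A \<le> emeasure M E + e"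
proof -
  interpret finite_measure M by fact
  define Ab where "Ab bs = {x \<in> space M. \<exists>z. (\<forall>i<length bs. z i \<le> bs ! i) \<and> (\<forall>k. x \<in> F (map z [0..<k]))}"
    for bs :: "nat list"
  have Ab_sub: "Ab bs \<subseteq> space M" for bs by (auto simp: Ab_def)
  have fin_out: "outer_measure_of M A < \<infinity>"
  proof -
    have "outer_measure_of M A \<le> outer_measure_of M (space M)"
      by (rule outer_measure_of_mono) (auto simp: A_def)
    also have "\<dots> = emeasure M (space M)" by simp
    also have "\<dots> < \<infinity>" by (simp add: less_top[symmetric])
    finally show ?thesis .
  qed
  \<comment> \<open>The same \<open>e\<close> is kept at every step: a strict inequality against the
    supremum over the next bound already holds for one of its terms.\<close>
  have "\<exists>f. \<forall>n. (length (f n) = n \<and> outer_measure_of M A < outer_measure_of M (Ab (f n)) + e) \<and>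
      (\<exists>m. f (Suc n) = f n @ [m])"
  proof (rule dependent_nat_choice)
    have "Ab [] = A" by (simp add: Ab_def A_def)
    moreover have "outer_measure_of M A < outer_measure_of M A + e"
      using fin_out e by (metis add.right_neutral ennreal_add_left_cancel_less infinity_ennreal_def less_top)
    ultimately show "\<exists>x. length x = 0 \<and> outer_measure_of M A < outer_measure_of M (Ab x) + e"
      by auto
  next
    fix bs n assume *: "length bs = n \<and> outer_measure_of M A < outer_measure_of M (Ab bs) + e"
    have Un: "Ab bs = (\<Union>m. Ab (bs @ [m]))"
    proof (intro set_eqI iffI)
      fix x assume "x \<in> Ab bs"
      then obtain z where z: "x \<in> space M" "\<forall>i<length bs. z i \<le> bs ! i" "\<forall>k. x \<in> F (map z [0..<k])"
        by (auto simp: Ab_def)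
      then have "x \<in> Ab (bs @ [z (length bs)])"
        by (auto simp: Ab_def nth_append less_Suc_eq intro!: exI[of _ z])
      then show "x \<in> (\<Union>m. Ab (bs @ [m]))" by auto
    next
      fix x assume "x \<in> (\<Union>m. Ab (bs @ [m]))"
      then obtain m z where z: "x \<in> space M" "\<And>i. i < Suc (length bs) \<Longrightarrow> z i \<le> (bs @ [m]) ! i"
        "\<forall>k. x \<in> F (map z [0..<k])"
        by (auto simp: Ab_def)
      have "z i \<le> bs ! i" if "i < length bs" for i
        using z(2)[of i] that by (simp add: nth_append)
      with z show "x \<in> Ab bs"
        by (auto simp: Ab_def)
    qed
    have inc: "incseq (\<lambda>m. Ab (bs @ [m]))"
      unfolding incseq_def
    proof (intro allI impI subsetI)
      fix m m' :: nat and x assume "m \<le> m'" "x \<in> Ab (bs @ [m])"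
      then obtain z where z: "x \<in> space M" "\<And>i. i < Suc (length bs) \<Longrightarrow> z i \<le> (bs @ [m]) ! i"
        "\<forall>k. x \<in> F (map z [0..<k])"
        by (auto simp: Ab_def)
      have "z i \<le> (bs @ [m']) ! i" if "i < Suc (length bs)" for i
        using z(2)[OF that] that \<open>m \<le> m'\<close> by (auto simp: nth_append split: if_splits)
      with z show "x \<in> Ab (bs @ [m'])"
        by (auto simp: Ab_def)
    qed
    have "outer_measure_of M (Ab bs) = (SUP m. outer_measure_of M (Ab (bs @ [m])))"
      using Un SUP_outer_measure_of_incseq[OF Ab_sub inc] by simp
    then have "outer_measure_of M A < (SUP m. outer_measure_of M (Ab (bs @ [m])) + e)"
      using * by (simp add: ennreal_SUP_add_left)
    then obtain m where "outer_measure_of M A < outer_measure_of M (Ab (bs @ [m])) + e"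
      by (auto simp: less_SUP_iff)
    then show "\<exists>y. (length y = Suc n \<and> outer_measure_of M A < outer_measure_of M (Ab y) + e) \<and> (\<exists>m. y = bs @ [m])"
      using * by (intro exI[of _ "bs @ [m]"]) auto
  qed
  then obtain f where f: "\<And>n. length (f n) = n" "\<And>n. outer_measure_of M A < outer_measure_of M (Ab (f n)) + e"
    "\<And>n. \<exists>m. f (Suc n) = f n @ [m]" by blast
  define b where "b i = f (Suc i) ! i" for i
  have f_b: "f n = map b [0..<n]" for n
  proof (induction n)
    case (Suc n)
    with f(3)[of n] f(1)[of n] show ?case by (auto simp: b_def nth_append)
  qed (use f(1)[of 0] in simp)
  define T where "T x = {s. (\<forall>i<length s. s ! i \<le> b i) \<and> (\<forall>j\<le>length s. x \<in> F (take j s))}" for x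
  \<comment> \<open>The measurability of \<open>Ab (f m)\<close> is unknown. \<open>Em m\<close>
    asks only for a node at level \<open>m\<close>; these sets are measurable, contain
    \<open>Ab (f m)\<close>, and decrease to \<open>E\<close>.\<close>
  define Em where "Em m = {x \<in> space M. \<exists>s\<in>T x. length s = m}" for m
  define E where "E = {x \<in> space M. \<forall>m. \<exists>s\<in>T x. length s = m}"
  note bt = bounded_tree_selection[of F M b, OF F, folded T_def E_def]
  have fin: "finite {s :: nat list. length s = m \<and> (\<forall>i<m. s ! i \<le> b i)}" for m
    by (rule finite_bounded_lists)
  have Em_alt: "Em m = {x \<in> space M. \<exists>s\<in>{s :: nat list. length s = m \<and> (\<forall>i<m. s ! i \<le> b i)}.
      \<forall>j\<in>{..m}. x \<in> F (take j s)}" for m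
    by (auto simp: Em_def T_def)
  have Em_meas: "Em m \<in> sets M" for m
    unfolding Em_alt pred_def[symmetric]
    by (intro pred_intros_finite fin) (auto intro!: pred_intros_finite pred_intros_logic)
  have "decseq Em"
    unfolding decseq_def
  proof (intro allI impI subsetI)
    fix m n x assume "m \<le> n" "x \<in> Em n"
    then obtain s where "x \<in> space M" "s \<in> T x" "length s = n" by (auto simp: Em_def)
    with \<open>m \<le> n\<close> have "take m s \<in> T x" "length (take m s) = m" by (auto simp: T_def min_def)
    with \<open>x \<in> space M\<close> show "x \<in> Em m" unfolding Em_def by blast
  qed
  moreover have "(\<Inter>m. Em m) = E" by (auto simp: Em_def E_def)
  ultimately have lim: "(INF m. emeasure M (Em m)) = emeasure M E"
    using INF_emeasure_decseq[of Em M] Em_meas by auto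
  have "outer_measure_of M A \<le> emeasure M (Em m) + e" for m
  proof -
    have "Ab (f m) \<subseteq> Em m"
    proof
      fix x assume "x \<in> Ab (f m)"
      then obtain z where z: "x \<in> space M" "\<forall>i<m. z i \<le> b i" "\<forall>k. x \<in> F (map z [0..<k])"
        by (auto simp: Ab_def f_b)
      then have "map z [0..<m] \<in> T x"
        by (auto simp: T_def take_map)
      then show "x \<in> Em m"
        using z(1) by (force simp: Em_def)
    qed
    then have "outer_measure_of M (Ab (f m)) \<le> emeasure M (Em m)"
      using outer_measure_of_mono[of "Ab (f m)" "Em m" M] Em_meas by simp
    then show ?thesis
      using f(2)[of m] by (meson add_right_mono order.strict_implies_order order.trans)
  qed
  then have "outer_measure_of M A \<le> (INF m. emeasure M (Em m) + e)"
    by (rule INF_greatest)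
  also have "\<dots> = emeasure M E + e"
    by (simp add: lim[symmetric] INF_ennreal_add_const)
  finally show ?thesis
    using bt by blast
qed

text \<open>Glueing the approximations for the errors 1/(n+1) gives a subset \<open>EE\<close> of
  \<open>A\<close> with the same outer measure as \<open>A\<close>; a measurable hull of
  \<open>A\<close> then exceeds \<open>EE\<close> by a null set only.\<close>

lemma souslin_selection:
  fixes F :: "nat list \<Rightarrow> 'x set"
  assumes F [measurable]: "\<And>s. F s \<in> sets M" and fin: "finite_measure M"
  defines "A \<equiv> {x \<in> space M. \<exists>z. \<forall>k. x \<in> F (map z [0..<k])}"
  shows "\<exists>E z N. E \<in> sets M \<and> z \<in> M \<rightarrow>\<^sub>M PiM UNIV (\<lambda>_. count_space UNIV) \<and>
    (\<forall>x\<in>E. \<forall>k. x \<in> F (map (z x) [0..<k])) \<and> N \<in> null_sets M \<and> A \<subseteq> E \<union> N"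
proof -
  interpret finite_measure M by fact
  have "\<exists>E z. E \<in> sets M \<and> z \<in> M \<rightarrow>\<^sub>M PiM UNIV (\<lambda>_. count_space UNIV) \<and>
    (\<forall>x\<in>E. \<forall>k. x \<in> F (map (z x) [0..<k])) \<and> outer_measure_of M A \<le> emeasure M E + ennreal (1 / Suc n)" for n
    unfolding A_def by (rule souslin_selection_approx[OF F fin]) auto
  then obtain E z where E: "\<And>n. E n \<in> sets M" and z [measurable]: "\<And>n. z n \<in> M \<rightarrow>\<^sub>M PiM UNIV (\<lambda>_. count_space UNIV)"
    and sel: "\<And>n x k. x \<in> E n \<Longrightarrow> x \<in> F (map (z n x) [0..<k])"
    and out: "\<And>n. outer_measure_of M A \<le> emeasure M (E n) + ennreal (1 / Suc n)"
    by metis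
  note E [measurable]
  define EE where "EE = (\<Union>n. E n)"
  define zz where "zz x = z (LEAST n. x \<in> E n) x" for x
  have EE [measurable]: "EE \<in> sets M" by (simp add: EE_def)
  have "zz \<in> M \<rightarrow>\<^sub>M PiM UNIV (\<lambda>_. count_space UNIV)"
    unfolding zz_def
    by (rule measurable_compose_countable[where g="\<lambda>x. LEAST n. x \<in> E n"]) measurable
  moreover have selE: "\<And>x k. x \<in> EE \<Longrightarrow> x \<in> F (map (zz x) [0..<k])"
  proof -
    fix x k assume that: "x \<in> EE"
    have "x \<in> E (LEAST n. x \<in> E n)"
      using that by (auto simp: EE_def intro: LeastI)
    then show "x \<in> F (map (zz x) [0..<k])" by (simp add: sel zz_def)
  qed
  moreover
  have out': "outer_measure_of M A \<le> emeasure M EE"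
  proof (rule ennreal_le_epsilon)
    fix e :: real assume "0 < e"
    then obtain n where "1 / Suc n < e" by (metis nat_approx_posE)
    have "outer_measure_of M A \<le> emeasure M (E n) + ennreal (1 / Suc n)" by (rule out)
    also have "\<dots> \<le> emeasure M EE + ennreal e"
      using \<open>1 / Suc n < e\<close> by (intro add_mono emeasure_mono ennreal_leI) (auto simp: EE_def)
    finally show "outer_measure_of M A \<le> emeasure M EE + ennreal e" .
  qed
  have "A \<subseteq> space M" by (auto simp: A_def)
  then obtain B where B [measurable]: "A \<subseteq> B" "B \<in> sets M" "outer_measure_of M A = emeasure M B"
    by (metis outer_measure_of_attain)
  have EA: "EE \<subseteq> A"
    using selE sets.sets_into_space[OF EE] by (auto simp: A_def)
  have "emeasure M (B - EE) = emeasure M B - emeasure M EE"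
    using EA B by (intro emeasure_Diff) auto
  then have "emeasure M (B - EE) = 0"
    using out' B by (simp add: diff_eq_0_iff_ennreal less_top[symmetric])
  then have "B - EE \<in> null_sets M" by auto
  moreover have "A \<subseteq> EE \<union> (B - EE)" using B by auto
  ultimately show ?thesis using EE by blast
qed

section \<open>Measurable sets over a product with Baire space as Souslin schemes\<close>

abbreviation baire :: "(nat \<Rightarrow> nat) measure" where
  "baire \<equiv> PiM UNIV (\<lambda>_. count_space UNIV)"

text \<open>Each condition H c is decided by a finite part of (y, \<sigma>), with a measurable set of x; a
  countable conjunction of such conditions under a quantifier over \<sigma> is a Souslin scheme.\<close>

definition souslin_rep :: "'x measure \<Rightarrow> ('x \<times> (nat \<Rightarrow> nat)) set \<Rightarrow>
    (nat \<Rightarrow> 'x \<Rightarrow> (nat \<Rightarrow> nat) \<Rightarrow> (nat \<Rightarrow> nat) \<Rightarrow> bool) \<Rightarrow> bool" where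
  "souslin_rep M B H \<longleftrightarrow>
     (\<forall>c y \<sigma>. {x \<in> space M. H c x y \<sigma>} \<in> sets M) \<and>
     (\<forall>c y \<sigma>. \<exists>N. \<forall>y' \<sigma>'. (\<forall>i<N. y' i = y i \<and> \<sigma>' i = \<sigma> i) \<longrightarrow> (\<forall>x. H c x y' \<sigma>' = H c x y \<sigma>)) \<and>
     B = {(x, y). x \<in> space M \<and> (\<exists>\<sigma>. \<forall>c. H c x y \<sigma>)}"

definition souslin_over :: "'x measure \<Rightarrow> ('x \<times> (nat \<Rightarrow> nat)) set \<Rightarrow> bool" where
  "souslin_over M B \<longleftrightarrow> (\<exists>H. souslin_rep M B H)"

lemma souslin_over_basic:
  assumes "\<And>y. {x \<in> space M. (x, y) \<in> B} \<in> sets M"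
    and "\<And>y. \<exists>N. \<forall>y'. (\<forall>i<N. y' i = y i) \<longrightarrow> (\<forall>x. (x, y') \<in> B \<longleftrightarrow> (x, y) \<in> B)"
    and "B \<subseteq> space M \<times> UNIV"
  shows "souslin_over M B"
  unfolding souslin_over_def souslin_rep_def
proof (intro exI[of _ "\<lambda>c x y \<sigma>. (x, y) \<in> B"] conjI allI)
  show "\<exists>N. \<forall>y' \<sigma>'. (\<forall>i<N. y' i = y i \<and> \<sigma>' i = \<sigma> i) \<longrightarrow> (\<forall>x. ((x, y') \<in> B) = ((x, y) \<in> B))" for y \<sigma> :: "nat \<Rightarrow> nat"
    using assms(2)[of y] by blast
qed (use assms in auto)

text \<open>The index of the set is stored in \<open>\<sigma> 0\<close>, the witness for that set in
  the remaining entries.\<close>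

lemma souslin_over_UN:
  assumes "\<And>i :: nat. souslin_over M (B i)"
  shows "souslin_over M (\<Union>i. B i)"
proof -
  from assms obtain H where "\<And>i. souslin_rep M (B i) (H i)"
    unfolding souslin_over_def by metis
  then have
    m: "\<And>i c y \<sigma>. {x \<in> space M. H i c x y \<sigma>} \<in> sets M"
    and l: "\<And>i c y \<sigma>. \<exists>N. \<forall>y' \<sigma>'. (\<forall>i<N. y' i = y i \<and> \<sigma>' i = \<sigma> i) \<longrightarrow> (\<forall>x. H i c x y' \<sigma>' = H i c x y \<sigma>)"
    and B: "\<And>i. B i = {(x, y). x \<in> space M \<and> (\<exists>\<sigma>. \<forall>c. H i c x y \<sigma>)}"
    unfolding souslin_rep_def by blast+
  show ?thesis
    unfolding souslin_over_def souslin_rep_def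
  proof (intro exI[of _ "\<lambda>c x y \<sigma>. H (\<sigma> 0) c x y (\<sigma> \<circ> Suc)"] conjI allI)
    fix c :: nat and y \<sigma> :: "nat \<Rightarrow> nat"
    obtain N where N: "\<forall>y' \<sigma>'. (\<forall>i<N. y' i = y i \<and> \<sigma>' i = (\<sigma> \<circ> Suc) i) \<longrightarrow>
        (\<forall>x. H (\<sigma> 0) c x y' \<sigma>' = H (\<sigma> 0) c x y (\<sigma> \<circ> Suc))"
      using l by blast
    show "\<exists>N. \<forall>y' \<sigma>'. (\<forall>i<N. y' i = y i \<and> \<sigma>' i = \<sigma> i) \<longrightarrow>
        (\<forall>x. H (\<sigma>' 0) c x y' (\<sigma>' \<circ> Suc) = H (\<sigma> 0) c x y (\<sigma> \<circ> Suc))"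
    proof (intro exI[of _ "Suc N"] allI impI)
      fix y' \<sigma>' :: "nat \<Rightarrow> nat" and x assume *: "\<forall>i<Suc N. y' i = y i \<and> \<sigma>' i = \<sigma> i"
      then have **: "\<sigma>' 0 = \<sigma> 0" "\<forall>i<N. y' i = y i \<and> (\<sigma>' \<circ> Suc) i = (\<sigma> \<circ> Suc) i" by auto
      from N[rule_format, OF **(2)[rule_format]] show "H (\<sigma>' 0) c x y' (\<sigma>' \<circ> Suc) = H (\<sigma> 0) c x y (\<sigma> \<circ> Suc)"
        unfolding **(1) .
    qed
  next
    have eq: "(\<exists>i \<sigma>. \<forall>c. H i c x y \<sigma>) \<longleftrightarrow> (\<exists>\<sigma>. \<forall>c. H (\<sigma> 0) c x y (\<sigma> \<circ> Suc))" for x y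
    proof safe
      fix i \<sigma> assume "\<forall>c. H i c x y \<sigma>"
      then show "\<exists>\<sigma>. \<forall>c. H (\<sigma> 0) c x y (\<sigma> \<circ> Suc)"
        by (intro exI[of _ "case_nat i \<sigma>"]) (simp add: comp_def)
    qed blast
    have "(\<Union>i. B i) = {(x, y). x \<in> space M \<and> (\<exists>i \<sigma>. \<forall>c. H i c x y \<sigma>)}"
      unfolding B by blast
    then show "(\<Union>i. B i) = {(x, y). x \<in> space M \<and> (\<exists>\<sigma>. \<forall>c. H (\<sigma> 0) c x y (\<sigma> \<circ> Suc))}"
      by (simp only: eq)
  qed (rule m)
qed

text \<open>One sequence carries witnesses for all the sets at once: the \<open>i\<close>-th sits at
  the places \<open>prod_encode (i, j)\<close>, and the conditions are enumerated by pairs in the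
  same way.\<close>

lemma souslin_over_INT:
  assumes "\<And>i :: nat. souslin_over M (B i)"
  shows "souslin_over M (\<Inter>i. B i)"
proof -
  from assms obtain H where "\<And>i. souslin_rep M (B i) (H i)"
    unfolding souslin_over_def by metis
  then have
    m: "\<And>i c y \<sigma>. {x \<in> space M. H i c x y \<sigma>} \<in> sets M"
    and l: "\<And>i c y \<sigma>. \<exists>N. \<forall>y' \<sigma>'. (\<forall>i<N. y' i = y i \<and> \<sigma>' i = \<sigma> i) \<longrightarrow> (\<forall>x. H i c x y' \<sigma>' = H i c x y \<sigma>)"
    and B: "\<And>i. B i = {(x, y). x \<in> space M \<and> (\<exists>\<sigma>. \<forall>c. H i c x y \<sigma>)}"
    unfolding souslin_rep_def by blast+
  define p where "p \<sigma> i = (\<lambda>j. \<sigma> (prod_encode (i, j)))" for \<sigma> :: "nat \<Rightarrow> nat" and i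
  show ?thesis
    unfolding souslin_over_def souslin_rep_def
  proof (intro exI[of _ "\<lambda>c x y \<sigma>. H (fst (prod_decode c)) (snd (prod_decode c)) x y (p \<sigma> (fst (prod_decode c)))"] conjI allI)
    fix c :: nat and y \<sigma> :: "nat \<Rightarrow> nat"
    define i c' where "i = fst (prod_decode c)" and "c' = snd (prod_decode c)"
    obtain N where N: "\<forall>y' \<sigma>'. (\<forall>j<N. y' j = y j \<and> \<sigma>' j = p \<sigma> i j) \<longrightarrow>
        (\<forall>x. H i c' x y' \<sigma>' = H i c' x y (p \<sigma> i))"
      using l by blast
    \<comment> \<open>Large enough that agreement below \<open>N'\<close> fixes both
      \<open>y\<close> and the \<open>i\<close>-th witness below \<open>N\<close>: it exceeds the
      code of every pair \<open>(i, j)\<close> with \<open>j < N\<close>.\<close>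
    define N' where "N' = N + Suc (\<Sum>j<N. prod_encode (i, j))"
    have N': "prod_encode (i, j) < N'" if "j < N" for j
      using member_le_sum[of j "{..<N}" "\<lambda>j. prod_encode (i, j)"] that by (simp add: N'_def)
    show "\<exists>N. \<forall>y' \<sigma>'. (\<forall>i<N. y' i = y i \<and> \<sigma>' i = \<sigma> i) \<longrightarrow>
        (\<forall>x. H i c' x y' (p \<sigma>' i) = H i c' x y (p \<sigma> i))"
    proof (intro exI[of _ N'] allI impI)
      fix y' \<sigma>' :: "nat \<Rightarrow> nat" and x assume *: "\<forall>i<N'. y' i = y i \<and> \<sigma>' i = \<sigma> i"
      then have "\<forall>j<N. y' j = y j \<and> p \<sigma>' i j = p \<sigma> i j" using N' by (auto simp: p_def N'_def)
      from N[rule_format, OF this[rule_format]] show "H i c' x y' (p \<sigma>' i) = H i c' x y (p \<sigma> i)" .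
    qed
  next
    have eq: "(\<forall>i. \<exists>\<sigma>. \<forall>c. H i c x y \<sigma>) \<longleftrightarrow>
       (\<exists>\<sigma>. \<forall>c. H (fst (prod_decode c)) (snd (prod_decode c)) x y (p \<sigma> (fst (prod_decode c))))" for x y
    proof safe
      assume "\<forall>i. \<exists>\<sigma>. \<forall>c. H i c x y \<sigma>"
      then obtain s where s: "\<And>i c. H i c x y (s i)" by metis
      have "p (\<lambda>n. s (fst (prod_decode n)) (snd (prod_decode n))) i = s i" for i
        by (simp add: p_def)
      with s show "\<exists>\<sigma>. \<forall>c. H (fst (prod_decode c)) (snd (prod_decode c)) x y (p \<sigma> (fst (prod_decode c)))"
        by (intro exI[of _ "\<lambda>n. s (fst (prod_decode n)) (snd (prod_decode n))"]) simp
    next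
      fix \<sigma> i assume *: "\<forall>c. H (fst (prod_decode c)) (snd (prod_decode c)) x y (p \<sigma> (fst (prod_decode c)))"
      have "H i c x y (p \<sigma> i)" for c
        using *[rule_format, of "prod_encode (i, c)"] by simp
      then show "\<exists>\<sigma>. \<forall>c. H i c x y \<sigma>" by blast
    qed
    have "(\<Inter>i. B i) = {(x, y). x \<in> space M \<and> (\<forall>i. \<exists>\<sigma>. \<forall>c. H i c x y \<sigma>)}"
      unfolding B by blast
    then show "(\<Inter>i. B i) = {(x, y). x \<in> space M \<and> (\<exists>\<sigma>. \<forall>c. H (fst (prod_decode c)) (snd (prod_decode c)) x y
        (p \<sigma> (fst (prod_decode c))))}"
      by (simp only: eq)
  qed (rule m)
qed

text \<open>Souslin sets are stable under countable unions and intersections but not under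
  complements, so the induction runs over sets that are Souslin together with their complement.
  These form a \<sigma>-algebra for which both projections are measurable.\<close>

lemma souslin_over_sets:
  assumes B: "B \<in> sets (M \<Otimes>\<^sub>M baire)"
  shows "souslin_over M B"
proof -
  define \<Omega> where "\<Omega> = space M \<times> (UNIV :: (nat \<Rightarrow> nat) set)"
  define D where "D = {A. A \<subseteq> \<Omega> \<and> souslin_over M A \<and> souslin_over M (\<Omega> - A)}"
  have alg: "sigma_algebra \<Omega> D"
  proof (rule sigma_algebra_iff2[THEN iffD2], intro conjI ballI allI impI)
    show "{} \<in> D"
      by (auto simp: D_def \<Omega>_def intro!: souslin_over_basic)
  next
    fix A assume "A \<in> D"
    then show "\<Omega> - A \<in> D"
      by (auto simp: D_def double_diff)
  next
    fix A :: "nat \<Rightarrow> _" assume "range A \<subseteq> D"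
    then have *: "A i \<subseteq> \<Omega>" "souslin_over M (A i)" "souslin_over M (\<Omega> - A i)" for i
      unfolding D_def by blast+
    have "souslin_over M (\<Inter>i. \<Omega> - A i)" "souslin_over M (\<Union>i. A i)"
      by (intro souslin_over_INT souslin_over_UN *)+
    moreover have eq: "\<Omega> - (\<Union>i. A i) = (\<Inter>i. \<Omega> - A i)" by auto
    ultimately show "(\<Union>i. A i) \<in> D"
      unfolding D_def mem_Collect_eq eq using *(1) by blast
  next
    show "D \<subseteq> Pow \<Omega>" unfolding D_def by blast
  qed
  define Q where "Q = sigma \<Omega> D"
  have sQ: "sets Q = D" and spQ: "space Q = \<Omega>"
    unfolding Q_def by (simp_all only: sigma_algebra.sets_measure_of_eq[OF alg] space_measure_of_conv)
  have "fst \<in> Q \<rightarrow>\<^sub>M M"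
  proof (rule measurableI)
    fix A assume A: "A \<in> sets M"
    have so: "souslin_over M (A \<times> UNIV)" if A: "A \<in> sets M" for A
    proof (rule souslin_over_basic)
      have "{x \<in> space M. (x, y) \<in> A \<times> (UNIV :: (nat \<Rightarrow> nat) set)} = A" for y
        using sets.sets_into_space[OF A] by blast
      then show "{x \<in> space M. (x, y) \<in> A \<times> (UNIV :: (nat \<Rightarrow> nat) set)} \<in> sets M" for y
        using A by (simp only:)
      show "\<exists>N. \<forall>y'. (\<forall>i<N. y' i = y i) \<longrightarrow> (\<forall>x. ((x, y') \<in> A \<times> UNIV) = ((x, y) \<in> A \<times> UNIV))"
        for y :: "nat \<Rightarrow> nat"
        by (rule exI[of _ 0]) simp
      show "A \<times> UNIV \<subseteq> space M \<times> UNIV"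
        using sets.sets_into_space[OF A] by blast
    qed
    have *: "fst -` A \<inter> \<Omega> = A \<times> UNIV" "\<Omega> - A \<times> UNIV = (space M - A) \<times> UNIV" "A \<times> UNIV \<subseteq> \<Omega>"
      using sets.sets_into_space[OF A] by (auto simp: \<Omega>_def)
    show "fst -` A \<inter> space Q \<in> sets Q"
      unfolding sQ spQ *(1) D_def mem_Collect_eq *(2)
      by (intro conjI so[OF A] so[OF sets.compl_sets[OF A]] *(3))
  qed (simp add: spQ \<Omega>_def mem_Times_iff)
  moreover have "snd \<in> Q \<rightarrow>\<^sub>M baire"
  proof (rule measurable_PiM_single')
    fix i
    show "(\<lambda>w. snd w i) \<in> Q \<rightarrow>\<^sub>M count_space UNIV"
    proof (rule measurableI)
      fix A :: "nat set"
      have s: "souslin_over M {w \<in> \<Omega>. snd w i \<in> A}" for A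
      proof (rule souslin_over_basic)
        show "{x \<in> space M. (x, y) \<in> {w \<in> \<Omega>. snd w i \<in> A}} \<in> sets M" for y
          by (cases "y i \<in> A") (simp_all add: \<Omega>_def)
        show "\<exists>N. \<forall>y'. (\<forall>i<N. y' i = y i) \<longrightarrow>
            (\<forall>x. ((x, y') \<in> {w \<in> \<Omega>. snd w i \<in> A}) = ((x, y) \<in> {w \<in> \<Omega>. snd w i \<in> A}))" for y
          by (rule exI[of _ "Suc i"]) (simp add: \<Omega>_def)
      qed (auto simp: \<Omega>_def)
      have *: "(\<lambda>w. snd w i) -` A \<inter> \<Omega> = {w \<in> \<Omega>. snd w i \<in> A}"
        "\<Omega> - {w \<in> \<Omega>. snd w i \<in> A} = {w \<in> \<Omega>. snd w i \<in> - A}"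
        by auto
      show "(\<lambda>w. snd w i) -` A \<inter> space Q \<in> sets Q"
        unfolding sQ spQ *(1) D_def mem_Collect_eq *(2) by (intro conjI s) blast
    qed simp
  qed simp
  ultimately have "(\<lambda>w. (fst w, snd w)) \<in> Q \<rightarrow>\<^sub>M M \<Otimes>\<^sub>M baire"
    by (rule measurable_Pair)
  from measurable_sets[OF this B] have "B \<inter> \<Omega> \<in> D"
    by (simp add: sQ spQ)
  moreover have "B \<subseteq> \<Omega>"
    using sets.sets_into_space[OF B] by (simp add: \<Omega>_def space_pair_measure space_PiM)
  ultimately show ?thesis
    by (simp add: D_def Int_absorb2)
qed

text \<open>A point \<open>y\<close> and a witness \<open>\<sigma>\<close> are interleaved into one
  sequence \<open>z\<close>. By the locality clause of \<open>souslin_rep\<close> every condition is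
  decided by some finite prefix of \<open>z\<close>, so membership in \<open>B\<close> becomes
  survival along a branch of the scheme \<open>F\<close>.\<close>

lemma measurable_selection_baire:
  assumes B: "B \<in> sets (M \<Otimes>\<^sub>M baire)" and fin: "finite_measure M"
  shows "\<exists>E f N. E \<in> sets M \<and> f \<in> M \<rightarrow>\<^sub>M baire \<and> (\<forall>x\<in>E. (x, f x) \<in> B) \<and> N \<in> null_sets M \<and> fst ` B \<subseteq> E \<union> N"
proof -
  from souslin_over_sets[OF B] obtain H where "souslin_rep M B H"
    unfolding souslin_over_def ..
  then have
    m: "\<And>c y \<sigma>. {x \<in> space M. H c x y \<sigma>} \<in> sets M"
    and l: "\<And>c y \<sigma>. \<exists>N. \<forall>y' \<sigma>'. (\<forall>i<N. y' i = y i \<and> \<sigma>' i = \<sigma> i) \<longrightarrow> (\<forall>x. H c x y' \<sigma>' = H c x y \<sigma>)"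
    and Beq: "B = {(x, y). x \<in> space M \<and> (\<exists>\<sigma>. \<forall>c. H c x y \<sigma>)}"
    unfolding souslin_rep_def by blast+
  define y\<^sub>1 where "y\<^sub>1 z = (\<lambda>j. z (2 * j))" for z :: "nat \<Rightarrow> nat"
  define \<sigma>\<^sub>1 where "\<sigma>\<^sub>1 z = (\<lambda>j. z (2 * j + 1))" for z :: "nat \<Rightarrow> nat"
  define H' where "H' c x z = H c x (y\<^sub>1 z) (\<sigma>\<^sub>1 z)" for c x z
  \<comment> \<open>\<open>det s c\<close> means that the prefix \<open>s\<close> already decides
    condition \<open>c\<close> at every \<open>x\<close>. Undecided conditions put no constraint on
    \<open>F s\<close>, and the zeros with which \<open>ex s\<close> pads \<open>s\<close> do not
    affect the decided ones.\<close>
  define det where "det s c \<longleftrightarrow> (\<forall>z z' x. map z [0..<length s] = s \<longrightarrow> map z' [0..<length s] = s \<longrightarrow> H' c x z = H' c x z')"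
    for s c
  define ex where "ex s = (\<lambda>i. if i < length s then s ! i else 0)" for s :: "nat list"
  define F where "F s = {x \<in> space M. \<forall>c\<in>{..<length s}. det s c \<longrightarrow> H' c x (ex s)}" for s
  have F: "F s \<in> sets M" for s
    unfolding F_def by (intro sets.sets_Collect_finite_All sets.sets_Collect) (auto simp: H'_def m)
  have ex: "map (ex s) [0..<length s] = s" for s
    by (rule nth_equalityI) (auto simp: ex_def)
  have key: "(\<forall>k. x \<in> F (map z [0..<k])) \<longleftrightarrow> x \<in> space M \<and> (\<forall>c. H' c x z)" for x z
  proof safe
    fix c assume *: "\<forall>k. x \<in> F (map z [0..<k])"
    from l[of "y\<^sub>1 z" "\<sigma>\<^sub>1 z" c] obtain N where
      N: "\<forall>y' \<sigma>'. (\<forall>i<N. y' i = y\<^sub>1 z i \<and> \<sigma>' i = \<sigma>\<^sub>1 z i) \<longrightarrow> (\<forall>x. H c x y' \<sigma>' = H c x (y\<^sub>1 z) (\<sigma>\<^sub>1 z))" ..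
    \<comment> \<open>\<open>k > c\<close> puts condition \<open>c\<close> among those tested by
      \<open>F\<close>, and \<open>k > 2 * N\<close> fixes the first \<open>N\<close> entries of
      both halves of \<open>z\<close>.\<close>
    define k where "k = Suc (c + 2 * N)"
    have eq: "H' c x z' = H' c x z" if "map z' [0..<k] = map z [0..<k]" for z' x
    proof -
      have "z' i = z i" if "i < k" for i
        using \<open>map z' [0..<k] = map z [0..<k]\<close> that by (auto simp: map_eq_conv)
      then show ?thesis
        unfolding H'_def by (intro N[rule_format]) (simp_all add: y\<^sub>1_def \<sigma>\<^sub>1_def k_def)
    qed
    have "det (map z [0..<k]) c"
      unfolding det_def
    proof (intro allI impI)
      fix z1 z2 x
      assume "map z1 [0..<length (map z [0..<k])] = map z [0..<k]" "map z2 [0..<length (map z [0..<k])] = map z [0..<k]"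
      then have "map z1 [0..<k] = map z [0..<k]" "map z2 [0..<k] = map z [0..<k]" by (simp_all only: length_map length_upt diff_zero)
      then show "H' c x z1 = H' c x z2" using eq by metis
    qed
    moreover have "x \<in> F (map z [0..<k])" using * by blast
    ultimately have "H' c x (ex (map z [0..<k]))"
      by (auto simp: F_def k_def)
    moreover have "map (ex (map z [0..<k])) [0..<k] = map z [0..<k]"
      using ex[of "map z [0..<k]"] by (simp only: length_map length_upt diff_zero)
    ultimately show "H' c x z"
      using eq by blast
  next
    fix k assume *: "\<forall>c. H' c x z" "x \<in> space M"
    have "H' c x (ex (map z [0..<k]))" if "det (map z [0..<k]) c" for c
    proof -
      have "map z [0..<length (map z [0..<k])] = map z [0..<k]" by (simp only: length_map length_upt diff_zero)
      with that[unfolded det_def] ex[of "map z [0..<k]"] have "H' c x (ex (map z [0..<k])) = H' c x z" by blast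
      then show ?thesis using * by simp
    qed
    then show "x \<in> F (map z [0..<k])"
      using * by (auto simp: F_def)
  qed (auto simp: F_def)
  have A: "{x \<in> space M. \<exists>z. \<forall>k. x \<in> F (map z [0..<k])} = fst ` B"
  proof (intro set_eqI iffI)
    fix x assume "x \<in> fst ` B"
    then obtain y \<sigma> where "x \<in> space M" "\<forall>c. H c x y \<sigma>" unfolding Beq by auto
    moreover define z where "z n = (if even n then y (n div 2) else \<sigma> (n div 2))" for n
    have "y\<^sub>1 z = y" "\<sigma>\<^sub>1 z = \<sigma>" by (auto simp: y\<^sub>1_def \<sigma>\<^sub>1_def z_def)
    ultimately show "x \<in> {x \<in> space M. \<exists>z. \<forall>k. x \<in> F (map z [0..<k])}"
      unfolding key H'_def by (intro CollectI conjI exI[of _ z]) simp_all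
  next
    fix x assume "x \<in> {x \<in> space M. \<exists>z. \<forall>k. x \<in> F (map z [0..<k])}"
    then obtain z where "x \<in> space M" "\<forall>c. H' c x z" unfolding key by auto
    then have "(x, y\<^sub>1 z) \<in> B" by (auto simp: Beq H'_def)
    then show "x \<in> fst ` B" by force
  qed
  obtain E z N where
    E: "E \<in> sets M" and z [measurable]: "z \<in> M \<rightarrow>\<^sub>M baire" and sel: "\<forall>x\<in>E. \<forall>k. x \<in> F (map (z x) [0..<k])"
    and N: "N \<in> null_sets M" "fst ` B \<subseteq> E \<union> N"
    using souslin_selection[of F M, OF F fin] unfolding A by (elim exE conjE) (rule that)
  have "(x, y\<^sub>1 (z x)) \<in> B" if "x \<in> E" for x
    using sel[rule_format, OF that] key[of x "z x"] unfolding Beq H'_def by blast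
  moreover have "(\<lambda>x. y\<^sub>1 (z x)) \<in> M \<rightarrow>\<^sub>M baire"
    unfolding y\<^sub>1_def by (intro measurable_PiM_single') (auto simp: space_PiM)
  ultimately show ?thesis
    using E N by blast
qed

section \<open>Measurable images of Baire space\<close>

definition baire_image :: "'y measure \<Rightarrow> bool" where
  "baire_image Y \<longleftrightarrow> (\<exists>d \<in> baire \<rightarrow>\<^sub>M Y. space Y \<subseteq> range d)"

text \<open>The selection is made in Baire space, for the pullback of \<open>B\<close> along the
  parametrisation \<open>d\<close> of \<open>Y\<close>, and then sent back to \<open>Y\<close> by
  \<open>d\<close>. Surjectivity of \<open>d\<close> keeps the projection of \<open>B\<close>
  unchanged.\<close>

theorem measurable_selection:
  assumes B: "B \<in> sets (M \<Otimes>\<^sub>M Y)" and fin: "finite_measure M" and Y: "baire_image Y"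
  shows "\<exists>E f N. E \<in> sets M \<and> f \<in> M \<rightarrow>\<^sub>M Y \<and> (\<forall>x\<in>E. (x, f x) \<in> B) \<and> N \<in> null_sets M \<and> fst ` B \<subseteq> E \<union> N"
proof -
  from Y obtain d where d [measurable]: "d \<in> baire \<rightarrow>\<^sub>M Y" and surj: "space Y \<subseteq> range d"
    unfolding baire_image_def by (elim bexE) (rule that)
  define B' where "B' = (\<lambda>(x, y). (x, d y)) -` B \<inter> space (M \<Otimes>\<^sub>M baire)"
  have "B' \<in> sets (M \<Otimes>\<^sub>M baire)"
    unfolding B'_def by (rule measurable_sets[OF _ B]) measurable
  obtain E f N where
    E: "E \<in> sets M" and f [measurable]: "f \<in> M \<rightarrow>\<^sub>M baire" and sel: "\<forall>x\<in>E. (x, f x) \<in> B'"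
    and N: "N \<in> null_sets M" "fst ` B' \<subseteq> E \<union> N"
    using measurable_selection_baire[OF \<open>B' \<in> _\<close> fin] by (elim exE conjE) (rule that)
  have s1: "fst ` B \<subseteq> fst ` B'"
  proof
    fix x assume "x \<in> fst ` B"
    then obtain y where xy: "(x, y) \<in> B" by auto
    then have "x \<in> space M" "y \<in> space Y"
      using sets.sets_into_space[OF B] by (auto simp: space_pair_measure)
    moreover then obtain z where "y = d z" using surj by auto
    ultimately have "(x, z) \<in> B'" using xy by (auto simp: B'_def space_pair_measure space_PiM)
    then show "x \<in> fst ` B'" by force
  qed
  have s2: "(x, d (f x)) \<in> B" if "x \<in> E" for x
    using sel that by (auto simp: B'_def)
  have s3: "(\<lambda>x. d (f x)) \<in> M \<rightarrow>\<^sub>M Y" by measurable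
  show ?thesis
    by (rule exI[of _ E], rule exI[of _ "\<lambda>x. d (f x)"], rule exI[of _ N],
      intro conjI E N(1) s3 ballI s2 order.trans[OF s1 N(2)])
qed

lemma baire_image_compose:
  assumes Y: "baire_image Y" and g: "g \<in> Y \<rightarrow>\<^sub>M Z" and surj: "\<And>z. z \<in> space Z \<Longrightarrow> \<exists>y\<in>space Y. g y = z"
  shows "baire_image Z"
proof -
  from Y obtain d where d: "d \<in> baire \<rightarrow>\<^sub>M Y" "space Y \<subseteq> range d"
    unfolding baire_image_def by (elim bexE) (rule that)
  have "space Z \<subseteq> range (g \<circ> d)"
  proof
    fix z assume "z \<in> space Z"
    from surj[OF this] obtain y where "y \<in> space Y" "g y = z" by blast
    moreover from this d(2) obtain w where "y = d w" by blast
    ultimately have "z = (g \<circ> d) w" by simp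
    then show "z \<in> range (g \<circ> d)" by (metis rangeI)
  qed
  then show ?thesis
    unfolding baire_image_def using measurable_comp[OF d(1) g] by (intro bexI[of _ "g \<circ> d"])
qed

lemma baire_image_PiM:
  assumes Y: "baire_image Y"
  shows "baire_image (PiM (UNIV :: nat set) (\<lambda>_. Y))"
proof -
  from Y obtain d where d [measurable]: "d \<in> baire \<rightarrow>\<^sub>M Y" and surj: "space Y \<subseteq> range d"
    unfolding baire_image_def by (elim bexE) (rule that)
  define D where "D z = (\<lambda>i::nat. d (\<lambda>j. z (prod_encode (i, j))))" for z :: "nat \<Rightarrow> nat"
  have "D \<in> baire \<rightarrow>\<^sub>M PiM UNIV (\<lambda>_. Y)"
  proof (rule measurable_PiM_single')
    show "(\<lambda>z. D z i) \<in> baire \<rightarrow>\<^sub>M Y" for i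
      unfolding D_def
    proof (rule measurable_compose[OF _ d])
      show "(\<lambda>z j. z (prod_encode (i, j))) \<in> baire \<rightarrow>\<^sub>M baire"
        by (rule measurable_PiM_single') (auto simp: space_PiM)
    qed
    then show "D \<in> space baire \<rightarrow> UNIV \<rightarrow>\<^sub>E space Y"
      by (auto dest: measurable_space)
  qed
  moreover have "space (PiM UNIV (\<lambda>_. Y)) \<subseteq> range D"
  proof
    fix w assume "w \<in> space (PiM UNIV (\<lambda>_::nat. Y))"
    then have "\<forall>i. \<exists>z. w i = d z"
      using surj by (auto simp: space_PiM PiE_iff)
    then obtain z where z: "\<And>i. w i = d (z i)" by metis
    have "w = D (\<lambda>n. z (fst (prod_decode n)) (snd (prod_decode n)))"
      by (rule ext) (simp add: D_def z)
    then show "w \<in> range D" by (metis rangeI)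
  qed
  ultimately show ?thesis
    unfolding baire_image_def by (intro bexI[of _ D])
qed

lemma baire_image_pair:
  assumes "baire_image Y" "baire_image Z"
  shows "baire_image (Y \<Otimes>\<^sub>M Z)"
proof -
  from assms(1) obtain d where d [measurable]: "d \<in> baire \<rightarrow>\<^sub>M Y" and sd: "space Y \<subseteq> range d"
    unfolding baire_image_def by (elim bexE) (rule that)
  from assms(2) obtain e where e [measurable]: "e \<in> baire \<rightarrow>\<^sub>M Z" and se: "space Z \<subseteq> range e"
    unfolding baire_image_def by (elim bexE) (rule that)
  define D where "D z = (d (\<lambda>j. z (2 * j)), e (\<lambda>j. z (2 * j + 1)))" for z :: "nat \<Rightarrow> nat"
  have "D \<in> baire \<rightarrow>\<^sub>M Y \<Otimes>\<^sub>M Z"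
    unfolding D_def
  proof (rule measurable_Pair)
    show "(\<lambda>z. d (\<lambda>j. z (2 * j))) \<in> baire \<rightarrow>\<^sub>M Y"
      by (rule measurable_compose[OF _ d], rule measurable_PiM_single') (auto simp: space_PiM)
    show "(\<lambda>z. e (\<lambda>j. z (2 * j + 1))) \<in> baire \<rightarrow>\<^sub>M Z"
      by (rule measurable_compose[OF _ e], rule measurable_PiM_single') (auto simp: space_PiM)
  qed
  moreover have "space (Y \<Otimes>\<^sub>M Z) \<subseteq> range D"
  proof
    fix w assume "w \<in> space (Y \<Otimes>\<^sub>M Z)"
    then obtain y z where w: "w = (y, z)" "y \<in> space Y" "z \<in> space Z"
      by (auto simp: space_pair_measure)
    from w(2) sd obtain a where a: "y = d a" by blast
    from w(3) se obtain b where b: "z = e b" by blast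
    have "w = D (\<lambda>n. if even n then a (n div 2) else b (n div 2))"
      by (simp add: D_def w(1) a b)
    then show "w \<in> range D" by (metis rangeI)
  qed
  ultimately show ?thesis
    unfolding baire_image_def by (intro bexI[of _ D])
qed

lemma dense_sequence:
  obtains r :: "nat \<Rightarrow> 'a::{metric_space, second_countable_topology}"
  where "\<And>x e. 0 < e \<Longrightarrow> \<exists>i. dist (r i) x < e"
proof -
  from countable_dense_setE obtain D :: "'a set" where D: "countable D" "\<And>X. open X \<Longrightarrow> X \<noteq> {} \<Longrightarrow> \<exists>d\<in>D. d \<in> X"
    by blast
  have "D \<noteq> {}" using D(2)[of UNIV] by auto
  have "\<exists>i. dist (from_nat_into D i) x < e" if "0 < e" for x and e :: real
  proof -
    from D(2)[of "ball x e"] that obtain d where "d \<in> D" "dist x d < e" by (auto simp: dist_commute)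
    moreover from this obtain i where "d = from_nat_into D i"
      using from_nat_into_surj[OF D(1)] by metis
    ultimately show ?thesis by (auto simp: dist_commute)
  qed
  then show ?thesis by (rule that)
qed

text \<open>Taking limits is made a total operation: an index sequence whose points are not Cauchy
  is replaced by a constant one. Being Cauchy is a countable condition on the indices, so the
  replaced sequences are measurable; completeness makes them converge, and a pointwise limit of
  measurable maps is measurable.\<close>

lemma measurable_limit_selector:
  fixes r :: "nat \<Rightarrow> 'a::polish_space"
  obtains L where "L \<in> baire \<rightarrow>\<^sub>M borel" and "\<And>k x. (\<lambda>j. r (k j)) \<longlonglongrightarrow> x \<Longrightarrow> L k = x"
proof -
  define C where "C k \<longleftrightarrow> (\<forall>n. \<exists>N. \<forall>i j. N \<le> i \<longrightarrow> N \<le> j \<longrightarrow> dist (r (k i)) (r (k j)) < 1 / real (Suc n))"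
    for k :: "nat \<Rightarrow> nat"
  have C_iff: "C k \<longleftrightarrow> Cauchy (\<lambda>j. r (k j))" for k
  proof
    assume C: "C k"
    show "Cauchy (\<lambda>j. r (k j))"
    proof (rule metric_CauchyI)
      fix e :: real assume "0 < e"
      then obtain n where n: "1 / real (Suc n) < e" by (metis nat_approx_posE)
      from C[unfolded C_def] obtain N where "\<forall>i j. N \<le> i \<longrightarrow> N \<le> j \<longrightarrow> dist (r (k i)) (r (k j)) < 1 / real (Suc n)" by blast
      with n show "\<exists>M. \<forall>m\<ge>M. \<forall>n\<ge>M. dist (r (k m)) (r (k n)) < e" by (meson less_trans)
    qed
  next
    assume "Cauchy (\<lambda>j. r (k j))"
    then show "C k"
      unfolding C_def using metric_CauchyD[of "\<lambda>j. r (k j)"] by (metis divide_pos_pos of_nat_0_less_iff zero_less_Suc zero_less_one)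
  qed
  have [measurable]: "Measurable.pred baire C"
    unfolding C_def by measurable
  define f where "f j k = (if C k then r (k j) else r 0)" for j k
  define L where "L k = lim (\<lambda>j. f j k)" for k
  have lim: "(\<lambda>j. f j k) \<longlonglongrightarrow> L k" for k
    unfolding L_def convergent_LIMSEQ_iff[symmetric]
    by (cases "C k") (auto simp: f_def C_iff convergent_const dest: Cauchy_convergent)
  have "L \<in> baire \<rightarrow>\<^sub>M borel"
  proof (rule borel_measurable_LIMSEQ_metric)
    show "f j \<in> borel_measurable baire" for j
      unfolding f_def by measurable
  qed (rule lim)
  moreover have "L k = x" if "(\<lambda>j. r (k j)) \<longlonglongrightarrow> x" for k x
  proof -
    have "C k" using that by (auto simp: C_iff intro!: LIMSEQ_imp_Cauchy)
    with lim[of k] that show ?thesis by (simp add: f_def LIMSEQ_unique)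
  qed
  ultimately show ?thesis by (rule that)
qed

lemma baire_image_borel: "baire_image (borel :: 'a::polish_space measure)"
proof -
  obtain r :: "nat \<Rightarrow> 'a" where r: "\<And>x e. 0 < e \<Longrightarrow> \<exists>i. dist (r i) x < e" by (rule dense_sequence) blast
  obtain L where L: "L \<in> baire \<rightarrow>\<^sub>M borel" "\<And>k x. (\<lambda>j. r (k j)) \<longlonglongrightarrow> x \<Longrightarrow> L k = x"
    by (rule measurable_limit_selector[of r]) blast
  have "\<exists>k. L k = x" for x
  proof -
    have "\<forall>j. \<exists>i. dist (r i) x < 1 / real (Suc j)" using r by simp
    then obtain k where k: "\<And>j. dist (r (k j)) x < 1 / real (Suc j)" by metis
    have "(\<lambda>j. dist (r (k j)) x) \<longlonglongrightarrow> 0"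
      by (rule tendsto_sandwich[OF _ _ tendsto_const LIMSEQ_inverse_real_of_nat])
        (auto intro!: always_eventually simp: less_imp_le[OF k] inverse_eq_divide simp del: of_nat_Suc)
    then show ?thesis using L(2) by (auto simp: tendsto_dist_iff[symmetric])
  qed
  then show ?thesis
    unfolding baire_image_def by (intro bexI[OF _ L(1)]) (metis rangeI subsetI)
qed

text \<open>Base 3 with the digits 0 and 1 excludes carries: after scaling, the tail beyond place
  \<open>n\<close> is at most 1/2, so rounding down isolates the digits up to place
  \<open>n\<close>. Base 2 would leave double expansions.\<close>

lemma ternary_digit:
  fixes b :: "nat \<Rightarrow> bool"
  defines "y \<equiv> (\<Sum>i. of_bool (b i) * (1 / 3 :: real) ^ Suc i)"
  shows "\<lfloor>3 ^ Suc n * y\<rfloor> mod 3 = 1 \<longleftrightarrow> b n"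
proof -
  define t where "t i = of_bool (b i) * (1 / 3 :: real) ^ Suc i" for i
  have y_t: "y = suminf t"
    unfolding y_def t_def ..
  have gs: "(\<lambda>i. (1 / 3 :: real) ^ Suc i) sums (1 / 2)"
    using sums_mult[OF geometric_sums[of "1 / 3 :: real"], of "1 / 3"] by simp
  have t_le: "t i \<le> (1 / 3) ^ Suc i" and t_0: "0 \<le> t i" for i
    by (auto simp: t_def)
  have st: "summable t"
    by (rule summable_comparison_test'[OF sums_summable[OF gs], of 0]) (use t_le t_0 in auto)
  have split: "y = (\<Sum>i. t (i + Suc n)) + (\<Sum>i<Suc n. t i)"
    unfolding y_t by (rule suminf_split_initial_segment[OF st])
  have tail_eq: "3 ^ Suc n * (\<Sum>i. t (i + Suc n)) = (\<Sum>i. 3 ^ Suc n * t (i + Suc n))"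
    by (rule suminf_mult[symmetric]) (use st in \<open>simp add: summable_iff_shift del: add_Suc_right\<close>)
  have sc: "3 ^ Suc n * t (i + Suc n) \<le> (1 / 3) ^ Suc i" for i
  proof -
    have "3 ^ Suc n * t (i + Suc n) \<le> 3 ^ Suc n * (1 / 3) ^ Suc (i + Suc n)"
      by (intro mult_left_mono t_le) auto
    also have "\<dots> = (1 / 3) ^ Suc i * (3 ^ Suc n * (1 / 3) ^ Suc n)"
      by (simp only: add_Suc[symmetric] power_add mult_ac)
    also have "3 ^ Suc n * (1 / 3) ^ Suc n = (1 :: real)"
      by (simp only: power_mult_distrib[symmetric]) simp
    finally show ?thesis by simp
  qed
  have s': "summable (\<lambda>i. 3 ^ Suc n * t (i + Suc n))"
    by (rule summable_comparison_test'[OF sums_summable[OF gs], of 0]) (use sc t_0 in auto)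
  have tail: "0 \<le> 3 ^ Suc n * (\<Sum>i. t (i + Suc n))" "3 ^ Suc n * (\<Sum>i. t (i + Suc n)) \<le> 1 / 2"
    unfolding tail_eq using suminf_le[OF sc s' sums_summable[OF gs]] sums_unique[OF gs] suminf_nonneg[OF s'] t_0
    by auto
  define m where "m = (\<Sum>i<n. (of_bool (b i) :: int) * 3 ^ (n - Suc i))"
  have "3 ^ Suc n * (\<Sum>i<Suc n. t i) = (\<Sum>i<Suc n. of_bool (b i) * 3 ^ (n - i))"
    unfolding sum_distrib_left
  proof (rule sum.cong[OF refl])
    fix i assume "i \<in> {..<Suc n}"
    then have "(3 :: real) ^ Suc n = 3 ^ (n - i) * 3 ^ Suc i"
      by (simp add: power_add[symmetric])
    then show "3 ^ Suc n * t i = of_bool (b i) * 3 ^ (n - i)"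
      by (simp add: t_def power_divide)
  qed
  also have "\<dots> = (\<Sum>i<n. of_bool (b i) * 3 ^ Suc (n - Suc i)) + of_bool (b n)"
    by (auto intro!: sum.cong simp: Suc_diff_Suc simp del: power_Suc)
  also have "\<dots> = of_int (3 * m + of_bool (b n))"
  proof -
    have "real_of_int m = (\<Sum>i<n. of_bool (b i) * 3 ^ (n - Suc i))"
      unfolding m_def of_int_sum by (intro sum.cong) simp_all
    moreover have "(\<Sum>i<n. of_bool (b i) * (3 :: real) ^ Suc (n - Suc i)) = 3 * (\<Sum>i<n. of_bool (b i) * 3 ^ (n - Suc i))"
      by (simp only: sum_distrib_left power_Suc mult_ac)
    ultimately show ?thesis by simp
  qed
  finally have "3 ^ Suc n * y = of_int (3 * m + of_bool (b n)) + 3 ^ Suc n * (\<Sum>i. t (i + Suc n))"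
    by (simp add: split distrib_left)
  then have "\<lfloor>3 ^ Suc n * y\<rfloor> = 3 * m + of_bool (b n)"
    using tail by (intro floor_unique) auto
  then show ?thesis
    by (cases "b n") (auto simp: mod_mult_self4)
qed

text \<open>A point \<open>x\<close> is encoded by the truth values of all statements
  \<open>dist (r i) x < 1 / (j + 1)\<close>, written as ternary digits. Decoding looks up, for each
  \<open>j\<close>, the least \<open>i\<close> whose digit is 1 and takes the limit of the points
  \<open>r i\<close> so found.\<close>

lemma polish_real_retract:
  obtains e :: "'a::polish_space \<Rightarrow> real" and d :: "real \<Rightarrow> 'a"
  where "e \<in> borel \<rightarrow>\<^sub>M borel" "d \<in> borel \<rightarrow>\<^sub>M borel" "\<And>x. d (e x) = x"
proof -
  obtain r :: "nat \<Rightarrow> 'a" where r: "\<And>x e. 0 < e \<Longrightarrow> \<exists>i. dist (r i) x < e" by (rule dense_sequence) blast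
  obtain L where L [measurable]: "L \<in> baire \<rightarrow>\<^sub>M borel" and lim: "\<And>k x. (\<lambda>j. r (k j)) \<longlonglongrightarrow> x \<Longrightarrow> L k = x"
    by (rule measurable_limit_selector[of r]) blast
  define b where "b x n \<longleftrightarrow> dist (r (fst (prod_decode n))) x < 1 / real (Suc (snd (prod_decode n)))" for x n
  define e where "e x = (\<Sum>n. of_bool (b x n) * (1 / 3 :: real) ^ Suc n)" for x
  define k where "k y j = (LEAST i. \<lfloor>3 ^ Suc (prod_encode (i, j)) * y\<rfloor> mod 3 = 1)" for y :: real and j
  have kx: "k (e x) j = (LEAST i. dist (r i) x < 1 / real (Suc j))" for x j
    unfolding k_def e_def ternary_digit b_def by simp
  have "dist (r (k (e x) j)) x < 1 / real (Suc j)" for x j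
    unfolding kx by (rule LeastI_ex) (use r in simp)
  note k = this
  have "(\<lambda>j. r (k (e x) j)) \<longlonglongrightarrow> x" for x
  proof -
    have "(\<lambda>j. dist (r (k (e x) j)) x) \<longlonglongrightarrow> 0"
      by (rule tendsto_sandwich[OF _ _ tendsto_const LIMSEQ_inverse_real_of_nat])
        (auto intro!: always_eventually simp: less_imp_le[OF k] inverse_eq_divide simp del: of_nat_Suc)
    then show ?thesis by (simp add: tendsto_dist_iff[symmetric])
  qed
  then have "L (k (e x)) = x" for x by (rule lim)
  moreover have "(\<lambda>y. L (k y)) \<in> borel \<rightarrow>\<^sub>M borel"
  proof (rule measurable_compose[OF _ L])
    show "k \<in> borel \<rightarrow>\<^sub>M baire"
    proof (rule measurable_PiM_single')
      have [measurable]: "Measurable.pred borel (\<lambda>y::real. \<lfloor>3 ^ Suc n * y\<rfloor> mod 3 = 1)" for n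
      proof -
        have "(\<lambda>y::real. \<lfloor>3 ^ Suc n * y\<rfloor>) \<in> borel \<rightarrow>\<^sub>M count_space UNIV" by measurable
        from measurable_compose[OF this measurable_count_space, of "\<lambda>i. i mod 3 = 1"] show ?thesis by simp
      qed
      show "(\<lambda>y. k y j) \<in> borel \<rightarrow>\<^sub>M count_space UNIV" for j
        unfolding k_def by (rule measurable_Least) measurable
    qed (simp add: space_PiM)
  qed
  moreover have "e \<in> borel \<rightarrow>\<^sub>M borel"
    unfolding e_def b_def by measurable
  ultimately show ?thesis
    by (intro that[of e "\<lambda>y. L (k y)"])
qed

text \<open>Every law on a closed set is the image of the uniform distribution under a decoding of a
  quantile function, and a quantile function is determined by its values at the rationals.\<close>

lemma baire_image_prob_algebra:
  fixes C :: "'a::polish_space set"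
  assumes C: "closed C" and ne: "space (prob_algebra (restrict_space borel C)) \<noteq> {}"
  shows "baire_image (prob_algebra (restrict_space borel C))"
proof -
  let ?N = "restrict_space borel C" and ?U = "restrict_space lborel {0<..<1::real}"
  from ne obtain P0 where "prob_space P0" "sets P0 = sets ?N" by (auto simp: space_prob_algebra)
  then have "C \<noteq> {}"
    using prob_space.not_empty[of P0] sets_eq_imp_space_eq[of P0 ?N] by (auto simp: space_restrict_space)
  then obtain c0 where c0: "c0 \<in> C" by blast
  obtain e :: "'a \<Rightarrow> real" and d :: "real \<Rightarrow> 'a" where e [measurable]: "e \<in> borel \<rightarrow>\<^sub>M borel"
    and d [measurable]: "d \<in> borel \<rightarrow>\<^sub>M borel" and de: "\<And>x. d (e x) = x"
    by (rule polish_real_retract) blast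
  \<comment> \<open>Decodings that leave \<open>C\<close> are sent to a fixed point of
    \<open>C\<close>, so that every parameter yields a law on \<open>C\<close>.\<close>
  define D where "D y = (if d y \<in> C then d y else c0)" for y
  have [measurable]: "C \<in> sets borel" using C by simp
  have D [measurable]: "D \<in> borel \<rightarrow>\<^sub>M ?N"
    unfolding D_def using c0 by (intro measurable_restrict_space2) auto
  define q where "q i = (of_rat (from_nat i) :: real)" for i
  \<comment> \<open>\<open>a\<close> stands for the values of a quantile function at the rationals,
    and \<open>Q a\<close> rebuilds the function from them by left continuity. For any other
    \<open>a\<close> the result is meaningless but still measurable.\<close>
  define Q where "Q a u = real_of_ereal (SUP i. if 0 < q i \<and> q i < u then ereal (a i) else - \<infinity>)"
    for a :: "nat \<Rightarrow> real" and u
  have U: "prob_space ?U"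
    by (auto simp add: emeasure_restrict_space space_restrict_space intro!: prob_spaceI)
  have "(\<lambda>(a, u). D (Q a u)) \<in> PiM UNIV (\<lambda>_. borel) \<Otimes>\<^sub>M ?U \<rightarrow>\<^sub>M ?N"
  proof -
    have "(\<lambda>w. Q (fst w) (snd w)) \<in> PiM UNIV (\<lambda>_. borel) \<Otimes>\<^sub>M borel \<rightarrow>\<^sub>M borel"
      unfolding Q_def by measurable
    moreover have "(\<lambda>w. (fst w, snd w)) \<in> PiM UNIV (\<lambda>_. borel) \<Otimes>\<^sub>M ?U \<rightarrow>\<^sub>M PiM UNIV (\<lambda>_. borel :: real measure) \<Otimes>\<^sub>M borel"
    proof (intro measurable_Pair measurable_fst measurable_compose[OF measurable_snd])
      show "(\<lambda>x. x) \<in> ?U \<rightarrow>\<^sub>M borel" by (rule measurable_restrict_space1) simp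
    qed
    ultimately have "(\<lambda>w. Q (fst w) (snd w)) \<in> PiM UNIV (\<lambda>_. borel) \<Otimes>\<^sub>M ?U \<rightarrow>\<^sub>M borel"
      by (auto dest: measurable_compose)
    from measurable_compose[OF this D] show ?thesis by (simp add: case_prod_beta')
  qed
  then have "(\<lambda>a. distr ?U ?N (\<lambda>u. D (Q a u))) \<in> PiM UNIV (\<lambda>_. borel) \<rightarrow>\<^sub>M prob_algebra ?N"
    by (intro measurable_distr_prob_space2[where M="?U"] measurable_const) (auto simp: space_prob_algebra U)
  then show ?thesis
  proof (rule baire_image_compose[OF baire_image_PiM[OF baire_image_borel]])
    fix P assume "P \<in> space (prob_algebra ?N)"
    then have P: "prob_space P" "sets P = sets ?N" by (auto simp: space_prob_algebra)
    have eP [measurable]: "e \<in> P \<rightarrow>\<^sub>M borel"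
      unfolding measurable_cong_sets[OF P(2) refl] by (rule measurable_restrict_space1) simp
    interpret R: cdf_distribution "distr P borel e"
      unfolding cdf_distribution_def by (rule prob_space.real_distribution_distr[OF P(1) eP])
    define a where "a i = R.I (q i)" for i
    have Qa: "Q a u = R.I u" if u: "u \<in> {0<..<1}" for u
    proof -
      have "(SUP i. if 0 < q i \<and> q i < u then ereal (a i) else - \<infinity>) = ereal (R.I u)"
      proof (rule antisym)
        show "(SUP i. if 0 < q i \<and> q i < u then ereal (a i) else - \<infinity>) \<le> ereal (R.I u)"
        proof (rule SUP_least)
          fix i
          have "a i \<le> R.I u" if "0 < q i \<and> q i < u"
            unfolding a_def by (rule mono_onD[OF R.mono_I]) (use that u in auto)
          then show "(if 0 < q i \<and> q i < u then ereal (a i) else - \<infinity>) \<le> ereal (R.I u)"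
            by (auto split: if_split)
        qed
        \<comment> \<open>Left continuity of the quantile function, through its Galois connection
          with the distribution function \<open>R.C\<close>: if all positive rationals below
          \<open>u\<close> are at most \<open>R.C x\<close>, then so is \<open>u\<close>.\<close>
        show "ereal (R.I u) \<le> (SUP i. if 0 < q i \<and> q i < u then ereal (a i) else - \<infinity>)"
        proof (rule ereal_le_real)
          fix x
          assume "(SUP i. if 0 < q i \<and> q i < u then ereal (a i) else - \<infinity>) \<le> ereal x"
          then have le: "(if 0 < q i \<and> q i < u then ereal (a i) else - \<infinity>) \<le> ereal x" for i
            by (rule order.trans[OF SUP_upper[OF UNIV_I]])
          have *: "a i \<le> x" if "0 < q i" "q i < u" for i
            using le[of i] that by simp
          have "u \<le> R.C x"
          proof (rule ccontr)
            assume "\<not> u \<le> R.C x"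
            then have "max 0 (R.C x) < u" using u by auto
            then obtain s where s: "s \<in> \<rat>" "max 0 (R.C x) < s" "s < u" using Rats_dense_in_real by blast
            then obtain i where i: "s = q i"
              unfolding q_def by (metis Rats_cases from_nat_to_nat)
            have "q i \<le> R.C x"
              using *[of i] s u i by (subst R.pseudoinverse) (auto simp: a_def)
            with s i show False by simp
          qed
          then show "ereal (R.I u) \<le> ereal x"
            using u R.pseudoinverse[of u x] by simp
        qed
      qed
      then show ?thesis by (simp add: Q_def)
    qed
    have sU: "sets ?U = sets (restrict_space borel {0<..<1::real})"
      by (rule sets_restrict_space_cong) simp
    have I_meas: "R.I \<in> ?U \<rightarrow>\<^sub>M borel"
      using R.measurable_CI unfolding measurable_cong_sets[OF sU refl] .
    have "distr ?U ?N (\<lambda>u. D (Q a u)) = distr ?U ?N (D \<circ> R.I)"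
      by (rule distr_cong) (auto simp: Qa space_restrict_space)
    also have "\<dots> = distr (distr ?U borel R.I) ?N D"
      by (rule distr_distr[OF D I_meas, symmetric])
    also have "\<dots> = distr (distr P borel e) ?N D"
      by (simp add: R.distr_I_eq_M)
    also have "\<dots> = distr P ?N (D \<circ> e)"
      by (rule distr_distr) measurable
    also have "\<dots> = distr P ?N (\<lambda>x. x)"
      using sets_eq_imp_space_eq[OF P(2)] by (intro distr_cong) (auto simp: D_def de space_restrict_space)
    also have "\<dots> = P"
      by (rule distr_id2) (simp add: P)
    finally show "\<exists>a\<in>space (PiM UNIV (\<lambda>_. borel)). distr ?U ?N (\<lambda>u. D (Q a u)) = P"
      by (intro bexI[of _ a]) (auto simp: space_PiM)
  qed
qed

subsection \<open>Universal measurability\<close>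

lemma probsD:
  assumes "P \<in> probs M"
  shows "prob_space P" "sets P = sets M" "space P = space M"
  using assms sets_eq_imp_space_eq[of P M] by (auto simp: probs_def)

lemma space_prob_algebra_probs: "space (prob_algebra M) = probs M"
  by (auto simp: space_prob_algebra probs_def)

text \<open>Only the \<sigma>-algebra matters. Packing the universally measurable sets into a value
  of type \<open>measure\<close> turns \<open>univ_meas\<close> into ordinary measurability, with
  all its closure rules.\<close>

definition umeas :: "'b measure \<Rightarrow> 'b measure" where
  "umeas M = sigma (space M) (univ_sets M)"

lemma sigma_algebra_univ_sets: "sigma_algebra (space M) (univ_sets M)"
proof (rule sigma_algebra_iff2[THEN iffD2], intro conjI ballI allI impI)
  show "univ_sets M \<subseteq> Pow (space M)" "{} \<in> univ_sets M"
    by (auto simp: univ_sets_def)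
next
  fix A assume A: "A \<in> univ_sets M"
  show "space M - A \<in> univ_sets M"
    unfolding univ_sets_def
  proof (intro CollectI conjI ballI)
    fix P assume P: "P \<in> probs M"
    then have "space (completion P) - A \<in> sets (completion P)"
      using A by (intro sets.compl_sets) (auto simp: univ_sets_def)
    then show "space M - A \<in> sets (completion P)"
      by (simp add: probsD[OF P])
  qed auto
next
  fix A :: "nat \<Rightarrow> _" assume A: "range A \<subseteq> univ_sets M"
  show "(\<Union>i. A i) \<in> univ_sets M"
    unfolding univ_sets_def
  proof (intro CollectI conjI ballI sets.countable_UN)
    show "(\<Union>i. A i) \<subseteq> space M"
      using A by (auto simp: univ_sets_def)
    show "range A \<subseteq> sets (completion P)" if "P \<in> probs M" for P
      using A that by (auto simp: univ_sets_def)
  qed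
qed

lemma space_umeas [simp]: "space (umeas M) = space M"
  by (simp add: umeas_def space_measure_of_conv)

lemma sets_umeas: "sets (umeas M) = univ_sets M"
  unfolding umeas_def by (rule sigma_algebra.sets_measure_of_eq[OF sigma_algebra_univ_sets])

lemma univ_meas_iff: "univ_meas M N f \<longleftrightarrow> f \<in> umeas M \<rightarrow>\<^sub>M N"
  by (simp add: univ_meas_def measurable_def sets_umeas)

lemma sets_umeasI: "A \<in> sets M \<Longrightarrow> A \<in> sets (umeas M)"
  using sets.sets_into_space[of A M] by (auto simp: sets_umeas univ_sets_def probs_def)

lemma measurable_umeasI: "f \<in> M \<rightarrow>\<^sub>M N \<Longrightarrow> f \<in> umeas M \<rightarrow>\<^sub>M N"
  by (auto simp: measurable_def intro: sets_umeasI)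

lemma measurable_umeas_completion: "f \<in> umeas M \<rightarrow>\<^sub>M N \<Longrightarrow> P \<in> probs M \<Longrightarrow> f \<in> completion P \<rightarrow>\<^sub>M N"
  by (auto simp: measurable_def sets_umeas univ_sets_def probsD)

text \<open>For a given law \<open>P\<close>, a universally measurable set is squeezed up to a null
  set of the image law, and pulling back squeezes its preimage up to a \<open>P\<close>-null set.
  This is what allows composition with restrictions to earlier dates.\<close>

lemma measurable_umeas_umeas:
  assumes g: "g \<in> M \<rightarrow>\<^sub>M N"
  shows "g \<in> umeas M \<rightarrow>\<^sub>M umeas N"
proof (rule measurableI)
  show "g x \<in> space (umeas N)" if "x \<in> space (umeas M)" for x
    using that g by (auto dest: measurable_space)
  fix A assume A: "A \<in> sets (umeas N)"
  show "g -` A \<inter> space (umeas M) \<in> sets (umeas M)"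
    unfolding sets_umeas univ_sets_def space_umeas
  proof (intro CollectI conjI ballI)
    fix P assume P: "P \<in> probs M"
    have gP: "g \<in> P \<rightarrow>\<^sub>M N"
      using g by (simp add: measurable_cong_sets[OF probsD(2)[OF P] refl])
    have "distr P N g \<in> probs N"
      by (auto simp: probs_def intro!: prob_space.prob_space_distr probsD(1)[OF P] gP)
    with A have "A \<in> sets (completion (distr P N g))"
      by (auto simp: sets_umeas univ_sets_def)
    then obtain S N1 N2 where *: "A = S \<union> N1" "N1 \<subseteq> N2" "N2 \<in> null_sets (distr P N g)" "S \<in> sets (distr P N g)"
      by (rule sets_completionE)
    show "g -` A \<inter> space M \<in> sets (completion P)"
    proof (rule sets_completionI)
      show "g -` A \<inter> space M = (g -` S \<inter> space P) \<union> (g -` N1 \<inter> space P)"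
        using *(1) by (auto simp: probsD[OF P])
      show "g -` N1 \<inter> space P \<subseteq> g -` N2 \<inter> space P" using *(2) by auto
      show "g -` N2 \<inter> space P \<in> null_sets P"
        using *(3) by (simp add: null_sets_distr_iff[OF gP])
      show "g -` S \<inter> space P \<in> sets P"
        using *(4) gP by (auto intro: measurable_sets)
    qed
  qed auto
qed

text \<open>A set in the completion is a measurable set together with part of a null set, so it is
  negligible once its measurable subsets are. This carries Fubini statements over from measurable to
  universally measurable events.\<close>

lemma AE_completion_measurable_set:
  assumes "Measurable.pred (completion P) R" "\<And>A. A \<in> sets P \<Longrightarrow> (\<And>x. x \<in> A \<Longrightarrow> \<not> R x) \<Longrightarrow> emeasure P A = 0"
  shows "AE x in P. R x"
proof -
  let ?A = "{x \<in> space P. \<not> R x}"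
  have [measurable]: "Measurable.pred (completion P) R" by (rule assms(1))
  have "{x \<in> space (completion P). \<not> R x} \<in> sets (completion P)" by measurable
  then have "?A \<in> sets (completion P)" by simp
  then obtain S N1 N2 where *: "?A = S \<union> N1" "N1 \<subseteq> N2" "N2 \<in> null_sets P" "S \<in> sets P"
    by (rule sets_completionE)
  have "S \<in> null_sets P"
    using *(1,4) by (intro null_setsI assms(2)) auto
  with *(3) have "S \<union> N2 \<in> null_sets P" by auto
  then show ?thesis
    by (rule AE_I') (use *(1,2) in auto)
qed

subsection \<open>Composition with kernels\<close>

lemma probs_space_ne: "P \<in> probs (Omt Om t) \<Longrightarrow> space P \<noteq> {}"
  using probsD(1) prob_space.not_empty by blast

lemma measurable_res [measurable]:
  assumes "t \<le> t'"
  shows "(\<lambda>z. restrict z {1..t}) \<in> Omt Om t' \<rightarrow>\<^sub>M Omt Om t"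
  unfolding Omt_def by (rule measurable_restrict_subset) (use assms in auto)

lemma res_upd: "\<omega> \<in> space (Omt Om t) \<Longrightarrow> restrict (fun_upd \<omega> (Suc t) x) {1..t} = \<omega>"
  by (auto simp: Omt_def space_PiM PiE_iff extensional_def restrict_def fun_eq_iff)

lemma res_res: "(t :: nat) \<le> t' \<Longrightarrow> restrict (restrict z {1..t'}) {1..t} = restrict z {1..t}"
  by (auto simp: restrict_def fun_eq_iff)

lemma res_id: "\<omega> \<in> space (Omt Om t) \<Longrightarrow> restrict \<omega> {1..t} = \<omega>"
  by (auto simp: Omt_def space_PiM PiE_iff extensional_def restrict_def fun_eq_iff)

lemma measurable_upd [measurable]:
  "(\<lambda>(\<omega>, x). (fun_upd \<omega> (Suc t) x)) \<in> Omt Om t \<Otimes>\<^sub>M Mcoord Om (Suc t) \<rightarrow>\<^sub>M Omt Om (Suc t)"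
proof -
  have "{1..Suc t} = insert (Suc t) {1..t}" by auto
  then show ?thesis
    unfolding Omt_def using measurable_add_dim[of "Suc t" "{1..t}" "Mcoord Om"] by simp
qed

lemma measurable_upd1:
  assumes "\<omega> \<in> space (Omt Om t)" "R \<in> probs (Mcoord Om (Suc t))"
  shows "fun_upd \<omega> (Suc t) \<in> R \<rightarrow>\<^sub>M Omt Om (Suc t)"
proof -
  have "(\<lambda>x. (\<lambda>(\<omega>, x). (fun_upd \<omega> (Suc t) x)) (\<omega>, x)) \<in> Mcoord Om (Suc t) \<rightarrow>\<^sub>M Omt Om (Suc t)"
    by (rule measurable_compose[OF _ measurable_upd]) (use assms in measurable)
  then show ?thesis
    by (simp add: measurable_cong_sets[OF probsD(2)[OF assms(2)] refl])
qed

lemma is_kernelI: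
  assumes "q \<in> umeas M \<rightarrow>\<^sub>M prob_algebra N"
  shows "is_kernel M N q"
  unfolding is_kernel_def univ_meas_iff
proof (intro conjI ballI)
  show "q \<omega> \<in> probs N" if "\<omega> \<in> space M" for \<omega>
    using measurable_space[OF assms] that by (simp add: space_prob_algebra_probs)
  show "(\<lambda>\<omega>. emeasure (q \<omega>) A) \<in> borel_measurable (umeas M)" if "A \<in> sets N" for A
    using measurable_prob_algebraD[OF assms] that by (rule measurable_emeasure_kernel)
qed

lemma is_kernelD:
  assumes "is_kernel M N q"
  shows "q \<in> umeas M \<rightarrow>\<^sub>M prob_algebra N"
proof (rule measurable_prob_algebraI)
  show "prob_space (q x)" if "x \<in> space (umeas M)" for x
    using assms that by (auto simp: is_kernel_def probs_def)
  show "q \<in> umeas M \<rightarrow>\<^sub>M subprob_algebra N"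
    using assms by (intro measurable_subprob_algebra)
      (auto simp: is_kernel_def probs_def univ_meas_iff prob_space_imp_subprob_space)
qed

locale kernel_composition =
  fixes Om :: "nat \<Rightarrow> 'a::topological_space set" and t :: nat and P q
  assumes P: "P \<in> probs (Omt Om t)" and q: "is_kernel (Omt Om t) (Mcoord Om (Suc t)) q"
begin

definition \<kappa> where "\<kappa> \<omega> = distr (q \<omega>) (Omt Om (Suc t)) (fun_upd \<omega> (Suc t))"

lemma q_probs: "\<omega> \<in> space P \<Longrightarrow> q \<omega> \<in> probs (Mcoord Om (Suc t))"
  using q by (auto simp: is_kernel_def probsD[OF P])

lemma q_meas: "q \<in> completion P \<rightarrow>\<^sub>M prob_algebra (Mcoord Om (Suc t))"
  by (rule measurable_umeas_completion[OF is_kernelD[OF q] P])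

lemma kappa_meas: "\<kappa> \<in> completion P \<rightarrow>\<^sub>M prob_algebra (Omt Om (Suc t))"
  unfolding \<kappa>_def
proof (rule measurable_distr_prob_space2[OF q_meas])
  have "(\<lambda>w. (fst w, snd w)) \<in> completion P \<Otimes>\<^sub>M Mcoord Om (Suc t) \<rightarrow>\<^sub>M Omt Om t \<Otimes>\<^sub>M Mcoord Om (Suc t)"
  proof (rule measurable_Pair)
    have "(\<lambda>x. x) \<in> completion P \<rightarrow>\<^sub>M Omt Om t"
      by (rule measurable_umeas_completion[OF measurable_umeasI P]) simp
    then show "fst \<in> completion P \<Otimes>\<^sub>M Mcoord Om (Suc t) \<rightarrow>\<^sub>M Omt Om t"
      by (rule measurable_compose[OF measurable_fst])
  qed simp
  from measurable_compose[OF this measurable_upd]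
  show "(\<lambda>(x, y). fun_upd x (Suc t) y) \<in> completion P \<Otimes>\<^sub>M Mcoord Om (Suc t) \<rightarrow>\<^sub>M Omt Om (Suc t)"
    by (simp add: case_prod_beta')
qed

text \<open>\<open>kcomp\<close> is given by a bare set function, and \<open>measure_of\<close>
  returns a zero measure if that function is not countably additive. Recognising it as a bind of
  probability kernels rules this out and supplies the integral formula.\<close>

lemma kcomp_bind: "kcomp Om t P q = completion P \<bind> \<kappa>"
proof -
  let ?B = "completion P \<bind> \<kappa>" and ?X = "Omt Om (Suc t)"
  have ne: "space (completion P) \<noteq> {}" using probs_space_ne[OF P] by simp
  have sB: "sets ?B = sets ?X"
    by (rule sets_bind[OF _ ne]) (use measurable_space[OF kappa_meas] in \<open>auto simp: space_prob_algebra\<close>)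
  have "kcomp Om t P q = measure_of (space ?X) (sets ?X) (emeasure ?B)"
    unfolding kcomp_def
  proof (rule measure_of_eq[OF sets.space_closed])
    fix A assume "A \<in> sigma_sets (space ?X) (sets ?X)"
    then have A: "A \<in> sets ?X" by (simp add: sets.sigma_sets_eq)
    have "emeasure ?B A = (\<integral>\<^sup>+\<omega>. emeasure (\<kappa> \<omega>) A \<partial>completion P)"
      by (rule emeasure_bind[OF ne measurable_prob_algebraD[OF kappa_meas] A])
    also have "\<dots> = (\<integral>\<^sup>+\<omega>. emeasure (q \<omega>) {x \<in> space (q \<omega>). fun_upd \<omega> (Suc t) x \<in> A} \<partial>completion P)"
    proof (rule nn_integral_cong)
      fix \<omega> assume "\<omega> \<in> space (completion P)"
      then have w: "\<omega> \<in> space P" "\<omega> \<in> space (Omt Om t)" by (simp_all add: probsD[OF P])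
      have "emeasure (\<kappa> \<omega>) A = emeasure (q \<omega>) (fun_upd \<omega> (Suc t) -` A \<inter> space (q \<omega>))"
        unfolding \<kappa>_def by (rule emeasure_distr[OF measurable_upd1[OF w(2) q_probs[OF w(1)]] A])
      also have "fun_upd \<omega> (Suc t) -` A \<inter> space (q \<omega>) = {x \<in> space (q \<omega>). fun_upd \<omega> (Suc t) x \<in> A}" by auto
      finally show "emeasure (\<kappa> \<omega>) A = emeasure (q \<omega>) {x \<in> space (q \<omega>). fun_upd \<omega> (Suc t) x \<in> A}" .
    qed
    finally show "(\<integral>\<^sup>+\<omega>. emeasure (q \<omega>) {x \<in> space (q \<omega>). fun_upd \<omega> (Suc t) x \<in> A} \<partial>completion P) = emeasure ?B A" ..
  qed
  also have "\<dots> = ?B"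
    unfolding sB[symmetric] sets_eq_imp_space_eq[OF sB, symmetric] by (rule measure_of_of_measure)
  finally show ?thesis .
qed

lemma kcomp_probs: "kcomp Om t P q \<in> probs (Omt Om (Suc t))"
proof -
  interpret cP: prob_space "completion P"
    using probsD(1)[OF P] by (simp add: prob_space.prob_space_completion)
  have "completion P \<bind> \<kappa> \<in> space (prob_algebra (Omt Om (Suc t)))"
  proof (unfold space_prob_algebra, intro CollectI conjI)
    show "prob_space (completion P \<bind> \<kappa>)"
      using measurable_space[OF kappa_meas]
      by (intro cP.prob_space_bind[OF AE_I2 measurable_prob_algebraD[OF kappa_meas]]) (auto simp: space_prob_algebra)
    show "sets (completion P \<bind> \<kappa>) = sets (Omt Om (Suc t))"
      by (rule sets_bind) (use measurable_space[OF kappa_meas] cP.not_empty in \<open>auto simp: space_prob_algebra\<close>)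
  qed
  then show ?thesis by (simp add: kcomp_bind space_prob_algebra_probs)
qed

lemma emeasure_kcomp:
  assumes A: "A \<in> sets (Omt Om (Suc t))"
  shows "emeasure (kcomp Om t P q) A = (\<integral>\<^sup>+\<omega>. emeasure (\<kappa> \<omega>) A \<partial>completion P)"
  unfolding kcomp_bind
  by (rule emeasure_bind[OF _ measurable_prob_algebraD[OF kappa_meas] A]) (use probs_space_ne[OF P] in simp)

lemma emeasure_kcomp_eq_0:
  assumes A: "A \<in> sets (Omt Om (Suc t))"
  shows "emeasure (kcomp Om t P q) A = 0 \<longleftrightarrow> (AE \<omega> in P. AE x in q \<omega>. (fun_upd \<omega> (Suc t) x) \<notin> A)"
proof -
  have [measurable]: "(\<lambda>\<omega>. emeasure (\<kappa> \<omega>) A) \<in> borel_measurable (completion P)"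
    by (rule measurable_emeasure_kernel[OF measurable_prob_algebraD[OF kappa_meas] A])
  have "emeasure (kcomp Om t P q) A = 0 \<longleftrightarrow> (AE \<omega> in P. emeasure (\<kappa> \<omega>) A = 0)"
    unfolding emeasure_kcomp[OF A] by (simp add: nn_integral_0_iff_AE AE_completion_iff)
  also have "\<dots> \<longleftrightarrow> (AE \<omega> in P. AE x in q \<omega>. (fun_upd \<omega> (Suc t) x) \<notin> A)"
  proof (rule AE_cong)
    fix \<omega> assume w: "\<omega> \<in> space P"
    then have w': "\<omega> \<in> space (Omt Om t)" by (simp add: probsD[OF P])
    note m = measurable_upd1[OF w' q_probs[OF w]]
    have "emeasure (\<kappa> \<omega>) A = 0 \<longleftrightarrow> (AE z in \<kappa> \<omega>. z \<notin> A)"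
      using A by (subst AE_iff_measurable[of A]) (auto simp: \<kappa>_def dest: sets.sets_into_space)
    also have "\<dots> \<longleftrightarrow> (AE x in q \<omega>. (fun_upd \<omega> (Suc t) x) \<notin> A)"
      unfolding \<kappa>_def
    proof (rule AE_distr_iff[OF m])
      have "{x \<in> space (Omt Om (Suc t)). x \<notin> A} = space (Omt Om (Suc t)) - A" by auto
      then show "{x \<in> space (Omt Om (Suc t)). x \<notin> A} \<in> sets (Omt Om (Suc t))" using A by auto
    qed
    finally show "emeasure (\<kappa> \<omega>) A = 0 \<longleftrightarrow> (AE x in q \<omega>. (fun_upd \<omega> (Suc t) x) \<notin> A)" .
  qed
  finally show ?thesis .
qed

lemma AE_kcompD:
  assumes "AE z in kcomp Om t P q. R z"
  shows "AE \<omega> in P. AE x in q \<omega>. R (fun_upd \<omega> (Suc t) x)"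
proof -
  from assms obtain A where A: "{z \<in> space (kcomp Om t P q). \<not> R z} \<subseteq> A" "emeasure (kcomp Om t P q) A = 0"
    "A \<in> sets (kcomp Om t P q)" by (rule AE_E)
  then have "A \<in> sets (Omt Om (Suc t))" by (simp add: probsD[OF kcomp_probs])
  with A(2) have "AE \<omega> in P. AE x in q \<omega>. (fun_upd \<omega> (Suc t) x) \<notin> A" by (simp add: emeasure_kcomp_eq_0)
  note 1 = this
  show ?thesis
  proof (rule AE_mp[OF 1], rule AE_I2, rule impI)
    fix \<omega> assume w: "\<omega> \<in> space P" and *: "AE x in q \<omega>. (fun_upd \<omega> (Suc t) x) \<notin> A"
    show "AE x in q \<omega>. R (fun_upd \<omega> (Suc t) x)"
    proof (rule AE_mp[OF *], rule AE_I2, rule impI)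
      fix x assume "x \<in> space (q \<omega>)" "(fun_upd \<omega> (Suc t) x) \<notin> A"
      moreover have "(fun_upd \<omega> (Suc t) x) \<in> space (Omt Om (Suc t))"
        using measurable_space[OF measurable_upd1[OF _ q_probs[OF w]] \<open>x \<in> space (q \<omega>)\<close>] w by (simp add: probsD[OF P])
      ultimately show "R (fun_upd \<omega> (Suc t) x)" using A(1) by (auto simp: probsD[OF kcomp_probs])
    qed
  qed
qed

text \<open>The exceptional set is only universally measurable, so the criterion
  \<open>emeasure_kcomp_eq_0\<close> is applied to its measurable subsets.\<close>

lemma AE_kcompI:
  assumes m: "Measurable.pred (umeas (Omt Om (Suc t))) R"
    and ae: "AE \<omega> in P. AE x in q \<omega>. R (fun_upd \<omega> (Suc t) x)"
  shows "AE z in kcomp Om t P q. R z"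
proof (rule AE_completion_measurable_set[OF measurable_umeas_completion[OF m kcomp_probs]])
  fix A assume A: "A \<in> sets (kcomp Om t P q)" "\<And>x. x \<in> A \<Longrightarrow> \<not> R x"
  then have "A \<in> sets (Omt Om (Suc t))" by (simp add: probsD[OF kcomp_probs])
  moreover have "AE \<omega> in P. AE x in q \<omega>. (fun_upd \<omega> (Suc t) x) \<notin> A"
  proof (rule AE_mp[OF ae], rule AE_I2, rule impI)
    fix \<omega> assume "AE x in q \<omega>. R (fun_upd \<omega> (Suc t) x)"
    then show "AE x in q \<omega>. (fun_upd \<omega> (Suc t) x) \<notin> A"
      by (rule eventually_mono) (use A(2) in blast)
  qed
  ultimately show "emeasure (kcomp Om t P q) A = 0" by (simp add: emeasure_kcomp_eq_0)
qed

text \<open>A set of paths determined by the past has a full or an empty section at each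
  \<open>\<omega>\<close>, and kernels have total mass one.\<close>

lemma kcomp_marginal: "distr (kcomp Om t P q) (Omt Om t) (\<lambda>z. restrict z {1..t}) = P"
proof (rule measure_eqI)
  fix A assume "A \<in> sets (distr (kcomp Om t P q) (Omt Om t) (\<lambda>z. restrict z {1..t}))"
  then have A: "A \<in> sets (Omt Om t)" "A \<in> sets P" by (simp_all add: probsD[OF P])
  have rm: "(\<lambda>z. restrict z {1..t}) \<in> Omt Om (Suc t) \<rightarrow>\<^sub>M Omt Om t" by (rule measurable_res) simp
  let ?A = "(\<lambda>z. restrict z {1..t}) -` A \<inter> space (Omt Om (Suc t))"
  have A': "?A \<in> sets (Omt Om (Suc t))" by (rule measurable_sets[OF rm A(1)])
  have "emeasure (distr (kcomp Om t P q) (Omt Om t) (\<lambda>z. restrict z {1..t})) A = emeasure (kcomp Om t P q) ?A"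
    using rm A(1) by (subst emeasure_distr) (simp_all add: measurable_cong_sets[OF probsD(2)[OF kcomp_probs] refl] probsD[OF kcomp_probs])
  also have "\<dots> = (\<integral>\<^sup>+\<omega>. emeasure (\<kappa> \<omega>) ?A \<partial>completion P)"
    by (rule emeasure_kcomp[OF A'])
  also have "\<dots> = (\<integral>\<^sup>+\<omega>. indicator A \<omega> \<partial>completion P)"
  proof (rule nn_integral_cong)
    fix \<omega> assume "\<omega> \<in> space (completion P)"
    then have w: "\<omega> \<in> space P" "\<omega> \<in> space (Omt Om t)" by (simp_all add: probsD[OF P])
    note m = measurable_upd1[OF w(2) q_probs[OF w(1)]]
    have "emeasure (\<kappa> \<omega>) ?A = emeasure (q \<omega>) (fun_upd \<omega> (Suc t) -` ?A \<inter> space (q \<omega>))"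
      unfolding \<kappa>_def by (rule emeasure_distr[OF m A'])
    also have "fun_upd \<omega> (Suc t) -` ?A \<inter> space (q \<omega>) = (if \<omega> \<in> A then space (q \<omega>) else {})"
      using measurable_space[OF m] res_upd[OF w(2)] by auto
    also have "emeasure (q \<omega>) \<dots> = indicator A \<omega>"
      using prob_space.emeasure_space_1[OF probsD(1)[OF q_probs[OF w(1)]]] by simp
    finally show "emeasure (\<kappa> \<omega>) ?A = indicator A \<omega>" .
  qed
  also have "\<dots> = emeasure P A"
    using A by (simp add: nn_integral_completion)
  finally show "emeasure (distr (kcomp Om t P q) (Omt Om t) (\<lambda>z. restrict z {1..t})) A = emeasure P A" .
qed (simp add: probsD[OF P])

end

lemma Qset_probs: "P \<in> Qset Om Qr t \<Longrightarrow> P \<in> probs (Omt Om t)"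
proof (induction t arbitrary: P)
  case (Suc t)
  then obtain P' q where "P = kcomp Om t P' q" "P' \<in> Qset Om Qr t" "is_kernel (Omt Om t) (Mcoord Om (Suc t)) q"
    by auto
  then show ?case
    using kernel_composition.kcomp_probs[of Om t P' q] Suc.IH[of P'] by (simp add: kernel_composition_def)
qed simp

lemma Qset_SucE:
  assumes "K \<in> Qset Om Qr (Suc t)"
  obtains P q where "K = kcomp Om t P q" "P \<in> Qset Om Qr t" "kernel_composition Om t P q" "AE \<omega> in P. q \<omega> \<in> Qr (Suc t) \<omega>"
proof -
  from assms obtain P q where "K = kcomp Om t P q" "P \<in> Qset Om Qr t" "is_kernel (Omt Om t) (Mcoord Om (Suc t)) q"
    "AE \<omega> in P. q \<omega> \<in> Qr (Suc t) \<omega>"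
    by (auto simp: AE_completion_iff)
  with Qset_probs[of P Om Qr t] show ?thesis
    by (intro that) (simp_all add: kernel_composition_def)
qed

lemma Qset_marginal:
  "t \<le> t' \<Longrightarrow> P \<in> Qset Om Qr t' \<Longrightarrow> distr P (Omt Om t) (\<lambda>z. restrict z {1..t}) \<in> Qset Om Qr t"
proof (induction t' arbitrary: P rule: dec_induct)
  case base
  have "distr P (Omt Om t) (\<lambda>z. restrict z {1..t}) = distr P (Omt Om t) (\<lambda>z. z)"
    using probsD[OF Qset_probs[OF base]] by (intro distr_cong) (simp_all add: res_id del: One_nat_def)
  also have "\<dots> = P" by (rule distr_id2) (simp add: probsD[OF Qset_probs[OF base]])
  finally show ?case using base by (simp only:)
next
  case (step n)
  from step.prems obtain P' q where P: "P = kcomp Om n P' q" "P' \<in> Qset Om Qr n" "kernel_composition Om n P' q"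
    by (rule Qset_SucE)
  have PO: "sets P = sets (Omt Om (Suc n))" using probsD Qset_probs[OF step.prems] by blast
  have "distr P (Omt Om t) (\<lambda>z. restrict z {1..t}) = distr P (Omt Om t) ((\<lambda>z. restrict z {1..t}) \<circ> (\<lambda>z. restrict z {1..n}))"
    by (intro distr_cong refl) (simp only: comp_def res_res[OF step.hyps(1)])
  also have "\<dots> = distr (distr P (Omt Om n) (\<lambda>z. restrict z {1..n})) (Omt Om t) (\<lambda>z. restrict z {1..t})"
    using step.hyps by (intro distr_distr[symmetric] measurable_res)
      (simp_all add: measurable_cong_sets[OF PO refl] measurable_res del: One_nat_def)
  also have "distr P (Omt Om n) (\<lambda>z. restrict z {1..n}) = P'"
    unfolding P(1) by (rule kernel_composition.kcomp_marginal[OF P(3)])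
  finally show ?case using step.IH[OF P(2)] by simp
qed

text \<open>From here on quasi-sure statements are handled as almost-sure statements under each
  prior. For the converse the failure set itself is polar: each prior provides a measurable null set
  that covers it.\<close>

lemma qs_iff: "qs Om Qr t R \<longleftrightarrow> (\<forall>P\<in>Qset Om Qr t. AE \<omega> in P. R \<omega>)"
proof
  assume "qs Om Qr t R"
  then obtain N where N: "polar Om Qr t N" "\<forall>\<omega>\<in>space (Omt Om t) - N. R \<omega>" by (auto simp: qs_def)
  show "\<forall>P\<in>Qset Om Qr t. AE \<omega> in P. R \<omega>"
  proof
    fix P assume P: "P \<in> Qset Om Qr t"
    with N(1) obtain A where A: "A \<in> univ_sets (Omt Om t)" "N \<subseteq> A" "emeasure (completion P) A = 0"
      by (auto simp: polar_def)
    with Qset_probs[OF P] have "A \<in> null_sets (completion P)" by (auto simp: univ_sets_def null_sets_def)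
    then have "AE \<omega> in completion P. R \<omega>"
      using A(2) N(2) by (intro AE_I'[of A]) (auto simp: probsD[OF Qset_probs[OF P]])
    then show "AE \<omega> in P. R \<omega>" by (simp add: AE_completion_iff)
  qed
next
  assume *: "\<forall>P\<in>Qset Om Qr t. AE \<omega> in P. R \<omega>"
  have "polar Om Qr t {\<omega> \<in> space (Omt Om t). \<not> R \<omega>}"
    unfolding polar_def
  proof
    fix P assume P: "P \<in> Qset Om Qr t"
    note Pp = probsD[OF Qset_probs[OF P]]
    from * P have "AE \<omega> in P. R \<omega>" by blast
    then obtain A where A: "{\<omega> \<in> space P. \<not> R \<omega>} \<subseteq> A" "emeasure P A = 0" "A \<in> sets P" by (rule AE_E)
    then show "\<exists>A\<in>univ_sets (Omt Om t). {\<omega> \<in> space (Omt Om t). \<not> R \<omega>} \<subseteq> A \<and> emeasure (completion P) A = 0"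
      using sets_umeasI[of A "Omt Om t"] by (intro bexI[of _ A]) (auto simp: Pp sets_umeas)
  qed
  then show "qs Om Qr t R" unfolding qs_def by auto
qed

lemma qs_mono: "qs Om Qr t R \<Longrightarrow> (\<And>\<omega>. \<omega> \<in> space (Omt Om t) \<Longrightarrow> R \<omega> \<Longrightarrow> R' \<omega>) \<Longrightarrow> qs Om Qr t R'"
  by (auto simp: qs_def)

lemma qs_conj: "qs Om Qr t R \<Longrightarrow> qs Om Qr t R' \<Longrightarrow> qs Om Qr t (\<lambda>\<omega>. R \<omega> \<and> R' \<omega>)"
  by (simp add: qs_iff)

lemma qs_all_countable: "(\<And>n :: nat. qs Om Qr t (R n)) \<Longrightarrow> qs Om Qr t (\<lambda>\<omega>. \<forall>n. R n \<omega>)"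
  by (simp add: qs_iff AE_all_countable)

lemma qs_lift:
  assumes "t \<le> t'" "qs Om Qr t R"
  shows "qs Om Qr t' (\<lambda>z. R (restrict z {1..t}))"
  unfolding qs_iff
proof
  fix P assume P: "P \<in> Qset Om Qr t'"
  have "AE \<omega> in distr P (Omt Om t) (\<lambda>z. restrict z {1..t}). R \<omega>"
    using assms Qset_marginal[OF assms(1) P] by (simp add: qs_iff)
  then show "AE z in P. R (restrict z {1..t})"
    by (rule AE_distrD[rotated])
      (use measurable_res[OF assms(1), of Om] in \<open>simp add: measurable_cong_sets[OF probsD(2)[OF Qset_probs[OF P]] refl]\<close>)
qed

subsection \<open>Selection of kernels\<close>

locale robust_market =
  fixes T :: nat
    and Om :: "nat \<Rightarrow> 'a::polish_space set"
    and Qr :: "nat \<Rightarrow> (nat \<Rightarrow> 'a) \<Rightarrow> 'a measure set"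
    and S :: "nat \<Rightarrow> (nat \<Rightarrow> 'a) \<Rightarrow> 'b::euclidean_space"
  assumes polish: "\<forall>s\<in>{1..T}. closed (Om s)"
    and A1_values: "\<forall>t<T. \<forall>\<omega>\<in>space (Omt Om t). Qr (Suc t) \<omega> \<noteq> {} \<and>
         Qr (Suc t) \<omega> \<subseteq> probs (Mcoord Om (Suc t)) \<and> convex_probs (Qr (Suc t) \<omega>)"
    and A1_graph: "\<forall>t<T. analytic (Omt Om t \<Otimes>\<^sub>M prob_algebra (Mcoord Om (Suc t)))
         {(\<omega>, P). \<omega> \<in> space (Omt Om t) \<and> P \<in> Qr (Suc t) \<omega>}"
    and A2: "\<forall>t\<le>T. S t \<in> borel_measurable (Omt Om t)"
begin

abbreviation "\<Omega> t \<equiv> Omt Om t"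
abbreviation "N t \<equiv> Mcoord Om t"
abbreviation "Q t \<equiv> Qset Om Qr t"
abbreviation res where "res t z \<equiv> restrict z {1..t :: nat}"
abbreviation up where "up t \<omega> x \<equiv> fun_upd \<omega> (Suc t) (x :: 'a)"

lemma Qr_ne: "t < T \<Longrightarrow> \<omega> \<in> space (\<Omega> t) \<Longrightarrow> Qr (Suc t) \<omega> \<noteq> {}"
  using A1_values by blast

lemma Qr_probs: "t < T \<Longrightarrow> \<omega> \<in> space (\<Omega> t) \<Longrightarrow> R \<in> Qr (Suc t) \<omega> \<Longrightarrow> R \<in> probs (N (Suc t))"
  using A1_values by blast

text \<open>The analytic graph is the projection, along the reals, of a measurable set; hence a
  local prior and a real witness are selected together and the witness is dropped. \<open>E\<close>
  collects the histories at which a local prior in \<open>C\<close> was found.\<close>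

lemma kernel_selection:
  assumes t: "t < T" and P: "P \<in> probs (\<Omega> t)" and C: "C \<in> sets (\<Omega> t \<Otimes>\<^sub>M prob_algebra (N (Suc t)))"
  shows "\<exists>E f Z. E \<in> sets (\<Omega> t) \<and> f \<in> \<Omega> t \<rightarrow>\<^sub>M prob_algebra (N (Suc t)) \<and>
    (\<forall>\<omega>\<in>E. f \<omega> \<in> Qr (Suc t) \<omega> \<and> (\<omega>, f \<omega>) \<in> C) \<and> Z \<in> null_sets P \<and>
    (\<forall>\<omega>\<in>space (\<Omega> t) - (E \<union> Z). \<forall>R\<in>Qr (Suc t) \<omega>. (\<omega>, R) \<notin> C)"
proof -
  let ?M = "\<Omega> t" and ?A = "prob_algebra (N (Suc t))"
  obtain \<omega>0 where "\<omega>0 \<in> space ?M" using probs_space_ne[OF P] probsD(3)[OF P] by auto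
  then have ne: "space ?A \<noteq> {}"
    using Qr_ne[OF t] Qr_probs[OF t] by (fastforce simp: space_prob_algebra_probs)
  have "baire_image ?A"
    using ne polish t unfolding Mcoord_def by (intro baire_image_prob_algebra) auto
  then have bi: "baire_image (?A \<Otimes>\<^sub>M (borel :: real measure))"
    by (rule baire_image_pair) (rule baire_image_borel)
  from A1_graph t obtain B where B: "B \<in> sets ((?M \<Otimes>\<^sub>M ?A) \<Otimes>\<^sub>M (borel :: real measure))"
    and gr: "{(\<omega>, P). \<omega> \<in> space ?M \<and> P \<in> Qr (Suc t) \<omega>} = fst ` B"
    unfolding analytic_def by blast
  define g where "g w = ((fst w, fst (snd w)), snd (snd w))" for w :: "(nat \<Rightarrow> 'a) \<times> 'a measure \<times> real"
  define B' where "B' = g -` (B \<inter> C \<times> UNIV) \<inter> space (?M \<Otimes>\<^sub>M (?A \<Otimes>\<^sub>M (borel :: real measure)))"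
  have g: "g \<in> ?M \<Otimes>\<^sub>M (?A \<Otimes>\<^sub>M borel) \<rightarrow>\<^sub>M (?M \<Otimes>\<^sub>M ?A) \<Otimes>\<^sub>M borel"
    unfolding g_def by measurable
  have "C \<times> (UNIV :: real set) \<in> sets ((?M \<Otimes>\<^sub>M ?A) \<Otimes>\<^sub>M borel)"
    using C by (intro pair_measureI) auto
  with B have "B \<inter> C \<times> UNIV \<in> sets ((?M \<Otimes>\<^sub>M ?A) \<Otimes>\<^sub>M borel)" by (rule sets.Int)
  then have "B' \<in> sets (?M \<Otimes>\<^sub>M (?A \<Otimes>\<^sub>M borel))"
    unfolding B'_def by (rule measurable_sets[OF g])
  then have B': "B' \<in> sets (P \<Otimes>\<^sub>M (?A \<Otimes>\<^sub>M borel))"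
    using sets_pair_measure_cong[OF probsD(2)[OF P] refl] by blast
  have B'_iff: "(\<omega>, R, r) \<in> B' \<longleftrightarrow> ((\<omega>, R), r) \<in> B \<and> (\<omega>, R) \<in> C" for \<omega> R r
    using sets.sets_into_space[OF B] by (auto simp: B'_def g_def space_pair_measure)
  have fin: "finite_measure P" using probsD(1)[OF P] by (simp add: prob_space.finite_measure)
  obtain E h Z where E: "E \<in> sets P" and h: "h \<in> P \<rightarrow>\<^sub>M ?A \<Otimes>\<^sub>M (borel :: real measure)"
    and sel: "\<forall>x\<in>E. (x, h x) \<in> B'" and Z: "Z \<in> null_sets P" "fst ` B' \<subseteq> E \<union> Z"
    using measurable_selection[OF B' fin bi] by (elim exE conjE) (rule that)
  have f: "(\<lambda>\<omega>. fst (h \<omega>)) \<in> ?M \<rightarrow>\<^sub>M ?A"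
    using measurable_compose[OF h measurable_fst] by (simp add: measurable_cong_sets[OF probsD(2)[OF P] refl])
  have s: "fst (h \<omega>) \<in> Qr (Suc t) \<omega> \<and> (\<omega>, fst (h \<omega>)) \<in> C" if "\<omega> \<in> E" for \<omega>
  proof -
    obtain R r where hr: "h \<omega> = (R, r)" by (cases "h \<omega>")
    with sel that have "(\<omega>, R, r) \<in> B'" by force
    then have *: "((\<omega>, R), r) \<in> B" "(\<omega>, R) \<in> C" by (simp_all add: B'_iff)
    from *(1) have "(\<omega>, R) \<in> fst ` B" by force
    then show ?thesis using *(2) by (simp add: gr[symmetric] hr)
  qed
  have z: "(\<omega>, R) \<notin> C" if w: "\<omega> \<in> space ?M - (E \<union> Z)" and R: "R \<in> Qr (Suc t) \<omega>" for \<omega> R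
  proof
    assume "(\<omega>, R) \<in> C"
    moreover have "(\<omega>, R) \<in> fst ` B" unfolding gr[symmetric] using w R by simp
    then obtain r where "((\<omega>, R), r) \<in> B" by force
    ultimately have "(\<omega>, R, r) \<in> B'" by (simp add: B'_iff)
    then have "\<omega> \<in> fst ` B'" by force
    with Z(2) w show False by blast
  qed
  have "E \<in> sets ?M" using E probsD(2)[OF P] by simp
  with f s z Z(1) show ?thesis
    by (intro exI[of _ E] exI[of _ "\<lambda>\<omega>. fst (h \<omega>)"] exI[of _ Z] conjI ballI) simp_all
qed

text \<open>For each \<open>P\<close> the selection traps the projection between the measurable set
  \<open>E\<close> and \<open>E \<union> Z\<close> with \<open>Z\<close> null, so it belongs to
  every completion.\<close>

lemma projection_umeas:
  assumes t: "t < T" and C: "C \<in> sets (\<Omega> t \<Otimes>\<^sub>M prob_algebra (N (Suc t)))"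
  shows "{\<omega> \<in> space (\<Omega> t). \<exists>R\<in>Qr (Suc t) \<omega>. (\<omega>, R) \<in> C} \<in> sets (umeas (\<Omega> t))"
  unfolding sets_umeas univ_sets_def
proof (intro CollectI conjI ballI)
  let ?X = "{\<omega> \<in> space (\<Omega> t). \<exists>R\<in>Qr (Suc t) \<omega>. (\<omega>, R) \<in> C}"
  fix P assume P: "P \<in> probs (\<Omega> t)"
  obtain E f Z where *: "E \<in> sets (\<Omega> t)" "\<forall>\<omega>\<in>E. f \<omega> \<in> Qr (Suc t) \<omega> \<and> (\<omega>, f \<omega>) \<in> C" "Z \<in> null_sets P"
    "\<forall>\<omega>\<in>space (\<Omega> t) - (E \<union> Z). \<forall>R\<in>Qr (Suc t) \<omega>. (\<omega>, R) \<notin> C"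
    using kernel_selection[OF t P C] by (elim exE conjE) (rule that)
  show "?X \<in> sets (completion P)"
  proof (rule sets_completionI)
    show "?X = E \<union> (?X - E)" using *(2) sets.sets_into_space[OF *(1)] by auto
    show "?X - E \<subseteq> Z" using *(4) by auto
    show "E \<in> sets P" using *(1) probsD(2)[OF P] by simp
  qed (rule *(3))
qed auto

text \<open>Selection with no further constraint on the local prior: nonempty values make
  \<open>E\<close> exhaust the space up to a null set.\<close>

lemma exists_kernel:
  assumes t: "t < T" and P: "P \<in> probs (\<Omega> t)"
  shows "\<exists>q. is_kernel (\<Omega> t) (N (Suc t)) q \<and> (AE \<omega> in P. q \<omega> \<in> Qr (Suc t) \<omega>)"
proof -
  let ?C = "space (\<Omega> t \<Otimes>\<^sub>M prob_algebra (N (Suc t)))"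
  obtain E f Z where *: "f \<in> \<Omega> t \<rightarrow>\<^sub>M prob_algebra (N (Suc t))" "\<forall>\<omega>\<in>E. f \<omega> \<in> Qr (Suc t) \<omega> \<and> (\<omega>, f \<omega>) \<in> ?C"
     "Z \<in> null_sets P" "\<forall>\<omega>\<in>space (\<Omega> t) - (E \<union> Z). \<forall>R\<in>Qr (Suc t) \<omega>. (\<omega>, R) \<notin> ?C"
    using kernel_selection[OF t P sets.top] by (elim exE conjE) (rule that)
  have "{\<omega> \<in> space P. f \<omega> \<notin> Qr (Suc t) \<omega>} \<subseteq> Z"
  proof
    fix \<omega> assume "\<omega> \<in> {\<omega> \<in> space P. f \<omega> \<notin> Qr (Suc t) \<omega>}"
    then have w: "\<omega> \<in> space (\<Omega> t)" "\<omega> \<notin> E" using *(2) probsD(3)[OF P] by auto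
    obtain R where R: "R \<in> Qr (Suc t) \<omega>" using Qr_ne[OF t w(1)] by blast
    then have "(\<omega>, R) \<in> ?C"
      using w(1) Qr_probs[OF t w(1) R] by (simp add: space_pair_measure space_prob_algebra_probs)
    with *(4) w R show "\<omega> \<in> Z" by blast
  qed
  with *(3) have "AE \<omega> in P. f \<omega> \<in> Qr (Suc t) \<omega>" by (rule AE_I')
  moreover have "is_kernel (\<Omega> t) (N (Suc t)) f"
    using *(1) by (intro is_kernelI measurable_umeasI)
  ultimately show ?thesis by blast
qed

lemma kcomp_Q:
  "P \<in> Q t \<Longrightarrow> is_kernel (\<Omega> t) (N (Suc t)) q \<Longrightarrow> AE \<omega> in P. q \<omega> \<in> Qr (Suc t) \<omega> \<Longrightarrow>
   kcomp Om t P q \<in> Q (Suc t) \<and> kernel_composition Om t P q"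
  using Qset_probs[of P Om Qr t] by (auto simp: AE_completion_iff kernel_composition_def)

text \<open>Every prior \<open>P\<close> can be prolonged by an admissible kernel, and an event that
  depends only on the past is constant under each \<open>q \<omega>\<close>.\<close>

lemma qs_unlift1:
  assumes t: "t < T" and R: "qs Om Qr (Suc t) (\<lambda>z. R (res t z))"
  shows "qs Om Qr t R"
  unfolding qs_iff
proof
  fix P assume PQ: "P \<in> Q t"
  obtain q where qq: "is_kernel (\<Omega> t) (N (Suc t)) q" "AE \<omega> in P. q \<omega> \<in> Qr (Suc t) \<omega>"
    using exists_kernel[OF t Qset_probs[OF PQ]] by blast
  interpret kernel_composition Om t P q using kcomp_Q[OF PQ qq] by blast
  have "AE z in kcomp Om t P q. R (res t z)"
    using R kcomp_Q[OF PQ qq] by (simp add: qs_iff)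
  from AE_kcompD[OF this] have ae: "AE \<omega> in P. AE x in q \<omega>. R (res t (up t \<omega> x))" .
  show "AE \<omega> in P. R \<omega>"
  proof (rule AE_mp[OF ae], rule AE_I2, rule impI)
    show "R \<omega>" if w: "\<omega> \<in> space P" and ae: "AE x in q \<omega>. R (res t (up t \<omega> x))" for \<omega>
    proof -
      have "\<omega> \<in> space (\<Omega> t)" using w probsD(3)[OF Qset_probs[OF PQ]] by simp
      then have "AE x in q \<omega>. R \<omega>" using ae by (simp only: res_upd)
      then show ?thesis
        using prob_space.AE_const[OF probsD(1)[OF q_probs[OF w]]] by simp
    qed
  qed
qed

lemma qs_unlift:
  "t \<le> t' \<Longrightarrow> t' \<le> T \<Longrightarrow> qs Om Qr t' (\<lambda>z. R (res t z)) \<Longrightarrow> qs Om Qr t R"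
proof (induction t' rule: dec_induct)
  case base
  show ?case by (rule qs_mono[OF base(2)]) (simp only: res_id)
next
  case (step n)
  have "qs Om Qr (Suc n) (\<lambda>z. R (res t (res n z)))"
    using step.prems(2) by (simp only: res_res[OF step.hyps(1)])
  then have h: "qs Om Qr n (\<lambda>z. R (res t z))"
    using step.prems(1) by (intro qs_unlift1[where R="\<lambda>z. R (res t z)"]) simp_all
  show ?case by (rule step.IH[OF _ h]) (use step.prems(1) in simp)
qed

text \<open>If local priors charging the section of \<open>C\<close> existed on a set of histories
  that is not \<open>P\<close>-negligible, selecting them measurably would give an admissible kernel
  whose composition with \<open>P\<close> charges \<open>C\<close>. This is the passage from global
  priors to all local priors at once.\<close>

lemma kernel_qs:
  assumes t: "t < T" and P: "P \<in> Q t" and C: "C \<in> sets (\<Omega> (Suc t))"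
    and qs: "\<And>q. is_kernel (\<Omega> t) (N (Suc t)) q \<Longrightarrow> AE \<omega> in P. q \<omega> \<in> Qr (Suc t) \<omega> \<Longrightarrow>
       AE z in kcomp Om t P q. z \<notin> C"
  shows "AE \<omega> in P. \<forall>R\<in>Qr (Suc t) \<omega>. AE x in R. up t \<omega> x \<notin> C"
proof -
  let ?A = "prob_algebra (N (Suc t))"
  note Pp = Qset_probs[OF P]
  define sec where "sec w = {x \<in> space (N (Suc t)). up t (fst w) x \<in> C}" for w :: "(nat \<Rightarrow> 'a) \<times> 'a measure"
  have sec_sets: "(SIGMA w:space (\<Omega> t \<Otimes>\<^sub>M ?A). sec w) \<in> sets ((\<Omega> t \<Otimes>\<^sub>M ?A) \<Otimes>\<^sub>M N (Suc t))"
  proof -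
    have "(\<lambda>v. (fst (fst v), snd v)) \<in> (\<Omega> t \<Otimes>\<^sub>M ?A) \<Otimes>\<^sub>M N (Suc t) \<rightarrow>\<^sub>M \<Omega> t \<Otimes>\<^sub>M N (Suc t)"
      by measurable
    from measurable_compose[OF this measurable_upd]
    have "(\<lambda>v. up t (fst (fst v)) (snd v)) \<in> (\<Omega> t \<Otimes>\<^sub>M ?A) \<Otimes>\<^sub>M N (Suc t) \<rightarrow>\<^sub>M \<Omega> (Suc t)"
      by (simp add: case_prod_beta')
    from measurable_sets[OF this C]
    have "(\<lambda>v. up t (fst (fst v)) (snd v)) -` C \<inter> space ((\<Omega> t \<Otimes>\<^sub>M ?A) \<Otimes>\<^sub>M N (Suc t)) \<in> sets ((\<Omega> t \<Otimes>\<^sub>M ?A) \<Otimes>\<^sub>M N (Suc t))" .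
    also have "(\<lambda>v. up t (fst (fst v)) (snd v)) -` C \<inter> space ((\<Omega> t \<Otimes>\<^sub>M ?A) \<Otimes>\<^sub>M N (Suc t)) =
      (SIGMA w:space (\<Omega> t \<Otimes>\<^sub>M ?A). sec w)"
      by (auto simp: sec_def space_pair_measure)
    finally show ?thesis .
  qed
  have em: "(\<lambda>w. emeasure (snd w) (sec w)) \<in> borel_measurable (\<Omega> t \<Otimes>\<^sub>M ?A)"
    by (rule emeasure_measurable_subprob_algebra2[OF sec_sets measurable_prob_algebraD]) simp
  \<comment> \<open>The pairs of a history and a local prior that charges the section of
    \<open>C\<close>. Selection wants this set measurable, which follows from the measurability of
    \<open>C\<close>; this is why \<open>C\<close> is taken in \<open>sets\<close> rather than among
    the universally measurable sets.\<close>
  define D where "D = {w \<in> space (\<Omega> t \<Otimes>\<^sub>M ?A). emeasure (snd w) (sec w) \<noteq> 0}"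
  have D: "D \<in> sets (\<Omega> t \<Otimes>\<^sub>M ?A)"
    unfolding D_def using em by measurable
  have D_iff: "(\<omega>, R) \<in> D \<longleftrightarrow> \<not> (AE x in R. up t \<omega> x \<notin> C)" if w: "\<omega> \<in> space (\<Omega> t)" and R: "R \<in> probs (N (Suc t))" for \<omega> R
  proof -
    have "sec (\<omega>, R) = up t \<omega> -` C \<inter> space R"
      by (auto simp: sec_def probsD[OF R])
    moreover have "up t \<omega> -` C \<inter> space R \<in> sets R"
      by (rule measurable_sets[OF measurable_upd1[OF w R] C])
    ultimately have "(AE x in R. up t \<omega> x \<notin> C) \<longleftrightarrow> emeasure R (sec (\<omega>, R)) = 0"
      by (intro AE_iff_measurable) auto
    then show ?thesis
      using w R by (simp add: D_def space_pair_measure space_prob_algebra_probs)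
  qed
  obtain E f Z where E: "E \<in> sets (\<Omega> t)" and f: "f \<in> \<Omega> t \<rightarrow>\<^sub>M ?A"
    and sel: "\<forall>\<omega>\<in>E. f \<omega> \<in> Qr (Suc t) \<omega> \<and> (\<omega>, f \<omega>) \<in> D" and Z: "Z \<in> null_sets P"
    and out: "\<forall>\<omega>\<in>space (\<Omega> t) - (E \<union> Z). \<forall>R\<in>Qr (Suc t) \<omega>. (\<omega>, R) \<notin> D"
    using kernel_selection[OF t Pp D] by (elim exE conjE) (rule that)
  obtain q0 where q0: "is_kernel (\<Omega> t) (N (Suc t)) q0" "AE \<omega> in P. q0 \<omega> \<in> Qr (Suc t) \<omega>"
    using exists_kernel[OF t Pp] by blast
  \<comment> \<open>An offending prior is used wherever one was found, and an arbitrary admissible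
    kernel elsewhere.\<close>
  define q where "q \<omega> = (if \<omega> \<in> E then f \<omega> else q0 \<omega>)" for \<omega>
  have q: "is_kernel (\<Omega> t) (N (Suc t)) q"
  proof (rule is_kernelI)
    have [measurable]: "q0 \<in> umeas (\<Omega> t) \<rightarrow>\<^sub>M ?A" "f \<in> umeas (\<Omega> t) \<rightarrow>\<^sub>M ?A" "E \<in> sets (umeas (\<Omega> t))"
      using q0(1) f E by (auto intro: is_kernelD measurable_umeasI sets_umeasI)
    show "q \<in> umeas (\<Omega> t) \<rightarrow>\<^sub>M ?A" unfolding q_def by measurable
  qed
  have q_in: "AE \<omega> in P. q \<omega> \<in> Qr (Suc t) \<omega>"
    using q0(2) by (rule eventually_mono) (use sel in \<open>simp add: q_def\<close>)
  interpret kernel_composition Om t P q using kcomp_Q[OF P q q_in] by blast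
  have ae: "AE \<omega> in P. AE x in q \<omega>. up t \<omega> x \<notin> C"
    by (rule AE_kcompD[OF qs[OF q q_in]])
  show ?thesis
  proof (rule AE_mp[OF AE_conjI[OF ae AE_not_in[OF Z]]], rule AE_I2, intro impI ballI)
    fix \<omega> R assume "\<omega> \<in> space P" and *: "(AE x in q \<omega>. up t \<omega> x \<notin> C) \<and> \<omega> \<notin> Z" and R: "R \<in> Qr (Suc t) \<omega>"
    then have w: "\<omega> \<in> space (\<Omega> t)" by (simp add: probsD[OF Pp])
    have "\<omega> \<notin> E"
    proof
      assume "\<omega> \<in> E"
      with sel have "(\<omega>, f \<omega>) \<in> D" "f \<omega> \<in> Qr (Suc t) \<omega>" by blast+
      have "q \<omega> = f \<omega>" using \<open>\<omega> \<in> E\<close> by (simp add: q_def)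
      then have "AE x in f \<omega>. up t \<omega> x \<notin> C" using conjunct1[OF *] by (simp only:)
      then show False
        using \<open>(\<omega>, f \<omega>) \<in> D\<close> D_iff[OF w Qr_probs[OF t w \<open>f \<omega> \<in> Qr (Suc t) \<omega>\<close>]] by blast
    qed
    then have "(\<omega>, R) \<notin> D" using out w R * by blast
    then show "AE x in R. up t \<omega> x \<notin> C" using D_iff[OF w Qr_probs[OF t w R]] by simp
  qed
qed

end

lemma completion_ex_borel_measurable_euclidean:
  fixes f :: "'x \<Rightarrow> 'b::euclidean_space"
  assumes f: "f \<in> borel_measurable (completion M)"
  shows "\<exists>g\<in>borel_measurable M. AE x in M. f x = g x"
proof -
  have "\<forall>b\<in>Basis. \<exists>g. g \<in> borel_measurable M \<and> (AE x in M. f x \<bullet> b = g x)"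
    using completion_ex_borel_measurable_real[OF borel_measurable_inner[OF f borel_measurable_const]] by blast
  then obtain g where g: "\<And>b. b \<in> Basis \<Longrightarrow> g b \<in> borel_measurable M"
    "\<And>b. b \<in> Basis \<Longrightarrow> AE x in M. f x \<bullet> b = g b x" by metis
  have "AE x in M. \<forall>b\<in>Basis. f x \<bullet> b = g b x"
    by (rule AE_finite_allI) (use g in auto)
  then have "AE x in M. f x = (\<Sum>b\<in>Basis. g b x *\<^sub>R b)"
    by (rule eventually_mono) (metis (no_types, lifting) euclidean_representation sum.cong)
  moreover have "(\<lambda>x. \<Sum>b\<in>Basis. g b x *\<^sub>R b) \<in> borel_measurable M"
    using g(1) by (intro borel_measurable_sum borel_measurable_scaleR) auto
  ultimately show ?thesis by (intro bexI)
qed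

lemma measure_eq_0_AE: "AE x in M. \<not> R x \<Longrightarrow> measure M {x \<in> space M. R x} = 0"
proof (cases "{x \<in> space M. R x} \<in> sets M")
  case True
  moreover assume "AE x in M. \<not> R x"
  ultimately have "emeasure M {x \<in> space M. R x} = 0"
    by (subst AE_iff_measurable[symmetric, where P="\<lambda>x. \<not> R x"]) auto
  then show ?thesis by (simp add: measure_def)
qed (simp add: measure_notin_sets)

text \<open>The family may be uncountable. By the Lindeloef property countably many of the open
  complements have the same union as all of them, so the exceptional set is a countable union of
  null sets.\<close>

lemma AE_in_closed_support:
  fixes f :: "'x \<Rightarrow> 'b::second_countable_topology"
  assumes R: "prob_space R" and full: "\<And>A. A \<in> \<A> \<Longrightarrow> closed A \<and> measure R {x \<in> space R. f x \<in> A} = 1"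
  shows "AE x in R. f x \<in> \<Inter>\<A>"
proof -
  interpret prob_space R by fact
  have "\<And>S. S \<in> uminus ` \<A> \<Longrightarrow> openin (top_of_set UNIV) S" using full by auto
  then obtain F where F: "F \<subseteq> uminus ` \<A>" "countable F" "\<Union>F = \<Union>(uminus ` \<A>)"
    by (rule Lindelof_openin)
  have "AE x in R. \<forall>S\<in>F. f x \<notin> S"
  proof (rule AE_ball_countable'[OF _ F(2)])
    fix S assume "S \<in> F"
    then obtain A where A: "A \<in> \<A>" "S = - A" using F(1) by auto
    from full[OF A(1)] have "AE x in R. x \<in> {x \<in> space R. f x \<in> A}" by (intro AE_prob_1) simp
    then show "AE x in R. f x \<notin> S" by (rule eventually_mono) (simp add: A(2))
  qed
  then show ?thesis
  proof (rule eventually_mono)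
    fix x assume "\<forall>S\<in>F. f x \<notin> S"
    then have "f x \<notin> \<Union>(uminus ` \<A>)" unfolding F(3)[symmetric] by blast
    then show "f x \<in> \<Inter>\<A>" by auto
  qed
qed

subsection \<open>Wealth bounds under no arbitrage\<close>

locale arbitrage_free_market = robust_market T Om Qr S
  for T :: nat
    and Om :: "nat \<Rightarrow> 'a::polish_space set"
    and Qr :: "nat \<Rightarrow> (nat \<Rightarrow> 'a) \<Rightarrow> 'a measure set"
    and S :: "nat \<Rightarrow> (nat \<Rightarrow> 'a) \<Rightarrow> 'b::euclidean_space" +
  fixes NA :: "nat \<Rightarrow> (nat \<Rightarrow> 'a) set" and \<alpha> :: "nat \<Rightarrow> (nat \<Rightarrow> 'a) \<Rightarrow> real"
  assumes A3: "\<forall>\<phi>\<in>strategies Om T. qs Om Qr T (\<lambda>\<omega>. 0 \<le> Vt S T 0 \<phi> \<omega>) \<longrightarrow>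
         qs Om Qr T (\<lambda>\<omega>. Vt S T 0 \<phi> \<omega> = 0)"
    and witness: "NA_witness Om Qr S T NA \<alpha>"
begin

abbreviation dS where "dS t \<omega> x \<equiv> S (Suc t) (up t \<omega> x) - S t \<omega>"

lemma S_meas: "t \<le> T \<Longrightarrow> S t \<in> borel_measurable (\<Omega> t)"
  using A2 by blast

lemma NA_sub: "t < T \<Longrightarrow> NA t \<subseteq> space (\<Omega> t)"
  using witness by (auto simp: NA_witness_def univ_sets_def)

lemma qs_NA: "t < T \<Longrightarrow> qs Om Qr t (\<lambda>\<omega>. \<omega> \<in> NA t)"
  using witness unfolding NA_witness_def full_def qs_def by blast

lemma alpha_pos: "t < T \<Longrightarrow> \<omega> \<in> space (\<Omega> t) \<Longrightarrow> 0 < \<alpha> t \<omega>"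
  using witness unfolding NA_witness_def by blast

lemma alpha_meas: "t < T \<Longrightarrow> \<alpha> t \<in> borel_measurable (umeas (\<Omega> t))"
  using witness unfolding NA_witness_def univ_meas_iff by blast

lemma strategiesD: "\<phi> \<in> strategies Om T \<Longrightarrow> t < T \<Longrightarrow> \<phi> (Suc t) \<in> borel_measurable (umeas (\<Omega> t))"
  by (force simp: strategies_def univ_meas_iff)

lemma strategiesI: "(\<And>t. t < T \<Longrightarrow> \<phi> (Suc t) \<in> borel_measurable (umeas (\<Omega> t))) \<Longrightarrow> \<phi> \<in> strategies Om T"
  unfolding strategies_def univ_meas_iff
proof (intro CollectI ballI)
  fix t assume *: "\<And>t. t < T \<Longrightarrow> \<phi> (Suc t) \<in> borel_measurable (umeas (\<Omega> t))" and t: "t \<in> {1..T}"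
  from t *[of "t - 1"] show "\<phi> t \<in> borel_measurable (umeas (\<Omega> (t - 1)))" by (cases t) auto
qed

lemma res_umeas: "t \<le> t' \<Longrightarrow> res t \<in> umeas (\<Omega> t') \<rightarrow>\<^sub>M umeas (\<Omega> t)"
  by (rule measurable_umeas_umeas[OF measurable_res])

lemma dS_meas:
  assumes "t < T"
  shows "(\<lambda>z. S (Suc t) z - S t (res t z)) \<in> borel_measurable (\<Omega> (Suc t))"
proof (rule borel_measurable_diff)
  show "S (Suc t) \<in> borel_measurable (\<Omega> (Suc t))" by (rule S_meas) (use assms in simp)
  have "S t \<in> borel_measurable (\<Omega> t)" by (rule S_meas) (use assms in simp)
  with measurable_res show "(\<lambda>z. S t (res t z)) \<in> borel_measurable (\<Omega> (Suc t))"
    by (rule measurable_compose) simp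
qed

lemma Vt_0: "Vt S 0 y \<phi> z = y"
  by (simp add: Vt_def)

lemma Vt_Suc: "Vt S (Suc t) y \<phi> z = Vt S t y \<phi> z + \<phi> (Suc t) (res t z) \<bullet> (S (Suc t) (res (Suc t) z) - S t (res t z))"
  by (simp add: Vt_def del: One_nat_def)

lemma Vt_res: "t \<le> t' \<Longrightarrow> Vt S t y \<phi> (res t' z) = Vt S t y \<phi> z"
  unfolding Vt_def by (intro arg_cong2[where f="(+)"] refl sum.cong) (simp only: atLeastAtMost_iff, subst (1 2 3) res_res, auto)

lemma Vt_const: "Vt S t y \<phi> z = y + Vt S t 0 \<phi> z"
  by (simp add: Vt_def)

lemma Vt_add: "Vt S t (x + y) (\<lambda>s \<omega>. \<phi> s \<omega> + \<psi> s \<omega>) z = Vt S t x \<phi> z + Vt S t y \<psi> z"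
  by (simp add: Vt_def inner_add_left sum.distrib)

lemma up_space: "\<omega> \<in> space (\<Omega> t) \<Longrightarrow> R \<in> probs (N (Suc t)) \<Longrightarrow> x \<in> space R \<Longrightarrow> up t \<omega> x \<in> space (\<Omega> (Suc t))"
  using measurable_space[OF measurable_upd1] by blast

lemma Vt_up:
  assumes "\<omega> \<in> space (\<Omega> t)" "R \<in> probs (N (Suc t))" "x \<in> space R"
  shows "Vt S (Suc t) y \<phi> (up t \<omega> x) = Vt S t y \<phi> \<omega> + \<phi> (Suc t) \<omega> \<bullet> dS t \<omega> x"
proof -
  have "Vt S t y \<phi> (up t \<omega> x) = Vt S t y \<phi> (res t (up t \<omega> x))" by (rule Vt_res[symmetric]) simp
  also have "\<dots> = Vt S t y \<phi> \<omega>" by (simp only: res_upd[OF assms(1)])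
  finally show ?thesis
    by (simp only: Vt_Suc res_upd[OF assms(1)] res_id[OF up_space[OF assms]])
qed

lemma Vt_meas:
  assumes \<phi>: "\<phi> \<in> strategies Om T"
  shows "t \<le> T \<Longrightarrow> Vt S t y \<phi> \<in> borel_measurable (umeas (\<Omega> t))"
proof (induction t)
  case 0
  show ?case by (simp add: Vt_0[abs_def])
next
  case (Suc t)
  then have t: "t < T" by simp
  have m1: "(\<lambda>z. Vt S t y \<phi> (res t z)) \<in> borel_measurable (umeas (\<Omega> (Suc t)))"
    by (rule measurable_compose[OF res_umeas Suc.IH]) (use t in auto)
  have m2: "(\<lambda>z. \<phi> (Suc t) (res t z)) \<in> borel_measurable (umeas (\<Omega> (Suc t)))"
    by (rule measurable_compose[OF res_umeas strategiesD[OF \<phi> t]]) simp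
  have "(\<lambda>z. Vt S t y \<phi> (res t z) + \<phi> (Suc t) (res t z) \<bullet> (S (Suc t) z - S t (res t z))) \<in> borel_measurable (umeas (\<Omega> (Suc t)))"
    by (intro borel_measurable_add borel_measurable_inner m1 m2 measurable_umeasI dS_meas t)
  then show ?case
    by (subst measurable_cong[where g="\<lambda>z. Vt S t y \<phi> (res t z) + \<phi> (Suc t) (res t z) \<bullet> (S (Suc t) z - S t (res t z))"])
      (auto simp only: space_umeas Vt_Suc Vt_res[OF order_refl] res_id)
qed

text \<open>Otherwise there is an arbitrage: trade in the single period after \<open>t\<close>,
  holding \<open>\<phi>\<close> exactly where wealth at \<open>t\<close> is negative. Wealth is
  nonnegative one period later, so the gain is strictly positive there and zero elsewhere.\<close>

lemma V_nonneg_step: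
  assumes \<phi>: "\<phi> \<in> strategies Om T" and t: "t < T"
    and nn: "qs Om Qr (Suc t) (\<lambda>z. 0 \<le> Vt S (Suc t) y \<phi> z)"
  shows "qs Om Qr t (\<lambda>z. 0 \<le> Vt S t y \<phi> z)"
proof -
  define \<psi> where "\<psi> s \<omega> = (if s = Suc t \<and> Vt S t y \<phi> \<omega> < 0 then \<phi> (Suc t) \<omega> else 0)" for s \<omega>
  have \<psi>: "\<psi> \<in> strategies Om T"
  proof (rule strategiesI)
    fix s assume s: "s < T"
    show "\<psi> (Suc s) \<in> borel_measurable (umeas (\<Omega> s))"
    proof (cases "s = t")
      case True
      have [measurable]: "Vt S t y \<phi> \<in> borel_measurable (umeas (\<Omega> t))" "\<phi> (Suc t) \<in> borel_measurable (umeas (\<Omega> t))"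
        using Vt_meas[OF \<phi>] strategiesD[OF \<phi> t] t by auto
      have "(\<lambda>\<omega>. if Vt S t y \<phi> \<omega> < 0 then \<phi> (Suc t) \<omega> else 0) \<in> borel_measurable (umeas (\<Omega> t))" by measurable
      then show ?thesis by (simp add: \<psi>_def[abs_def] True)
    qed (simp add: \<psi>_def[abs_def])
  qed
  have V\<psi>: "Vt S T 0 \<psi> z = (if Vt S t y \<phi> z < 0 then Vt S (Suc t) y \<phi> z - Vt S t y \<phi> z else 0)" for z
  proof -
    let ?g = "\<lambda>s. \<psi> s (restrict z {1..s - 1}) \<bullet> (S s (restrict z {1..s}) - S (s - 1) (restrict z {1..s - 1}))"
    have "Vt S T 0 \<psi> z = sum ?g {1..T}" by (simp add: Vt_def)
    also have "\<dots> = sum ?g {Suc t}"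
      using t by (intro sum.mono_neutral_right) (auto simp: \<psi>_def)
    also have "\<dots> = \<psi> (Suc t) (res t z) \<bullet> (S (Suc t) (res (Suc t) z) - S t (res t z))" by (simp del: One_nat_def)
    also have "\<dots> = (if Vt S t y \<phi> z < 0 then Vt S (Suc t) y \<phi> z - Vt S t y \<phi> z else 0)"
      unfolding \<psi>_def Vt_res[OF order_refl] Vt_Suc by (simp del: One_nat_def)
    finally show ?thesis .
  qed
  have nnT: "qs Om Qr T (\<lambda>z. 0 \<le> Vt S (Suc t) y \<phi> z)"
    using qs_lift[OF _ nn, of T] t by (simp only: Vt_res[OF order_refl])
  then have "qs Om Qr T (\<lambda>z. 0 \<le> Vt S T 0 \<psi> z)"
    by (rule qs_mono) (simp add: V\<psi>)
  with A3 \<psi> have "qs Om Qr T (\<lambda>z. Vt S T 0 \<psi> z = 0)" by blast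
  with nnT have "qs Om Qr T (\<lambda>z. 0 \<le> Vt S (Suc t) y \<phi> z \<and> Vt S T 0 \<psi> z = 0)" by (rule qs_conj)
  then have "qs Om Qr T (\<lambda>z. 0 \<le> Vt S t y \<phi> (res t z))"
    by (rule qs_mono) (simp only: V\<psi> Vt_res[OF order_refl], auto split: if_splits)
  then show ?thesis
    by (rule qs_unlift[rotated 2]) (use t in auto)
qed

lemma V_nonneg:
  assumes \<phi>: "\<phi> \<in> strategies Om T" and nn: "qs Om Qr T (\<lambda>z. 0 \<le> Vt S T y \<phi> z)"
  shows "t \<le> T \<Longrightarrow> qs Om Qr t (\<lambda>z. 0 \<le> Vt S t y \<phi> z)"
proof (induction rule: inc_induct)
  case (step n)
  from step.hyps(2) step.IH show ?case by (rule V_nonneg_step[OF \<phi>])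
qed (rule nn)

text \<open>The event of negative wealth is only universally measurable, so under each
  \<open>P\<close> the wealth and the position are replaced by Borel versions \<open>v\<close> and
  \<open>h\<close> before \<open>kernel_qs\<close> is applied. The versions remain valid under every
  extension of \<open>P\<close> by a kernel, since its marginal is \<open>P\<close>.\<close>

lemma local_nonneg:
  assumes \<phi>: "\<phi> \<in> strategies Om T" and t: "t < T"
    and nn: "qs Om Qr (Suc t) (\<lambda>z. 0 \<le> Vt S (Suc t) y \<phi> z)"
  shows "qs Om Qr t (\<lambda>\<omega>. \<forall>R\<in>Qr (Suc t) \<omega>. AE x in R. 0 \<le> Vt S t y \<phi> \<omega> + \<phi> (Suc t) \<omega> \<bullet> dS t \<omega> x)"
  unfolding qs_iff
proof
  fix P assume PQ: "P \<in> Q t"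
  note Pp = Qset_probs[OF PQ]
  obtain v where v: "v \<in> borel_measurable P" "AE \<omega> in P. Vt S t y \<phi> \<omega> = v \<omega>"
    using completion_ex_borel_measurable_real[OF measurable_umeas_completion[OF Vt_meas[OF \<phi>] Pp]] t by force
  obtain h where h: "h \<in> borel_measurable P" "AE \<omega> in P. \<phi> (Suc t) \<omega> = h \<omega>"
    using completion_ex_borel_measurable_euclidean[OF measurable_umeas_completion[OF strategiesD[OF \<phi> t] Pp]] by blast
  have vh: "AE \<omega> in P. Vt S t y \<phi> \<omega> = v \<omega> \<and> \<phi> (Suc t) \<omega> = h \<omega>"
    using v(2) h(2) by (rule AE_conjI)
  have [measurable]: "v \<in> borel_measurable (\<Omega> t)" "h \<in> borel_measurable (\<Omega> t)"
    using v(1) h(1) by (simp_all add: measurable_cong_sets[OF probsD(2)[OF Pp] refl])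
  have [measurable]: "res t \<in> \<Omega> (Suc t) \<rightarrow>\<^sub>M \<Omega> t" by (rule measurable_res) simp
  note [measurable] = dS_meas[OF t]
  define C where "C = {z \<in> space (\<Omega> (Suc t)). v (res t z) + h (res t z) \<bullet> (S (Suc t) z - S t (res t z)) < 0}"
  have C: "C \<in> sets (\<Omega> (Suc t))" unfolding C_def by measurable
  have nC: "AE \<omega> in P. \<forall>R\<in>Qr (Suc t) \<omega>. AE x in R. up t \<omega> x \<notin> C"
  proof (rule kernel_qs[OF t PQ C])
    fix q assume qq: "is_kernel (\<Omega> t) (N (Suc t)) q" "AE \<omega> in P. q \<omega> \<in> Qr (Suc t) \<omega>"
    have K: "kcomp Om t P q \<in> Q (Suc t)" and kc: "kernel_composition Om t P q"
      using kcomp_Q[OF PQ qq] by auto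
    note Kp = probsD[OF Qset_probs[OF K]]
    have 1: "AE z in kcomp Om t P q. 0 \<le> Vt S (Suc t) y \<phi> z" using nn K by (simp add: qs_iff)
    have "AE \<omega> in distr (kcomp Om t P q) (\<Omega> t) (res t). Vt S t y \<phi> \<omega> = v \<omega> \<and> \<phi> (Suc t) \<omega> = h \<omega>"
      using vh by (simp only: kernel_composition.kcomp_marginal[OF kc])
    then have 2: "AE z in kcomp Om t P q. Vt S t y \<phi> (res t z) = v (res t z) \<and> \<phi> (Suc t) (res t z) = h (res t z)"
      by (rule AE_distrD[rotated]) (simp add: measurable_cong_sets[OF Kp(2) refl] \<open>res t \<in> \<Omega> (Suc t) \<rightarrow>\<^sub>M \<Omega> t\<close> del: One_nat_def)
    show "AE z in kcomp Om t P q. z \<notin> C"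
    proof (rule AE_mp[OF AE_conjI[OF 1 2]], rule AE_I2, rule impI)
      fix z assume z: "z \<in> space (kcomp Om t P q)" and *: "0 \<le> Vt S (Suc t) y \<phi> z \<and>
        Vt S t y \<phi> (res t z) = v (res t z) \<and> \<phi> (Suc t) (res t z) = h (res t z)"
      have "res (Suc t) z = z" using z by (intro res_id) (simp add: Kp)
      with * show "z \<notin> C"
        unfolding C_def Vt_Suc by (auto simp: Vt_res simp del: One_nat_def)
    qed
  qed
  show "AE \<omega> in P. \<forall>R\<in>Qr (Suc t) \<omega>. AE x in R. 0 \<le> Vt S t y \<phi> \<omega> + \<phi> (Suc t) \<omega> \<bullet> dS t \<omega> x"
  proof (rule AE_mp[OF AE_conjI[OF vh nC]], rule AE_I2, rule impI, rule ballI)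
    fix \<omega> R assume w: "\<omega> \<in> space P" and R: "R \<in> Qr (Suc t) \<omega>"
      and *: "(Vt S t y \<phi> \<omega> = v \<omega> \<and> \<phi> (Suc t) \<omega> = h \<omega>) \<and> (\<forall>R\<in>Qr (Suc t) \<omega>. AE x in R. up t \<omega> x \<notin> C)"
    have w': "\<omega> \<in> space (\<Omega> t)" using w by (simp add: probsD[OF Pp])
    have ae: "AE x in R. up t \<omega> x \<notin> C" using * R by blast
    show "AE x in R. 0 \<le> Vt S t y \<phi> \<omega> + \<phi> (Suc t) \<omega> \<bullet> dS t \<omega> x"
    proof (rule AE_mp[OF ae], rule AE_I2, rule impI)
      fix x assume "x \<in> space R" "up t \<omega> x \<notin> C"
      then show "0 \<le> Vt S t y \<phi> \<omega> + \<phi> (Suc t) \<omega> \<bullet> dS t \<omega> x"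
        using * up_space[OF w' Qr_probs[OF t w' R]] unfolding C_def by (auto simp: res_upd[OF w'] simp del: One_nat_def)
    qed
  qed
qed

lemma AE_in_Dset:
  assumes t: "t < T" and w: "\<omega> \<in> space (\<Omega> t)" and R: "R \<in> Qr (Suc t) \<omega>"
  shows "AE x in R. dS t \<omega> x \<in> Dset Qr S t \<omega>"
proof -
  let ?\<A> = "{A. closed A \<and> (\<forall>P\<in>Qr (Suc t) \<omega>. measure P {x \<in> space P. dS t \<omega> x \<in> A} = 1)}"
  have "AE x in R. dS t \<omega> x \<in> \<Inter>?\<A>"
    by (rule AE_in_closed_support[OF probsD(1)[OF Qr_probs[OF t w R]]]) (use R in auto)
  then show ?thesis
  proof (rule eventually_mono)
    fix x assume "dS t \<omega> x \<in> \<Inter>?\<A>"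
    then show "dS t \<omega> x \<in> Dset Qr S t \<omega>"
      unfolding Dset_def by (rule hull_inc)
  qed
qed

text \<open>\<open>h\<close> is the orthogonal projection of the position \<open>g\<close>. Price
  increments lie in \<open>Dset\<close> almost surely under every local prior, so \<open>h\<close>
  earns the same gains as \<open>g\<close>, and only \<open>h\<close> can be bounded.\<close>

lemma Dset_projection:
  assumes t: "t < T" and w: "\<omega> \<in> NA t"
  obtains h where "h \<in> Dset Qr S t \<omega>" "\<And>v. v \<in> Dset Qr S t \<omega> \<Longrightarrow> g \<bullet> v = h \<bullet> v"
proof -
  have "subspace (Dset Qr S t \<omega>)" using witness t w by (auto simp: NA_witness_def)
  then have sp: "span (Dset Qr S t \<omega>) = Dset Qr S t \<omega>" by (simp add: span_eq_iff)
  obtain h k where "h \<in> span (Dset Qr S t \<omega>)" "\<And>v. v \<in> span (Dset Qr S t \<omega>) \<Longrightarrow> orthogonal k v" "g = h + k"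
    by (rule orthogonal_subspace_decomp_exists) blast
  then show ?thesis
    by (intro that[of h]) (auto simp: sp orthogonal_def inner_add_left)
qed

lemma NA_D:
  assumes t: "t < T" and w: "\<omega> \<in> NA t" and h: "h \<in> Dset Qr S t \<omega>" "h \<noteq> 0"
  obtains R where "R \<in> Qr (Suc t) \<omega>" "measure R {x \<in> space R. (h /\<^sub>R norm h) \<bullet> dS t \<omega> x < - \<alpha> t \<omega>} > \<alpha> t \<omega>"
  using witness t w h unfolding NA_witness_def by blast

text \<open>If the norm of \<open>h\<close> exceeded \<open>V / \<alpha> t \<omega>\<close>, some
  local prior from the no-arbitrage witness in direction \<open>h\<close> would produce, with
  positive probability, a loss above \<open>norm h * \<alpha> t \<omega> > V\<close>.\<close>

lemma projection_bound:
  assumes t: "t < T" and w: "\<omega> \<in> NA t" and V: "0 \<le> V"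
    and nn: "\<forall>R\<in>Qr (Suc t) \<omega>. AE x in R. 0 \<le> V + g \<bullet> dS t \<omega> x"
    and h: "h \<in> Dset Qr S t \<omega>" "\<And>v. v \<in> Dset Qr S t \<omega> \<Longrightarrow> g \<bullet> v = h \<bullet> v"
  shows "norm h \<le> V / \<alpha> t \<omega>"
proof (cases "h = 0")
  case False
  have w': "\<omega> \<in> space (\<Omega> t)" using w NA_sub[OF t] by blast
  have a: "0 < \<alpha> t \<omega>" by (rule alpha_pos[OF t w'])
  obtain R where R: "R \<in> Qr (Suc t) \<omega>" "measure R {x \<in> space R. (h /\<^sub>R norm h) \<bullet> dS t \<omega> x < - \<alpha> t \<omega>} > \<alpha> t \<omega>"
    by (rule NA_D[OF t w h(1) False])
  have "\<not> (AE x in R. \<not> (h /\<^sub>R norm h) \<bullet> dS t \<omega> x < - \<alpha> t \<omega>)"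
    using measure_eq_0_AE[where M=R and R="\<lambda>x. (h /\<^sub>R norm h) \<bullet> dS t \<omega> x < - \<alpha> t \<omega>"] R(2) a by auto
  show ?thesis
  proof (rule ccontr)
    assume "\<not> norm h \<le> V / \<alpha> t \<omega>"
    then have big: "V < norm h * \<alpha> t \<omega>" using a by (simp add: field_simps)
    have "AE x in R. 0 \<le> V + g \<bullet> dS t \<omega> x \<and> dS t \<omega> x \<in> Dset Qr S t \<omega>"
      using nn R(1) AE_in_Dset[OF t w' R(1)] by (intro AE_conjI) auto
    then have "AE x in R. \<not> (h /\<^sub>R norm h) \<bullet> dS t \<omega> x < - \<alpha> t \<omega>"
    proof (rule eventually_mono)
      fix x assume *: "0 \<le> V + g \<bullet> dS t \<omega> x \<and> dS t \<omega> x \<in> Dset Qr S t \<omega>"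
      then have eq: "g \<bullet> dS t \<omega> x = h \<bullet> dS t \<omega> x" by (intro h(2)) blast
      have "0 \<le> V + h \<bullet> dS t \<omega> x" using * unfolding eq by blast
      then have "- (norm h * \<alpha> t \<omega>) < h \<bullet> dS t \<omega> x" using big by simp
      then show "\<not> (h /\<^sub>R norm h) \<bullet> dS t \<omega> x < - \<alpha> t \<omega>"
        using False by (simp add: field_simps)
    qed
    with \<open>\<not> (AE x in R. \<not> (h /\<^sub>R norm h) \<bullet> dS t \<omega> x < - \<alpha> t \<omega>)\<close> show False by blast
  qed
qed (use V alpha_pos[OF t] w NA_sub[OF t] in \<open>auto intro!: divide_nonneg_pos\<close>)

text \<open>The bound on the wealth that one unit of capital can grow to: the projected position is
  at most current wealth divided by \<open>\<alpha>\<close>, so by Cauchy-Schwarz each period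
  multiplies wealth by no more than the corresponding factor.\<close>

definition wealth_factor :: "nat \<Rightarrow> (nat \<Rightarrow> 'a) \<Rightarrow> real" where
  "wealth_factor t z = (\<Prod>s<t. 1 + norm (S (Suc s) (res (Suc s) z) - S s (res s z)) / \<alpha> s (res s z))"

lemma wealth_factor_Suc: "wealth_factor (Suc t) z = wealth_factor t z * (1 + norm (S (Suc t) (res (Suc t) z) - S t (res t z)) / \<alpha> t (res t z))"
  by (simp add: wealth_factor_def)

lemma wealth_factor_res: "t \<le> t' \<Longrightarrow> wealth_factor t (res t' z) = wealth_factor t z"
  unfolding wealth_factor_def by (intro prod.cong refl) (simp only: lessThan_iff, subst (1 2 3) res_res, auto)

lemma dS_alpha_meas:
  assumes "t < T"
  shows "(\<lambda>z. 1 + norm (S (Suc t) z - S t (res t z)) / \<alpha> t (res t z)) \<in> borel_measurable (umeas (\<Omega> (Suc t)))"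
proof (intro borel_measurable_add borel_measurable_divide borel_measurable_const)
  show "(\<lambda>z. norm (S (Suc t) z - S t (res t z))) \<in> borel_measurable (umeas (\<Omega> (Suc t)))"
    by (rule measurable_compose[OF measurable_umeasI[OF dS_meas[OF assms]] borel_measurable_norm])
  show "(\<lambda>z. \<alpha> t (res t z)) \<in> borel_measurable (umeas (\<Omega> (Suc t)))"
    by (rule measurable_compose[OF res_umeas alpha_meas[OF assms]]) simp
qed

lemma wealth_step:
  assumes \<phi>: "\<phi> \<in> strategies Om T" and t: "t < T"
    and nn: "qs Om Qr T (\<lambda>z. 0 \<le> Vt S T y \<phi> z)"
  shows "qs Om Qr (Suc t) (\<lambda>z. Vt S (Suc t) y \<phi> z \<le>
    Vt S t y \<phi> (res t z) * (1 + norm (S (Suc t) z - S t (res t z)) / \<alpha> t (res t z)))"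
  unfolding qs_iff
proof
  fix K assume "K \<in> Q (Suc t)"
  then obtain P q where K: "K = kcomp Om t P q" and PQ: "P \<in> Q t" and kc: "kernel_composition Om t P q"
    and qin: "AE \<omega> in P. q \<omega> \<in> Qr (Suc t) \<omega>" by (rule Qset_SucE)
  have 1: "AE \<omega> in P. 0 \<le> Vt S t y \<phi> \<omega>" "AE \<omega> in P. \<omega> \<in> NA t"
    "AE \<omega> in P. \<forall>R\<in>Qr (Suc t) \<omega>. AE x in R. 0 \<le> Vt S t y \<phi> \<omega> + \<phi> (Suc t) \<omega> \<bullet> dS t \<omega> x"
    using V_nonneg[OF \<phi> nn, of t] qs_NA[OF t] local_nonneg[OF \<phi> t V_nonneg[OF \<phi> nn]] t PQ by (auto simp: qs_iff)
  show "AE z in K. Vt S (Suc t) y \<phi> z \<le> Vt S t y \<phi> (res t z) * (1 + norm (S (Suc t) z - S t (res t z)) / \<alpha> t (res t z))"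
    unfolding K
  proof (rule kernel_composition.AE_kcompI[OF kc])
    have m1: "Vt S (Suc t) y \<phi> \<in> borel_measurable (umeas (\<Omega> (Suc t)))"
      by (rule Vt_meas[OF \<phi>]) (use t in simp)
    have m2: "(\<lambda>z. Vt S t y \<phi> (res t z)) \<in> borel_measurable (umeas (\<Omega> (Suc t)))"
      by (rule measurable_compose[OF res_umeas Vt_meas[OF \<phi>]]) (use t in simp_all)
    show "Measurable.pred (umeas (\<Omega> (Suc t))) (\<lambda>z. Vt S (Suc t) y \<phi> z \<le>
        Vt S t y \<phi> (res t z) * (1 + norm (S (Suc t) z - S t (res t z)) / \<alpha> t (res t z)))"
      unfolding pred_def by (rule borel_measurable_le[OF m1 borel_measurable_times[OF m2 dS_alpha_meas[OF t]]])
    show "AE \<omega> in P. AE x in q \<omega>. Vt S (Suc t) y \<phi> (up t \<omega> x) \<le>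
        Vt S t y \<phi> (res t (up t \<omega> x)) * (1 + norm (S (Suc t) (up t \<omega> x) - S t (res t (up t \<omega> x))) / \<alpha> t (res t (up t \<omega> x)))"
    proof (rule AE_mp[OF AE_conjI[OF AE_conjI[OF 1(1,2)] AE_conjI[OF 1(3) qin]]], rule AE_I2, rule impI)
      fix \<omega> assume "\<omega> \<in> space P" and *: "(0 \<le> Vt S t y \<phi> \<omega> \<and> \<omega> \<in> NA t) \<and>
        (\<forall>R\<in>Qr (Suc t) \<omega>. AE x in R. 0 \<le> Vt S t y \<phi> \<omega> + \<phi> (Suc t) \<omega> \<bullet> dS t \<omega> x) \<and> q \<omega> \<in> Qr (Suc t) \<omega>"
      then have w: "\<omega> \<in> space (\<Omega> t)" by (simp add: probsD[OF Qset_probs[OF PQ]])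
      have NAw: "\<omega> \<in> NA t" and R: "q \<omega> \<in> Qr (Suc t) \<omega>" using * by auto
      obtain h where h: "h \<in> Dset Qr S t \<omega>" "\<And>v. v \<in> Dset Qr S t \<omega> \<Longrightarrow> \<phi> (Suc t) \<omega> \<bullet> v = h \<bullet> v"
        by (rule Dset_projection[OF t NAw, where g="\<phi> (Suc t) \<omega>"]) blast
      have hb: "norm h \<le> Vt S t y \<phi> \<omega> / \<alpha> t \<omega>"
        by (rule projection_bound[OF t NAw _ _ h]) (use * in auto)
      show "AE x in q \<omega>. Vt S (Suc t) y \<phi> (up t \<omega> x) \<le>
        Vt S t y \<phi> (res t (up t \<omega> x)) * (1 + norm (S (Suc t) (up t \<omega> x) - S t (res t (up t \<omega> x))) / \<alpha> t (res t (up t \<omega> x)))"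
      proof (rule AE_mp[OF AE_in_Dset[OF t w R]], rule AE_I2, rule impI)
        fix x assume x: "x \<in> space (q \<omega>)" and D: "dS t \<omega> x \<in> Dset Qr S t \<omega>"
        have "Vt S (Suc t) y \<phi> (up t \<omega> x) = Vt S t y \<phi> \<omega> + h \<bullet> dS t \<omega> x"
          by (simp only: Vt_up[OF w Qr_probs[OF t w R] x] h(2)[OF D])
        also have "h \<bullet> dS t \<omega> x \<le> norm h * norm (dS t \<omega> x)" by (rule norm_cauchy_schwarz)
        also have "\<dots> \<le> Vt S t y \<phi> \<omega> / \<alpha> t \<omega> * norm (dS t \<omega> x)" by (rule mult_right_mono[OF hb]) simp
        finally show "Vt S (Suc t) y \<phi> (up t \<omega> x) \<le>
          Vt S t y \<phi> (res t (up t \<omega> x)) * (1 + norm (S (Suc t) (up t \<omega> x) - S t (res t (up t \<omega> x))) / \<alpha> t (res t (up t \<omega> x)))"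
          by (simp only: res_upd[OF w]) (simp add: algebra_simps)
      qed
    qed
  qed
qed

lemma wealth_bound:
  assumes \<phi>: "\<phi> \<in> strategies Om T" and nn: "qs Om Qr T (\<lambda>z. 0 \<le> Vt S T y \<phi> z)"
  shows "t \<le> T \<Longrightarrow> qs Om Qr t (\<lambda>z. Vt S t y \<phi> z \<le> y * wealth_factor t z)"
proof (induction t)
  case 0
  show ?case by (simp add: qs_iff Vt_0 wealth_factor_def)
next
  case (Suc t)
  then have t: "t < T" by simp
  have "qs Om Qr (Suc t) (\<lambda>z. Vt S t y \<phi> (res t z) \<le> y * wealth_factor t (res t z))"
    by (rule qs_lift[OF _ Suc.IH]) (use t in auto)
  from qs_conj[OF this wealth_step[OF \<phi> t nn]] show ?case
  proof (rule qs_mono)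
    fix z assume z: "z \<in> space (\<Omega> (Suc t))" and *: "Vt S t y \<phi> (res t z) \<le> y * wealth_factor t (res t z) \<and> Vt S (Suc t) y \<phi> z \<le>
      Vt S t y \<phi> (res t z) * (1 + norm (S (Suc t) z - S t (res t z)) / \<alpha> t (res t z))"
    have "res t z \<in> space (\<Omega> t)" by (rule measurable_space[OF measurable_res z]) simp
    from alpha_pos[OF t this] have "0 \<le> 1 + norm (S (Suc t) z - S t (res t z)) / \<alpha> t (res t z)"
      by (intro add_nonneg_nonneg divide_nonneg_pos) auto
    from mult_right_mono[OF conjunct1[OF *] this] conjunct2[OF *]
    have "Vt S (Suc t) y \<phi> z \<le> y * wealth_factor t (res t z) * (1 + norm (S (Suc t) z - S t (res t z)) / \<alpha> t (res t z))" by linarith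
    then show "Vt S (Suc t) y \<phi> z \<le> y * wealth_factor (Suc t) z"
      by (simp only: wealth_factor_Suc wealth_factor_res[OF order_refl] res_id[OF z] mult.assoc)
  qed
qed

end

subsection \<open>Measurable cluster points\<close>

text \<open>A 1-Lipschitz function equals its infimal convolution with the norm, and the infimum may
  be taken over a dense sequence. The composition thus becomes a countable infimum of measurable
  functions.\<close>

lemma lipschitz_compose_measurable:
  fixes f :: "'x \<Rightarrow> 'b::euclidean_space \<Rightarrow> real"
  assumes fm: "\<And>h. (\<lambda>\<omega>. f \<omega> h) \<in> borel_measurable M"
    and lip: "\<And>\<omega> a b. \<omega> \<in> space M \<Longrightarrow> f \<omega> a \<le> f \<omega> b + norm (a - b)"
    and \<psi>: "\<psi> \<in> borel_measurable M"
  shows "(\<lambda>\<omega>. f \<omega> (\<psi> \<omega>)) \<in> borel_measurable M"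
proof -
  obtain r :: "nat \<Rightarrow> 'b" where r: "\<And>x e. 0 < e \<Longrightarrow> \<exists>i. dist (r i) x < e" by (rule dense_sequence) blast
  have "f \<omega> (\<psi> \<omega>) = (INF i. f \<omega> (r i) + norm (\<psi> \<omega> - r i))" if w: "\<omega> \<in> space M" for \<omega>
  proof (rule antisym)
    show "f \<omega> (\<psi> \<omega>) \<le> (INF i. f \<omega> (r i) + norm (\<psi> \<omega> - r i))"
      by (rule cINF_greatest) (use lip[OF w] in auto)
    have bdd: "bdd_below (range (\<lambda>i. f \<omega> (r i) + norm (\<psi> \<omega> - r i)))"
      by (rule bdd_belowI[of _ "f \<omega> (\<psi> \<omega>)"]) (use lip[OF w] in auto)
    show "(INF i. f \<omega> (r i) + norm (\<psi> \<omega> - r i)) \<le> f \<omega> (\<psi> \<omega>)"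
    proof (rule field_le_epsilon)
      fix e :: real assume "0 < e"
      then obtain i where i: "dist (r i) (\<psi> \<omega>) < e / 2" using r[of "e / 2"] by auto
      have "(INF i. f \<omega> (r i) + norm (\<psi> \<omega> - r i)) \<le> f \<omega> (r i) + norm (\<psi> \<omega> - r i)"
        by (rule cINF_lower[OF bdd]) simp
      also have "\<dots> \<le> f \<omega> (\<psi> \<omega>) + e"
        using lip[OF w, of "r i" "\<psi> \<omega>"] i by (simp add: dist_norm norm_minus_commute)
      finally show "(INF i. f \<omega> (r i) + norm (\<psi> \<omega> - r i)) \<le> f \<omega> (\<psi> \<omega>) + e" .
    qed
  qed
  moreover have "(\<lambda>\<omega>. INF i. f \<omega> (r i) + norm (\<psi> \<omega> - r i)) \<in> borel_measurable M"
    using fm \<psi> by (intro borel_measurable_cINF_real borel_measurable_add) auto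
  ultimately show ?thesis by (simp cong: measurable_cong)
qed

text \<open>The left side has countable quantifiers only, hence is measurable in a parameter; the
  right side speaks of actual cluster points. To return from left to right, points
  \<open>r i\<close> with tolerances tending to 0 stay in a compact ball, and the limit of a
  subsequence is a cluster point by the Lipschitz condition.\<close>

lemma cluster_near_iff:
  fixes g :: "nat \<Rightarrow> 'b::euclidean_space \<Rightarrow> real" and r :: "nat \<Rightarrow> 'b"
  assumes lip: "\<And>n a b. g n a \<le> g n b + norm (a - b)"
    and r: "\<And>x e. 0 < e \<Longrightarrow> \<exists>i. dist (r i) x < e"
  shows "(\<forall>m. \<exists>i. norm (r i - x) < \<rho> + 1 / Suc m \<and> (\<forall>N. \<exists>n\<ge>N. g n (r i) < 1 / Suc m)) \<longleftrightarrow>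
    (\<exists>z. norm (z - x) \<le> \<rho> \<and> (\<forall>e>0. \<forall>N. \<exists>n\<ge>N. g n z < e))" (is "?L \<longleftrightarrow> ?R")
proof
  assume ?R
  then obtain z where z: "norm (z - x) \<le> \<rho>" "\<And>e N. 0 < e \<Longrightarrow> \<exists>n\<ge>N. g n z < e" by blast
  show ?L
  proof
    fix m
    define e where "e = 1 / (2 * real (Suc m))"
    have e: "0 < e" "e + e = 1 / Suc m" by (simp_all add: e_def field_simps)
    from r[OF e(1)] obtain i where i: "norm (r i - z) < e" by (auto simp: dist_norm)
    have "norm (r i - x) < \<rho> + 1 / Suc m"
      using norm_triangle_ineq[of "r i - z" "z - x"] z(1) i e by simp
    moreover have "\<exists>n\<ge>N. g n (r i) < 1 / Suc m" for N
    proof -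
      from z(2)[OF e(1)] obtain n where "n \<ge> N" "g n z < e" by blast
      moreover have "g n (r i) \<le> g n z + norm (r i - z)" by (rule lip)
      ultimately show ?thesis using i e by (intro exI[of _ n]) linarith
    qed
    ultimately show "\<exists>i. norm (r i - x) < \<rho> + 1 / Suc m \<and> (\<forall>N. \<exists>n\<ge>N. g n (r i) < 1 / Suc m)" by blast
  qed
next
  assume L: ?L
  then obtain i where i: "\<And>m. norm (r (i m) - x) < \<rho> + 1 / Suc m"
    "\<And>m N. \<exists>n\<ge>N. g n (r (i m)) < 1 / Suc m" by metis
  have "r (i m) \<in> cball x (\<rho> + 1)" for m
  proof -
    have "1 / real (Suc m) \<le> 1" by simp
    with i(1)[of m] have "norm (r (i m) - x) \<le> \<rho> + 1" by linarith
    then show ?thesis by (simp add: dist_norm norm_minus_commute)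
  qed
  then obtain z s where s: "strict_mono (s :: nat \<Rightarrow> nat)" "((\<lambda>m. r (i m)) \<circ> s) \<longlonglongrightarrow> z"
    using compact_cball[of x "\<rho> + 1"] unfolding compact_def by (metis (no_types, lifting))
  have lim0: "(\<lambda>m. 1 / real (Suc (s m))) \<longlonglongrightarrow> 0"
    using LIMSEQ_subseq_LIMSEQ[OF LIMSEQ_inverse_real_of_nat s(1)] by (simp add: comp_def inverse_eq_divide)
  have lz: "(\<lambda>m. norm (r (i (s m)) - z)) \<longlonglongrightarrow> 0"
    using s(2) by (simp add: comp_def tendsto_norm_zero LIM_zero_iff)
  have "norm (z - x) \<le> \<rho> + 0"
  proof (rule LIMSEQ_le)
    show "(\<lambda>m. norm (r (i (s m)) - x)) \<longlonglongrightarrow> norm (z - x)"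
      using s(2) by (intro tendsto_intros) (simp add: comp_def)
    show "(\<lambda>m. \<rho> + 1 / real (Suc (s m))) \<longlonglongrightarrow> \<rho> + 0"
      by (intro tendsto_add tendsto_const lim0)
    show "\<exists>N. \<forall>n\<ge>N. norm (r (i (s n)) - x) \<le> \<rho> + 1 / real (Suc (s n))"
      using i(1) less_imp_le by blast
  qed
  moreover have "\<exists>n\<ge>N. g n z < e" if e: "0 < e" for e N
  proof -
    have "\<forall>\<^sub>F m in sequentially. 1 / real (Suc (s m)) < e / 2 \<and> norm (r (i (s m)) - z) < e / 2"
      using order_tendstoD(2)[OF lim0, of "e / 2"] order_tendstoD(2)[OF lz, of "e / 2"] e by (simp add: eventually_conj)
    then obtain m where m: "1 / real (Suc (s m)) < e / 2" "norm (r (i (s m)) - z) < e / 2"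
      using eventually_happens'[OF sequentially_bot] by blast
    obtain n where n: "n \<ge> N" "g n (r (i (s m))) < 1 / Suc (s m)" using i(2) by blast
    have "g n z \<le> g n (r (i (s m))) + norm (z - r (i (s m)))" by (rule lip)
    with n m show ?thesis by (intro exI[of _ n]) (simp add: norm_minus_commute)
  qed
  ultimately show ?R by auto
qed

text \<open>\<open>idx\<close> takes at each stage \<open>k\<close> the least admissible index of a
  point of the dense sequence with a cluster point within \<open>1 / 2 ^ k\<close>. These points
  converge, and their limit \<open>\<psi>\<close> is a cluster point because the cluster points form
  a closed set. \<open>\<tau> k\<close> is the first index from \<open>k\<close> on at which
  \<open>f\<close> is small. Where no cluster point exists, both have arbitrary values but stay
  measurable.\<close>

lemma measurable_cluster:
  fixes f :: "'x \<Rightarrow> 'b::euclidean_space \<Rightarrow> real" and \<phi> :: "nat \<Rightarrow> 'x \<Rightarrow> 'b"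
  assumes fm: "\<And>h. (\<lambda>\<omega>. f \<omega> h) \<in> borel_measurable M"
    and lip: "\<And>\<omega> a b. \<omega> \<in> space M \<Longrightarrow> f \<omega> a \<le> f \<omega> b + norm (a - b)"
    and \<phi>: "\<And>n. \<phi> n \<in> borel_measurable M"
  shows "\<exists>\<psi> \<tau>. \<psi> \<in> borel_measurable M \<and> (\<forall>k. \<tau> k \<in> M \<rightarrow>\<^sub>M count_space UNIV) \<and>
    (\<forall>\<omega>\<in>space M. (\<exists>z. \<forall>e>0. \<forall>N. \<exists>n\<ge>N. f \<omega> (\<phi> n \<omega> - z) < e) \<longrightarrow>
       (\<forall>k :: nat. k \<le> \<tau> k \<omega> \<and> f \<omega> (\<phi> (\<tau> k \<omega>) \<omega> - \<psi> \<omega>) < 1 / Suc k))"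
proof -
  obtain r :: "nat \<Rightarrow> 'b" where r: "\<And>x e. 0 < e \<Longrightarrow> \<exists>i. dist (r i) x < e" by (rule dense_sequence) blast
  define g where "g \<omega> n a = f \<omega> (\<phi> n \<omega> - a)" for \<omega> n a
  have glip: "g \<omega> n a \<le> g \<omega> n b + norm (a - b)" if "\<omega> \<in> space M" for \<omega> n a b
    using lip[OF that, of "\<phi> n \<omega> - a" "\<phi> n \<omega> - b"] by (simp add: g_def norm_minus_commute)
  have gm: "(\<lambda>\<omega>. g \<omega> n (\<psi> \<omega>)) \<in> borel_measurable M" if "\<psi> \<in> borel_measurable M" for n \<psi>
    unfolding g_def by (rule lipschitz_compose_measurable[OF fm lip borel_measurable_diff[OF \<phi> that]])
  have gmc [measurable]: "(\<lambda>\<omega>. g \<omega> n a) \<in> borel_measurable M" for n a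
    using gm[of "\<lambda>_. a"] by simp
  define Z where "Z \<omega> z \<longleftrightarrow> (\<forall>e>0. \<forall>N. \<exists>n\<ge>N. g \<omega> n z < e)" for \<omega> z
  define B where "B \<omega> x \<rho> \<longleftrightarrow> (\<forall>m. \<exists>i. norm (r i - x) < \<rho> + 1 / Suc m \<and> (\<forall>N. \<exists>n\<ge>N. g \<omega> n (r i) < 1 / Suc m))" for \<omega> x \<rho>
  have B_iff: "B \<omega> x \<rho> \<longleftrightarrow> (\<exists>z. norm (z - x) \<le> \<rho> \<and> Z \<omega> z)" if "\<omega> \<in> space M" for \<omega> x \<rho>
    unfolding B_def Z_def by (rule cluster_near_iff[OF glip[OF that] r])
  have B_meas [measurable]: "Measurable.pred M (\<lambda>\<omega>. B \<omega> x \<rho>)" for x \<rho>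
    unfolding B_def by measurable
  \<comment> \<open>Two successive approximations lie within \<open>1 / 2 ^ k\<close> and
    \<open>1 / 2 ^ Suc k\<close> of a common cluster point, hence less than \<open>2 / 2 ^ k\<close>
    apart; imposing this bound makes the increments summable.\<close>
  define c where "c j k i \<longleftrightarrow> norm (r i - r j) < 2 / 2 ^ k" for j k i
  define idx where "idx \<omega> = rec_nat (LEAST i. B \<omega> (r i) 1) (\<lambda>k j. LEAST i. c j k i \<and> B \<omega> (r i) (1 / 2 ^ Suc k))" for \<omega>
  have idx_0: "idx \<omega> 0 = (LEAST i. B \<omega> (r i) 1)"
    and idx_Suc: "idx \<omega> (Suc k) = (LEAST i. c (idx \<omega> k) k i \<and> B \<omega> (r i) (1 / 2 ^ Suc k))" for \<omega> k
    by (simp_all add: idx_def)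
  have idx_meas [measurable]: "(\<lambda>\<omega>. idx \<omega> k) \<in> M \<rightarrow>\<^sub>M count_space UNIV" for k
  proof (induction k)
    case 0
    show ?case unfolding idx_0 by measurable
  next
    case (Suc k)
    show ?case unfolding idx_Suc
      by (rule measurable_compose_countable[OF _ Suc, where f="\<lambda>j \<omega>. LEAST i. c j k i \<and> B \<omega> (r i) (1 / 2 ^ Suc k)"]) measurable
  qed
  define \<psi> where "\<psi> \<omega> = lim (\<lambda>k. r (idx \<omega> k))" for \<omega>
  have \<psi>m: "\<psi> \<in> borel_measurable M"
    unfolding \<psi>_def by (rule borel_measurable_lim_metric) measurable
  define \<tau> where "\<tau> k \<omega> = (LEAST n. k \<le> n \<and> g \<omega> n (\<psi> \<omega>) < 1 / Suc k)" for k :: nat and \<omega>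
  have \<tau>m: "\<tau> k \<in> M \<rightarrow>\<^sub>M count_space UNIV" for k
    unfolding \<tau>_def using gm[OF \<psi>m] by measurable
  have main: "k \<le> \<tau> k \<omega> \<and> f \<omega> (\<phi> (\<tau> k \<omega>) \<omega> - \<psi> \<omega>) < 1 / Suc k"
    if w: "\<omega> \<in> space M" and ex: "\<exists>z. \<forall>e>0. \<forall>N. \<exists>n\<ge>N. f \<omega> (\<phi> n \<omega> - z) < e" for \<omega> k
  proof -
    from ex obtain z0 where z0: "Z \<omega> z0" unfolding Z_def g_def by blast
    have step: "\<exists>i. c j k i \<and> B \<omega> (r i) (1 / 2 ^ Suc k)" if Bj: "B \<omega> (r j) (1 / 2 ^ k)" for j k
    proof -
      obtain z where z: "norm (z - r j) \<le> 1 / 2 ^ k" "Z \<omega> z" using Bj by (auto simp: B_iff[OF w])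
      obtain i where i: "dist (r i) z < 1 / 2 ^ Suc k" using r[of "1 / 2 ^ Suc k" z] by auto
      have "norm (r i - r j) \<le> norm (r i - z) + norm (z - r j)"
        using norm_triangle_ineq[of "r i - z" "z - r j"] by simp
      also have "\<dots> < 2 / 2 ^ k"
        using i z(1) by (simp add: dist_norm field_simps)
      finally have "c j k i \<and> B \<omega> (r i) (1 / 2 ^ Suc k)"
        using i z(2) by (auto simp: c_def B_iff[OF w] dist_norm norm_minus_commute intro!: exI[of _ z])
      then show ?thesis by (rule exI)
    qed
    have Bk: "B \<omega> (r (idx \<omega> k)) (1 / 2 ^ k)" for k
    proof (induction k)
      case 0
      obtain i where "dist (r i) z0 < 1" using r[of 1 z0] by auto
      then have "B \<omega> (r i) 1" using z0 by (auto simp: B_iff[OF w] dist_norm norm_minus_commute intro!: exI[of _ z0])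
      then show ?case unfolding idx_0 using LeastI[of "\<lambda>i. B \<omega> (r i) 1"] by simp
    next
      case (Suc k)
      from LeastI_ex[OF step[OF Suc]] show ?case unfolding idx_Suc by (rule conjunct2)
    qed
    have close: "norm (r (idx \<omega> (Suc k)) - r (idx \<omega> k)) < 2 / 2 ^ k" for k
      using LeastI_ex[OF step[OF Bk[of k]]] unfolding idx_Suc c_def by (rule conjunct1)
    have "summable (\<lambda>k. r (idx \<omega> (Suc k)) - r (idx \<omega> k))"
    proof (rule summable_comparison_test')
      show "summable (\<lambda>k. 2 * (1 / 2 :: real) ^ k)" by (intro summable_mult summable_geometric) simp
      show "norm (r (idx \<omega> (Suc k)) - r (idx \<omega> k)) \<le> 2 * (1 / 2) ^ k" if "0 \<le> k" for k
        using close[of k] by (simp add: power_divide)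
    qed
    then have "convergent (\<lambda>n. \<Sum>k<n. r (idx \<omega> (Suc k)) - r (idx \<omega> k))"
      by (simp add: summable_iff_convergent)
    then have "convergent (\<lambda>n. r (idx \<omega> n) - r (idx \<omega> 0))"
      by (simp only: sum_lessThan_telescope[of "\<lambda>k. r (idx \<omega> k)"])
    then have "convergent (\<lambda>n. r (idx \<omega> n) - r (idx \<omega> 0) + r (idx \<omega> 0))"
      by (rule convergent_add[OF _ convergent_const])
    then have conv: "(\<lambda>n. r (idx \<omega> n)) \<longlonglongrightarrow> \<psi> \<omega>"
      by (simp add: \<psi>_def convergent_LIMSEQ_iff)
    have Z\<psi>: "Z \<omega> (\<psi> \<omega>)"
      unfolding Z_def
    proof (intro allI impI)
      fix e :: real and N :: nat assume e: "0 < e"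
      have 1: "\<forall>\<^sub>F k in sequentially. norm (r (idx \<omega> k) - \<psi> \<omega>) < e / 3"
        using tendstoD[OF conv, of "e / 3"] e by (simp add: dist_norm)
      have "(\<lambda>k. (1 / 2 :: real) ^ k) \<longlonglongrightarrow> 0" by (rule LIMSEQ_power_zero) simp
      then have 2: "\<forall>\<^sub>F k in sequentially. (1 / 2 :: real) ^ k < e / 3"
        using e by (intro order_tendstoD(2)) auto
      from eventually_conj[OF 1 2] obtain k where k: "norm (r (idx \<omega> k) - \<psi> \<omega>) < e / 3" "(1 / 2 :: real) ^ k < e / 3"
        using eventually_happens'[OF sequentially_bot] by blast
      obtain z where z: "norm (z - r (idx \<omega> k)) \<le> 1 / 2 ^ k" "Z \<omega> z" using Bk by (auto simp: B_iff[OF w])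
      obtain n where n: "n \<ge> N" "g \<omega> n z < e / 3" using z(2) e unfolding Z_def by (meson divide_pos_pos zero_less_numeral)
      have "g \<omega> n (\<psi> \<omega>) \<le> g \<omega> n z + norm (\<psi> \<omega> - z)" by (rule glip[OF w])
      moreover have "norm (\<psi> \<omega> - z) \<le> norm (\<psi> \<omega> - r (idx \<omega> k)) + norm (r (idx \<omega> k) - z)"
        using norm_triangle_ineq[of "\<psi> \<omega> - r (idx \<omega> k)" "r (idx \<omega> k) - z"] by simp
      moreover have "norm (\<psi> \<omega> - r (idx \<omega> k)) < e / 3" "norm (r (idx \<omega> k) - z) < e / 3"
        using k z(1) by (simp_all add: norm_minus_commute power_divide)
      ultimately show "\<exists>n\<ge>N. g \<omega> n (\<psi> \<omega>) < e" using n by (intro exI[of _ n]) linarith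
    qed
    have "0 < 1 / real (Suc k)" by simp
    with Z\<psi> have "\<exists>n. k \<le> n \<and> g \<omega> n (\<psi> \<omega>) < 1 / Suc k" unfolding Z_def by blast
    then have "k \<le> \<tau> k \<omega> \<and> g \<omega> (\<tau> k \<omega>) (\<psi> \<omega>) < 1 / Suc k"
      unfolding \<tau>_def by (rule LeastI_ex)
    then show ?thesis by (simp add: g_def)
  qed
  show ?thesis
    by (rule exI[of _ \<psi>], rule exI[of _ \<tau>], intro conjI allI ballI impI \<psi>m \<tau>m main[THEN conjunct1] main[THEN conjunct2]) assumption+
qed

subsection \<open>Closedness of the set of superreplicable claims\<close>

context arbitrage_free_market
begin

text \<open>For fixed \<omega> this is a seminorm; it vanishes exactly on the positions without gains or losses under all
  local priors. The weight makes it finite and Lipschitz.\<close>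

definition seminorm_enn :: "nat \<Rightarrow> (nat \<Rightarrow> 'a) \<Rightarrow> 'b \<Rightarrow> ennreal" where
  "seminorm_enn t \<omega> h = (SUP R\<in>Qr (Suc t) \<omega>. \<integral>\<^sup>+x. ennreal (\<bar>h \<bullet> dS t \<omega> x\<bar> / (1 + norm (dS t \<omega> x))) \<partial>R)"

lemma dS_pair_meas:
  assumes t: "t < T"
  shows "(\<lambda>(\<omega>, x). dS t \<omega> x) \<in> borel_measurable (\<Omega> t \<Otimes>\<^sub>M N (Suc t))"
proof -
  have 1: "(\<lambda>w. S (Suc t) ((\<lambda>(\<omega>, x). up t \<omega> x) w)) \<in> borel_measurable (\<Omega> t \<Otimes>\<^sub>M N (Suc t))"
    by (rule measurable_compose[OF measurable_upd S_meas]) (use t in simp)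
  have 2: "(\<lambda>w. S t (fst w)) \<in> borel_measurable (\<Omega> t \<Otimes>\<^sub>M N (Suc t))"
    by (rule measurable_compose[OF measurable_fst S_meas]) (use t in simp)
  from borel_measurable_diff[OF 1 2] show ?thesis by (simp add: case_prod_beta')
qed

lemma dS_R_meas:
  assumes t: "t < T" and w: "\<omega> \<in> space (\<Omega> t)" and R: "R \<in> probs (N (Suc t))"
  shows "dS t \<omega> \<in> borel_measurable R"
proof -
  have "(\<lambda>x. S (Suc t) (up t \<omega> x)) \<in> borel_measurable R"
    by (rule measurable_compose[OF measurable_upd1[OF w R] S_meas]) (use t in simp)
  then show ?thesis by (intro borel_measurable_diff borel_measurable_const)
qed

lemma weight_le: "\<bar>h \<bullet> v\<bar> / (1 + norm (v :: 'b)) \<le> norm h"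
proof -
  have "\<bar>h \<bullet> v\<bar> \<le> norm h * norm v" by (rule Cauchy_Schwarz_ineq2)
  also have "\<dots> \<le> norm h * (1 + norm v)" by (intro mult_left_mono) auto
  finally show ?thesis by (simp add: divide_le_eq add_pos_nonneg)
qed

lemma seminorm_enn_le_norm:
  assumes t: "t < T" and w: "\<omega> \<in> space (\<Omega> t)"
  shows "seminorm_enn t \<omega> h \<le> ennreal (norm h)"
  unfolding seminorm_enn_def
proof (rule SUP_least)
  fix R assume R: "R \<in> Qr (Suc t) \<omega>"
  interpret R: prob_space R using probsD(1)[OF Qr_probs[OF t w R]] .
  have "(\<integral>\<^sup>+x. ennreal (\<bar>h \<bullet> dS t \<omega> x\<bar> / (1 + norm (dS t \<omega> x))) \<partial>R) \<le> (\<integral>\<^sup>+x. ennreal (norm h) \<partial>R)"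
    by (intro nn_integral_mono ennreal_leI weight_le)
  also have "\<dots> = ennreal (norm h)" by (simp add: R.emeasure_space_1)
  finally show "(\<integral>\<^sup>+x. ennreal (\<bar>h \<bullet> dS t \<omega> x\<bar> / (1 + norm (dS t \<omega> x))) \<partial>R) \<le> ennreal (norm h)" .
qed

lemma seminorm_enn_add:
  assumes t: "t < T" and w: "\<omega> \<in> space (\<Omega> t)"
  shows "seminorm_enn t \<omega> (a + b) \<le> seminorm_enn t \<omega> a + seminorm_enn t \<omega> b"
  unfolding seminorm_enn_def[of t \<omega> "a + b"]
proof (rule SUP_least)
  fix R assume R: "R \<in> Qr (Suc t) \<omega>"
  note [measurable] = dS_R_meas[OF t w Qr_probs[OF t w R]]
  have "\<bar>(a + b) \<bullet> v\<bar> / (1 + norm v) \<le> \<bar>a \<bullet> v\<bar> / (1 + norm v) + \<bar>b \<bullet> v\<bar> / (1 + norm v)" for v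
    unfolding add_divide_distrib[symmetric] inner_add_left by (intro divide_right_mono abs_triangle_ineq) simp
  then have "(\<integral>\<^sup>+x. ennreal (\<bar>(a + b) \<bullet> dS t \<omega> x\<bar> / (1 + norm (dS t \<omega> x))) \<partial>R) \<le>
     (\<integral>\<^sup>+x. ennreal (\<bar>a \<bullet> dS t \<omega> x\<bar> / (1 + norm (dS t \<omega> x))) + ennreal (\<bar>b \<bullet> dS t \<omega> x\<bar> / (1 + norm (dS t \<omega> x))) \<partial>R)"
    by (intro nn_integral_mono) (simp add: ennreal_plus[symmetric] del: ennreal_plus)
  also have "\<dots> = (\<integral>\<^sup>+x. ennreal (\<bar>a \<bullet> dS t \<omega> x\<bar> / (1 + norm (dS t \<omega> x))) \<partial>R) + (\<integral>\<^sup>+x. ennreal (\<bar>b \<bullet> dS t \<omega> x\<bar> / (1 + norm (dS t \<omega> x))) \<partial>R)"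
    by (rule nn_integral_add) measurable
  also have "\<dots> \<le> seminorm_enn t \<omega> a + seminorm_enn t \<omega> b"
    unfolding seminorm_enn_def by (intro add_mono SUP_upper R)
  finally show "(\<integral>\<^sup>+x. ennreal (\<bar>(a + b) \<bullet> dS t \<omega> x\<bar> / (1 + norm (dS t \<omega> x))) \<partial>R) \<le> seminorm_enn t \<omega> a + seminorm_enn t \<omega> b" .
qed

lemma seminorm_enn_scale:
  assumes t: "t < T" and w: "\<omega> \<in> space (\<Omega> t)"
  shows "seminorm_enn t \<omega> (c *\<^sub>R h) = ennreal \<bar>c\<bar> * seminorm_enn t \<omega> h"
  unfolding seminorm_enn_def SUP_mult_left_ennreal
proof (rule SUP_cong[OF refl])
  fix R assume R: "R \<in> Qr (Suc t) \<omega>"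
  note [measurable] = dS_R_meas[OF t w Qr_probs[OF t w R]]
  have "(\<integral>\<^sup>+x. ennreal (\<bar>c *\<^sub>R h \<bullet> dS t \<omega> x\<bar> / (1 + norm (dS t \<omega> x))) \<partial>R) =
    (\<integral>\<^sup>+x. ennreal \<bar>c\<bar> * ennreal (\<bar>h \<bullet> dS t \<omega> x\<bar> / (1 + norm (dS t \<omega> x))) \<partial>R)"
    by (intro nn_integral_cong) (simp add: abs_mult ennreal_mult[symmetric])
  also have "\<dots> = ennreal \<bar>c\<bar> * (\<integral>\<^sup>+x. ennreal (\<bar>h \<bullet> dS t \<omega> x\<bar> / (1 + norm (dS t \<omega> x))) \<partial>R)"
    by (rule nn_integral_cmult) measurable
  finally show "(\<integral>\<^sup>+x. ennreal (\<bar>c *\<^sub>R h \<bullet> dS t \<omega> x\<bar> / (1 + norm (dS t \<omega> x))) \<partial>R) =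
    ennreal \<bar>c\<bar> * (\<integral>\<^sup>+x. ennreal (\<bar>h \<bullet> dS t \<omega> x\<bar> / (1 + norm (dS t \<omega> x))) \<partial>R)" .
qed

lemma seminorm_enn_cong:
  assumes "\<And>R. R \<in> Qr (Suc t) \<omega> \<Longrightarrow> AE x in R. a \<bullet> dS t \<omega> x = b \<bullet> dS t \<omega> x"
  shows "seminorm_enn t \<omega> a = seminorm_enn t \<omega> b"
  unfolding seminorm_enn_def by (intro SUP_cong refl nn_integral_cong_AE eventually_mono[OF assms]) auto

text \<open>The integral is measurable in the pair of history and local prior, so a superlevel set
  of the supremum is the projection of a measurable set of pairs and \<open>projection_umeas\<close>
  applies.\<close>

lemma seminorm_enn_meas:
  assumes t: "t < T"
  shows "(\<lambda>\<omega>. seminorm_enn t \<omega> h) \<in> borel_measurable (umeas (\<Omega> t))"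
proof (rule borel_measurableI_greater)
  fix y :: ennreal
  let ?A = "prob_algebra (N (Suc t))"
  have "(\<lambda>v. dS t (fst (fst v)) (snd v)) \<in> borel_measurable ((\<Omega> t \<Otimes>\<^sub>M ?A) \<Otimes>\<^sub>M N (Suc t))"
  proof -
    have "(\<lambda>v. (fst (fst v), snd v)) \<in> (\<Omega> t \<Otimes>\<^sub>M ?A) \<Otimes>\<^sub>M N (Suc t) \<rightarrow>\<^sub>M \<Omega> t \<Otimes>\<^sub>M N (Suc t)"
      by measurable
    from measurable_compose[OF this dS_pair_meas[OF t]] show ?thesis by (simp add: case_prod_beta')
  qed
  then have "(\<lambda>v. ennreal (\<bar>h \<bullet> dS t (fst (fst v)) (snd v)\<bar> / (1 + norm (dS t (fst (fst v)) (snd v))))) \<in>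
      borel_measurable ((\<Omega> t \<Otimes>\<^sub>M ?A) \<Otimes>\<^sub>M N (Suc t))"
    by (intro measurable_compose[OF _ measurable_ennreal] borel_measurable_divide borel_measurable_abs
        borel_measurable_inner borel_measurable_add borel_measurable_const measurable_compose[OF _ borel_measurable_norm])
  then have "(\<lambda>w. \<integral>\<^sup>+x. ennreal (\<bar>h \<bullet> dS t (fst w) x\<bar> / (1 + norm (dS t (fst w) x))) \<partial>snd w) \<in> borel_measurable (\<Omega> t \<Otimes>\<^sub>M ?A)"
    by (intro nn_integral_measurable_subprob_algebra2[where N="N (Suc t)"] measurable_prob_algebraD measurable_snd)
      (simp add: case_prod_beta')
  then have C: "{w \<in> space (\<Omega> t \<Otimes>\<^sub>M ?A). y < (\<integral>\<^sup>+x. ennreal (\<bar>h \<bullet> dS t (fst w) x\<bar> / (1 + norm (dS t (fst w) x))) \<partial>snd w)} \<in> sets (\<Omega> t \<Otimes>\<^sub>M ?A)"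
    (is "?C \<in> _") by measurable
  have "{\<omega> \<in> space (umeas (\<Omega> t)). y < seminorm_enn t \<omega> h} = {\<omega> \<in> space (\<Omega> t). \<exists>R\<in>Qr (Suc t) \<omega>. (\<omega>, R) \<in> ?C}"
    using Qr_probs[OF t] by (auto simp: seminorm_enn_def less_SUP_iff space_pair_measure space_prob_algebra_probs)
  then show "{\<omega> \<in> space (umeas (\<Omega> t)). y < seminorm_enn t \<omega> h} \<in> sets (umeas (\<Omega> t))"
    using projection_umeas[OF t C] by simp
qed

definition loc_seminorm where "loc_seminorm t \<omega> h = enn2real (seminorm_enn t \<omega> h)"

lemma loc_seminorm_meas: "t < T \<Longrightarrow> (\<lambda>\<omega>. loc_seminorm t \<omega> h) \<in> borel_measurable (umeas (\<Omega> t))"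
  unfolding loc_seminorm_def using seminorm_enn_meas by measurable

lemma seminorm_enn_fs: "t < T \<Longrightarrow> \<omega> \<in> space (\<Omega> t) \<Longrightarrow> seminorm_enn t \<omega> h = ennreal (loc_seminorm t \<omega> h)"
  using seminorm_enn_le_norm[of t \<omega> h] unfolding loc_seminorm_def by (metis ennreal_enn2real ennreal_less_top le_less_trans)

lemma loc_seminorm_nonneg: "0 \<le> loc_seminorm t \<omega> h"
  by (simp add: loc_seminorm_def)

lemma loc_seminorm_le_norm: "t < T \<Longrightarrow> \<omega> \<in> space (\<Omega> t) \<Longrightarrow> loc_seminorm t \<omega> h \<le> norm h"
  using seminorm_enn_le_norm[of t \<omega> h] by (simp add: seminorm_enn_fs ennreal_le_iff)

lemma loc_seminorm_add: "t < T \<Longrightarrow> \<omega> \<in> space (\<Omega> t) \<Longrightarrow> loc_seminorm t \<omega> (a + b) \<le> loc_seminorm t \<omega> a + loc_seminorm t \<omega> b"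
  using seminorm_enn_add[of t \<omega> a b] by (simp add: seminorm_enn_fs loc_seminorm_nonneg ennreal_plus[symmetric] ennreal_le_iff del: ennreal_plus)

lemma loc_seminorm_scale: "t < T \<Longrightarrow> \<omega> \<in> space (\<Omega> t) \<Longrightarrow> loc_seminorm t \<omega> (c *\<^sub>R h) = \<bar>c\<bar> * loc_seminorm t \<omega> h"
  by (simp add: loc_seminorm_def seminorm_enn_scale enn2real_mult)

lemma loc_seminorm_lip: "t < T \<Longrightarrow> \<omega> \<in> space (\<Omega> t) \<Longrightarrow> loc_seminorm t \<omega> a \<le> loc_seminorm t \<omega> b + norm (a - b)"
  using loc_seminorm_add[of t \<omega> b "a - b"] loc_seminorm_le_norm[of t \<omega> "a - b"] by simp

text \<open>Seminorm zero means neither gain nor loss under any local prior, whereas the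
  no-arbitrage witness in direction \<open>h\<close> loses with positive probability.\<close>

lemma loc_seminorm_pos:
  assumes t: "t < T" and w: "\<omega> \<in> NA t" and h: "h \<in> Dset Qr S t \<omega>" "h \<noteq> 0"
  shows "0 < loc_seminorm t \<omega> h"
proof (rule ccontr)
  assume "\<not> 0 < loc_seminorm t \<omega> h"
  then have "loc_seminorm t \<omega> h = 0" using loc_seminorm_nonneg[of t \<omega> h] by simp
  have w': "\<omega> \<in> space (\<Omega> t)" using w NA_sub[OF t] by blast
  obtain R where R: "R \<in> Qr (Suc t) \<omega>" "measure R {x \<in> space R. (h /\<^sub>R norm h) \<bullet> dS t \<omega> x < - \<alpha> t \<omega>} > \<alpha> t \<omega>"
    by (rule NA_D[OF t w h])
  note [measurable] = dS_R_meas[OF t w' Qr_probs[OF t w' R(1)]]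
  have "(\<integral>\<^sup>+x. ennreal (\<bar>h \<bullet> dS t \<omega> x\<bar> / (1 + norm (dS t \<omega> x))) \<partial>R) \<le> seminorm_enn t \<omega> h"
    unfolding seminorm_enn_def by (rule SUP_upper[OF R(1)])
  also have "seminorm_enn t \<omega> h = 0" using \<open>loc_seminorm t \<omega> h = 0\<close> by (simp add: seminorm_enn_fs[OF t w'])
  finally have "(\<integral>\<^sup>+x. ennreal (\<bar>h \<bullet> dS t \<omega> x\<bar> / (1 + norm (dS t \<omega> x))) \<partial>R) = 0" by simp
  then have "AE x in R. ennreal (\<bar>h \<bullet> dS t \<omega> x\<bar> / (1 + norm (dS t \<omega> x))) = 0"
    by (subst (asm) nn_integral_0_iff_AE) measurable
  then have "AE x in R. \<not> (h /\<^sub>R norm h) \<bullet> dS t \<omega> x < - \<alpha> t \<omega>"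
  proof (rule eventually_mono)
    fix x assume "ennreal (\<bar>h \<bullet> dS t \<omega> x\<bar> / (1 + norm (dS t \<omega> x))) = 0"
    then have "\<bar>h \<bullet> dS t \<omega> x\<bar> / (1 + norm (dS t \<omega> x)) \<le> 0" by (simp only: ennreal_eq_0_iff)
    then have "h \<bullet> dS t \<omega> x = 0" by (simp only: divide_le_0_iff) (use norm_ge_zero[of "dS t \<omega> x"] in linarith)
    then show "\<not> (h /\<^sub>R norm h) \<bullet> dS t \<omega> x < - \<alpha> t \<omega>"
      using alpha_pos[OF t w'] by (simp only: inner_scaleR_left)
  qed
  from measure_eq_0_AE[OF this] R(2) alpha_pos[OF t w'] show False by linarith
qed

text \<open>On \<open>Dset\<close> the seminorm is a norm by \<open>loc_seminorm_pos\<close>; being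
  Lipschitz, it attains a positive minimum on the compact unit sphere of \<open>Dset\<close>, and
  homogeneity does the rest.\<close>

lemma loc_seminorm_coercive:
  assumes t: "t < T" and w: "\<omega> \<in> NA t"
  shows "\<exists>c>0. \<forall>h\<in>Dset Qr S t \<omega>. c * norm h \<le> loc_seminorm t \<omega> h"
proof -
  have w': "\<omega> \<in> space (\<Omega> t)" using w NA_sub[OF t] by blast
  let ?D = "Dset Qr S t \<omega>" and ?K = "sphere 0 1 \<inter> Dset Qr S t \<omega>"
  have sub: "subspace ?D" using witness t w by (auto simp: NA_witness_def)
  have "compact ?K" by (intro compact_Int_closed closed_subspace sub) auto
  have cont: "continuous_on ?K (loc_seminorm t \<omega>)"
  proof (rule continuous_onI)
    fix x e assume "0 < (e :: real)"
    then show "\<exists>d>0. \<forall>x'\<in>?K. dist x' x < d \<longrightarrow> dist (loc_seminorm t \<omega> x') (loc_seminorm t \<omega> x) \<le> e"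
    proof (intro exI[of _ e] conjI ballI impI)
      fix x' assume "dist x' x < e"
      then show "dist (loc_seminorm t \<omega> x') (loc_seminorm t \<omega> x) \<le> e"
        using loc_seminorm_lip[OF t w', of x' x] loc_seminorm_lip[OF t w', of x x']
        by (simp add: dist_norm norm_minus_commute abs_le_iff)
    qed
  qed
  obtain c where c: "0 < c" "\<And>h. h \<in> ?K \<Longrightarrow> c \<le> loc_seminorm t \<omega> h"
  proof (cases "?K = {}")
    case False
    then obtain h0 where h0: "h0 \<in> ?K" "\<forall>h\<in>?K. loc_seminorm t \<omega> h0 \<le> loc_seminorm t \<omega> h"
      using continuous_attains_inf[OF \<open>compact ?K\<close> _ cont] by blast
    then have "0 < loc_seminorm t \<omega> h0" by (intro loc_seminorm_pos[OF t w]) auto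
    with h0 show ?thesis by (intro that[of "loc_seminorm t \<omega> h0"]) auto
  qed (use that[of 1] in auto)
  have "c * norm h \<le> loc_seminorm t \<omega> h" if h: "h \<in> ?D" for h
  proof (cases "h = 0")
    case False
    have "(1 / norm h) *\<^sub>R h \<in> ?K" using False h sub by (auto simp: subspace_scale)
    from c(2)[OF this] have "c \<le> (1 / norm h) * loc_seminorm t \<omega> h" by (simp add: loc_seminorm_scale[OF t w'])
    then show ?thesis using False by (simp add: field_simps)
  qed (use loc_seminorm_nonneg in auto)
  with c(1) show ?thesis by blast
qed

lemma loc_seminorm_cong_proj:
  assumes t: "t < T" and w: "\<omega> \<in> NA t" and h: "\<And>v. v \<in> Dset Qr S t \<omega> \<Longrightarrow> a \<bullet> v = b \<bullet> v"
  shows "loc_seminorm t \<omega> a = loc_seminorm t \<omega> b"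
proof -
  have w': "\<omega> \<in> space (\<Omega> t)" using w NA_sub[OF t] by blast
  have "seminorm_enn t \<omega> a = seminorm_enn t \<omega> b"
    by (rule seminorm_enn_cong, rule eventually_mono[OF AE_in_Dset[OF t w']]) (auto dest: h)
  then show ?thesis by (simp add: loc_seminorm_def)
qed

text \<open>Coercivity sends the projections of the positions onto \<open>Dset\<close> to 0 in norm,
  and gains see these projections only. The positions themselves may diverge.\<close>

lemma loc_seminorm_tendsto_0:
  assumes t: "t < T" and w: "\<omega> \<in> NA t" and lim: "(\<lambda>k. loc_seminorm t \<omega> (h k)) \<longlonglongrightarrow> 0" and R: "R \<in> Qr (Suc t) \<omega>"
  shows "AE x in R. (\<lambda>k. h k \<bullet> dS t \<omega> x) \<longlonglongrightarrow> 0"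
proof -
  have w': "\<omega> \<in> space (\<Omega> t)" using w NA_sub[OF t] by blast
  have "\<forall>k. \<exists>p. p \<in> Dset Qr S t \<omega> \<and> (\<forall>v\<in>Dset Qr S t \<omega>. h k \<bullet> v = p \<bullet> v)"
    using Dset_projection[OF t w] by metis
  then obtain p where p: "\<And>k. p k \<in> Dset Qr S t \<omega>" "\<And>k v. v \<in> Dset Qr S t \<omega> \<Longrightarrow> h k \<bullet> v = p k \<bullet> v" by metis
  obtain c where c: "0 < c" "\<forall>h\<in>Dset Qr S t \<omega>. c * norm h \<le> loc_seminorm t \<omega> h" using loc_seminorm_coercive[OF t w] by blast
  have "norm (p k) \<le> loc_seminorm t \<omega> (h k) / c" for k
    using c p(1)[of k] loc_seminorm_cong_proj[OF t w p(2)[of _ k]] by (simp add: pos_le_divide_eq mult.commute)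
  note pb = this
  have np: "(\<lambda>k. norm (p k)) \<longlonglongrightarrow> 0"
  proof (rule tendsto_sandwich[OF _ _ tendsto_const])
    show "(\<lambda>k. loc_seminorm t \<omega> (h k) / c) \<longlonglongrightarrow> 0"
      using tendsto_divide[OF lim tendsto_const[of c]] c(1) by simp
  qed (simp_all add: pb)
  from AE_in_Dset[OF t w' R] show ?thesis
  proof (rule eventually_mono)
    fix x assume D: "dS t \<omega> x \<in> Dset Qr S t \<omega>"
    have "(\<lambda>k. p k \<bullet> dS t \<omega> x) \<longlonglongrightarrow> 0 \<bullet> dS t \<omega> x"
      by (intro tendsto_inner tendsto_const) (use np in \<open>simp add: tendsto_norm_zero_iff\<close>)
    then show "(\<lambda>k. h k \<bullet> dS t \<omega> x) \<longlonglongrightarrow> 0" by (simp only: p(2)[OF D] inner_zero_left)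
  qed
qed

text \<open>Nonnegative wealth bounds the projections of the positions onto \<open>Dset\<close>. A
  limit point of the projections is a cluster point of the positions themselves, since the seminorm
  does not distinguish a position from its projection.\<close>

lemma cluster_exists:
  fixes V :: "nat \<Rightarrow> real" and g :: "nat \<Rightarrow> 'b"
  assumes t: "t < T" and w: "\<omega> \<in> NA t" and V: "\<And>n. 0 \<le> V n" "\<And>n. V n \<le> c"
    and nn: "\<And>n. \<forall>R\<in>Qr (Suc t) \<omega>. AE x in R. 0 \<le> V n + g n \<bullet> dS t \<omega> x"
  shows "\<exists>z. \<forall>e>0. \<forall>N. \<exists>n\<ge>N. loc_seminorm t \<omega> (g n - z) < e"
proof -
  have w': "\<omega> \<in> space (\<Omega> t)" using w NA_sub[OF t] by blast
  have "\<forall>k. \<exists>p. p \<in> Dset Qr S t \<omega> \<and> (\<forall>v\<in>Dset Qr S t \<omega>. g k \<bullet> v = p \<bullet> v)"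
    using Dset_projection[OF t w] by metis
  then obtain p where p: "\<And>k. p k \<in> Dset Qr S t \<omega>" "\<And>k v. v \<in> Dset Qr S t \<omega> \<Longrightarrow> g k \<bullet> v = p k \<bullet> v" by metis
  have "p n \<in> cball 0 (c / \<alpha> t \<omega>)" for n
  proof -
    have "norm (p n) \<le> V n / \<alpha> t \<omega>" by (rule projection_bound[OF t w V(1) nn p(1) p(2)])
    also have "\<dots> \<le> c / \<alpha> t \<omega>" using V(2) alpha_pos[OF t w'] by (intro divide_right_mono) auto
    finally show ?thesis by simp
  qed
  then obtain z s where s: "strict_mono (s :: nat \<Rightarrow> nat)" "(p \<circ> s) \<longlonglongrightarrow> z"
    using compact_cball[of "0 :: 'b" "c / \<alpha> t \<omega>"] unfolding compact_def by (metis (no_types, lifting))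
  show ?thesis
  proof (intro exI[of _ z] allI impI)
    fix e :: real and N assume "0 < e"
    then obtain k0 where k0: "\<And>k. k \<ge> k0 \<Longrightarrow> norm (p (s k) - z) < e"
      using s(2) by (auto simp: LIMSEQ_def dist_norm)
    define k where "k = max k0 N"
    have "loc_seminorm t \<omega> (g (s k) - z) = loc_seminorm t \<omega> (p (s k) - z)"
      by (rule loc_seminorm_cong_proj[OF t w]) (simp add: inner_diff_left p(2))
    also have "\<dots> \<le> norm (p (s k) - z)" by (rule loc_seminorm_le_norm[OF t w'])
    also have "\<dots> < e" by (rule k0) (simp add: k_def)
    finally show "\<exists>n\<ge>N. loc_seminorm t \<omega> (g n - z) < e"
      using seq_suble[OF s(1), of k] by (intro exI[of _ "s k"]) (simp add: k_def)
  qed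
qed

text \<open>The limit strategy is built forward in time, along a random subsequence refined at every date.\<close>

lemma limit_strategy:
  assumes \<phi>: "\<And>n. \<phi> n \<in> strategies Om T" and nn: "\<And>n. qs Om Qr T (\<lambda>z. 0 \<le> Vt S T y (\<phi> n) z)"
  shows "t \<le> T \<Longrightarrow> \<exists>\<psi> \<sigma>. (\<forall>s<t. \<psi> (Suc s) \<in> borel_measurable (umeas (\<Omega> s))) \<and>
    (\<forall>k. \<sigma> k \<in> umeas (\<Omega> t) \<rightarrow>\<^sub>M count_space UNIV) \<and>
    qs Om Qr t (\<lambda>z. (\<forall>k :: nat. k \<le> \<sigma> k z) \<and> (\<lambda>k. Vt S t 0 (\<phi> (\<sigma> k z)) z) \<longlonglongrightarrow> Vt S t 0 \<psi> z)"
proof (induction t)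
  case 0
  show ?case
    by (intro exI[of _ "\<lambda>_ _. 0"] exI[of _ "\<lambda>k _. k"]) (simp add: qs_iff Vt_0)
next
  case (Suc t)
  then have t: "t < T" by simp
  from Suc obtain \<psi> \<sigma> where \<psi>: "\<And>s. s < t \<Longrightarrow> \<psi> (Suc s) \<in> borel_measurable (umeas (\<Omega> s))"
    and \<sigma>m: "\<And>k. \<sigma> k \<in> umeas (\<Omega> t) \<rightarrow>\<^sub>M count_space UNIV"
    and IH: "qs Om Qr t (\<lambda>z. (\<forall>k :: nat. k \<le> \<sigma> k z) \<and> (\<lambda>k. Vt S t 0 (\<phi> (\<sigma> k z)) z) \<longlonglongrightarrow> Vt S t 0 \<psi> z)"
    by auto
  \<comment> \<open>The positions of the next period along the random subsequence constructed so
    far.\<close>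
  define \<Phi> where "\<Phi> k \<omega> = \<phi> (\<sigma> k \<omega>) (Suc t) \<omega>" for k \<omega>
  have \<Phi>m: "\<Phi> k \<in> borel_measurable (umeas (\<Omega> t))" for k
    unfolding \<Phi>_def by (rule measurable_compose_countable[OF strategiesD[OF \<phi> t] \<sigma>m])
  have fl: "loc_seminorm t \<omega> a \<le> loc_seminorm t \<omega> b + norm (a - b)" if "\<omega> \<in> space (umeas (\<Omega> t))" for \<omega> a b
    using that by (intro loc_seminorm_lip[OF t]) simp
  have mc: "\<exists>\<psi> \<tau>. \<psi> \<in> borel_measurable (umeas (\<Omega> t)) \<and> (\<forall>k. \<tau> k \<in> umeas (\<Omega> t) \<rightarrow>\<^sub>M count_space UNIV) \<and>
    (\<forall>\<omega>\<in>space (umeas (\<Omega> t)). (\<exists>z. \<forall>e>0. \<forall>N. \<exists>n\<ge>N. loc_seminorm t \<omega> (\<Phi> n \<omega> - z) < e) \<longrightarrow>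
       (\<forall>k. k \<le> \<tau> k \<omega> \<and> loc_seminorm t \<omega> (\<Phi> (\<tau> k \<omega>) \<omega> - \<psi> \<omega>) < 1 / Suc k))"
    by (rule measurable_cluster[OF loc_seminorm_meas[OF t] fl \<Phi>m]) assumption
  obtain \<psi>' \<tau> where \<psi>'m: "\<psi>' \<in> borel_measurable (umeas (\<Omega> t))"
    and \<tau>m: "\<forall>k. \<tau> k \<in> umeas (\<Omega> t) \<rightarrow>\<^sub>M count_space UNIV"
    and cl: "\<forall>\<omega>\<in>space (\<Omega> t). (\<exists>z. \<forall>e>0. \<forall>N. \<exists>n\<ge>N. loc_seminorm t \<omega> (\<Phi> n \<omega> - z) < e) \<longrightarrow>
       (\<forall>k. k \<le> \<tau> k \<omega> \<and> loc_seminorm t \<omega> (\<Phi> (\<tau> k \<omega>) \<omega> - \<psi>' \<omega>) < 1 / Suc k)"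
    using mc unfolding space_umeas by (elim exE conjE) (rule that)
  define \<psi>2 where "\<psi>2 = \<psi>(Suc t := \<psi>')"
  \<comment> \<open>The refined subsequence keeps the indices at which the new positions come close
    to \<open>\<psi>'\<close>. It depends on the path up to date \<open>t\<close> only, so
    \<open>\<sigma>2\<close> reads it off the restricted path and ignores the increment that
    follows.\<close>
  define \<sigma>1 where "\<sigma>1 k \<omega> = \<sigma> (\<tau> k \<omega>) \<omega>" for k \<omega>
  define \<sigma>2 where "\<sigma>2 k z = \<sigma>1 k (res t z)" for k z
  have \<sigma>1m: "\<sigma>1 k \<in> umeas (\<Omega> t) \<rightarrow>\<^sub>M count_space UNIV" for k
    unfolding \<sigma>1_def by (rule measurable_compose_countable[OF \<sigma>m \<tau>m[rule_format]])
  have \<sigma>2m: "\<sigma>2 k \<in> umeas (\<Omega> (Suc t)) \<rightarrow>\<^sub>M count_space UNIV" for k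
    unfolding \<sigma>2_def by (rule measurable_compose[OF res_umeas \<sigma>1m]) simp
  have \<psi>2: "\<psi>2 (Suc s) \<in> borel_measurable (umeas (\<Omega> s))" if "s < Suc t" for s
    using that \<psi> \<psi>'m by (cases "s = t") (auto simp: \<psi>2_def)
  have V\<psi>2: "Vt S t 0 \<psi>2 z = Vt S t 0 \<psi> z" for z
    unfolding Vt_def by (intro arg_cong2[where f="(+)"] refl sum.cong) (auto simp: \<psi>2_def)
  have good: "qs Om Qr t (\<lambda>\<omega>. \<forall>k. k \<le> \<sigma>1 k \<omega> \<and> loc_seminorm t \<omega> (\<Phi> (\<tau> k \<omega>) \<omega> - \<psi>' \<omega>) < 1 / Suc k \<and> k \<le> \<tau> k \<omega>)"
  proof (rule qs_mono)
    show "qs Om Qr t (\<lambda>\<omega>. (\<omega> \<in> NA t \<and> ((\<forall>k :: nat. k \<le> \<sigma> k \<omega>) \<and> (\<lambda>k. Vt S t 0 (\<phi> (\<sigma> k \<omega>)) \<omega>) \<longlonglongrightarrow> Vt S t 0 \<psi> \<omega>)) \<and>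
      ((\<forall>n. 0 \<le> Vt S t y (\<phi> n) \<omega>) \<and> (\<forall>n. Vt S t y (\<phi> n) \<omega> \<le> y * wealth_factor t \<omega>)) \<and>
      (\<forall>n. \<forall>R\<in>Qr (Suc t) \<omega>. AE x in R. 0 \<le> Vt S t y (\<phi> n) \<omega> + \<phi> n (Suc t) \<omega> \<bullet> dS t \<omega> x))"
      by (intro qs_conj qs_NA[OF t] IH qs_all_countable V_nonneg[OF \<phi> nn] wealth_bound[OF \<phi> nn] local_nonneg[OF \<phi> t])
        (use t in auto)
  next
    fix \<omega> assume w: "\<omega> \<in> space (\<Omega> t)"
      and *: "(\<omega> \<in> NA t \<and> ((\<forall>k :: nat. k \<le> \<sigma> k \<omega>) \<and> (\<lambda>k. Vt S t 0 (\<phi> (\<sigma> k \<omega>)) \<omega>) \<longlonglongrightarrow> Vt S t 0 \<psi> \<omega>)) \<and>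
      ((\<forall>n. 0 \<le> Vt S t y (\<phi> n) \<omega>) \<and> (\<forall>n. Vt S t y (\<phi> n) \<omega> \<le> y * wealth_factor t \<omega>)) \<and>
      (\<forall>n. \<forall>R\<in>Qr (Suc t) \<omega>. AE x in R. 0 \<le> Vt S t y (\<phi> n) \<omega> + \<phi> n (Suc t) \<omega> \<bullet> dS t \<omega> x)"
    have "\<exists>z. \<forall>e>0. \<forall>N. \<exists>n\<ge>N. loc_seminorm t \<omega> (\<Phi> n \<omega> - z) < e"
      by (rule cluster_exists[OF t, where V="\<lambda>n. Vt S t y (\<phi> (\<sigma> n \<omega>)) \<omega>" and c="y * wealth_factor t \<omega>"])
        (use * in \<open>simp_all only: \<Phi>_def, blast+\<close>)
    with cl w have "\<forall>k. k \<le> \<tau> k \<omega> \<and> loc_seminorm t \<omega> (\<Phi> (\<tau> k \<omega>) \<omega> - \<psi>' \<omega>) < 1 / Suc k" by blast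
    moreover from this * have "\<forall>k. k \<le> \<sigma>1 k \<omega>" unfolding \<sigma>1_def by (meson order.trans)
    ultimately show "\<forall>k. k \<le> \<sigma>1 k \<omega> \<and> loc_seminorm t \<omega> (\<Phi> (\<tau> k \<omega>) \<omega> - \<psi>' \<omega>) < 1 / Suc k \<and> k \<le> \<tau> k \<omega>" by blast
  qed
  have conv: "qs Om Qr (Suc t) (\<lambda>z. (\<lambda>k. Vt S (Suc t) 0 (\<phi> (\<sigma>2 k z)) z) \<longlonglongrightarrow> Vt S (Suc t) 0 \<psi>2 z)"
    unfolding qs_iff
  proof
    fix K assume "K \<in> Q (Suc t)"
    then obtain P q where K: "K = kcomp Om t P q" and PQ: "P \<in> Q t" and kc: "kernel_composition Om t P q"
      and qin: "AE \<omega> in P. q \<omega> \<in> Qr (Suc t) \<omega>" by (rule Qset_SucE)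
    show "AE z in K. (\<lambda>k. Vt S (Suc t) 0 (\<phi> (\<sigma>2 k z)) z) \<longlonglongrightarrow> Vt S (Suc t) 0 \<psi>2 z"
      unfolding K
    proof (rule kernel_composition.AE_kcompI[OF kc])
      have m1: "(\<lambda>z. Vt S (Suc t) 0 (\<phi> (\<sigma>2 k z)) z) \<in> borel_measurable (umeas (\<Omega> (Suc t)))" for k
        by (rule measurable_compose_countable[OF Vt_meas[OF \<phi>] \<sigma>2m]) (use t in simp)
      \<comment> \<open>\<open>\<psi>2\<close> is known to be measurable only for the first
        \<open>Suc t\<close> periods; setting later positions to zero makes it a strategy without
        changing wealth at date \<open>Suc t\<close>.\<close>
      define \<psi>3 where "\<psi>3 s = (if s \<le> Suc t then \<psi>2 s else (\<lambda>_. 0))" for s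
      have "\<psi>3 \<in> strategies Om T"
        by (rule strategiesI) (use \<psi>2 in \<open>auto simp: \<psi>3_def\<close>)
      then have "Vt S (Suc t) 0 \<psi>3 \<in> borel_measurable (umeas (\<Omega> (Suc t)))"
        by (rule Vt_meas) (use t in simp)
      also have "Vt S (Suc t) 0 \<psi>3 = Vt S (Suc t) 0 \<psi>2"
        unfolding Vt_def by (intro ext arg_cong2[where f="(+)"] refl sum.cong) (auto simp: \<psi>3_def)
      finally have m2: "Vt S (Suc t) 0 \<psi>2 \<in> borel_measurable (umeas (\<Omega> (Suc t)))" .
      show "Measurable.pred (umeas (\<Omega> (Suc t))) (\<lambda>z. (\<lambda>k. Vt S (Suc t) 0 (\<phi> (\<sigma>2 k z)) z) \<longlonglongrightarrow> Vt S (Suc t) 0 \<psi>2 z)"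
        by (rule measurable_limit2[OF m1 m2])
      have 1: "AE \<omega> in P. \<omega> \<in> NA t \<and> ((\<forall>k :: nat. k \<le> \<sigma> k \<omega>) \<and> (\<lambda>k. Vt S t 0 (\<phi> (\<sigma> k \<omega>)) \<omega>) \<longlonglongrightarrow> Vt S t 0 \<psi> \<omega>)"
        using qs_conj[OF qs_NA[OF t] IH] PQ by (simp add: qs_iff)
      have 2: "AE \<omega> in P. \<forall>k. k \<le> \<sigma>1 k \<omega> \<and> loc_seminorm t \<omega> (\<Phi> (\<tau> k \<omega>) \<omega> - \<psi>' \<omega>) < 1 / Suc k \<and> k \<le> \<tau> k \<omega>"
        using good PQ by (simp add: qs_iff)
      show "AE \<omega> in P. AE x in q \<omega>. (\<lambda>k. Vt S (Suc t) 0 (\<phi> (\<sigma>2 k (up t \<omega> x))) (up t \<omega> x)) \<longlonglongrightarrow> Vt S (Suc t) 0 \<psi>2 (up t \<omega> x)"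
      proof (rule AE_mp[OF AE_conjI[OF AE_conjI[OF 1 2] qin]], rule AE_I2, rule impI)
        fix \<omega> assume "\<omega> \<in> space P" and *: "((\<omega> \<in> NA t \<and> ((\<forall>k :: nat. k \<le> \<sigma> k \<omega>) \<and> (\<lambda>k. Vt S t 0 (\<phi> (\<sigma> k \<omega>)) \<omega>) \<longlonglongrightarrow> Vt S t 0 \<psi> \<omega>)) \<and>
          (\<forall>k. k \<le> \<sigma>1 k \<omega> \<and> loc_seminorm t \<omega> (\<Phi> (\<tau> k \<omega>) \<omega> - \<psi>' \<omega>) < 1 / Suc k \<and> k \<le> \<tau> k \<omega>)) \<and> q \<omega> \<in> Qr (Suc t) \<omega>"
        then have w: "\<omega> \<in> space (\<Omega> t)" by (simp add: probsD[OF Qset_probs[OF PQ]])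
        have NAw: "\<omega> \<in> NA t" and R: "q \<omega> \<in> Qr (Suc t) \<omega>" and lim: "(\<lambda>k. Vt S t 0 (\<phi> (\<sigma> k \<omega>)) \<omega>) \<longlonglongrightarrow> Vt S t 0 \<psi> \<omega>"
          and f1: "\<And>k. loc_seminorm t \<omega> (\<Phi> (\<tau> k \<omega>) \<omega> - \<psi>' \<omega>) < 1 / Suc k" and t1: "\<And>k. k \<le> \<tau> k \<omega>" using * by blast+
        have "(\<lambda>k. loc_seminorm t \<omega> (\<Phi> (\<tau> k \<omega>) \<omega> - \<psi>' \<omega>)) \<longlonglongrightarrow> 0"
          by (rule tendsto_sandwich[OF _ _ tendsto_const LIMSEQ_inverse_real_of_nat])
            (auto intro!: always_eventually simp: loc_seminorm_nonneg less_imp_le[OF f1] inverse_eq_divide simp del: of_nat_Suc)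
        note f0 = loc_seminorm_tendsto_0[OF t NAw this R]
        have "filterlim (\<lambda>k. \<tau> k \<omega>) at_top sequentially"
          by (rule filterlim_at_top_mono[OF filterlim_ident]) (simp add: t1)
        from filterlim_compose[OF lim this] have lim1: "(\<lambda>k. Vt S t 0 (\<phi> (\<sigma>1 k \<omega>)) \<omega>) \<longlonglongrightarrow> Vt S t 0 \<psi> \<omega>"
          by (simp only: \<sigma>1_def)
        show "AE x in q \<omega>. (\<lambda>k. Vt S (Suc t) 0 (\<phi> (\<sigma>2 k (up t \<omega> x))) (up t \<omega> x)) \<longlonglongrightarrow> Vt S (Suc t) 0 \<psi>2 (up t \<omega> x)"
        proof (rule AE_mp[OF f0], rule AE_I2, rule impI)
          fix x assume x: "x \<in> space (q \<omega>)" and l0: "(\<lambda>k. (\<Phi> (\<tau> k \<omega>) \<omega> - \<psi>' \<omega>) \<bullet> dS t \<omega> x) \<longlonglongrightarrow> 0"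
          note Vu = Vt_up[OF w Qr_probs[OF t w R] x]
          have s2: "\<sigma>2 k (up t \<omega> x) = \<sigma>1 k \<omega>" for k by (simp only: \<sigma>2_def res_upd[OF w])
          have "(\<lambda>k. Vt S t 0 (\<phi> (\<sigma>1 k \<omega>)) \<omega> + ((\<Phi> (\<tau> k \<omega>) \<omega> - \<psi>' \<omega>) \<bullet> dS t \<omega> x + \<psi>' \<omega> \<bullet> dS t \<omega> x))
              \<longlonglongrightarrow> Vt S t 0 \<psi> \<omega> + (0 + \<psi>' \<omega> \<bullet> dS t \<omega> x)"
            by (intro tendsto_add lim1 l0 tendsto_const)
          also have "(\<lambda>k. Vt S t 0 (\<phi> (\<sigma>1 k \<omega>)) \<omega> + ((\<Phi> (\<tau> k \<omega>) \<omega> - \<psi>' \<omega>) \<bullet> dS t \<omega> x + \<psi>' \<omega> \<bullet> dS t \<omega> x)) =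
              (\<lambda>k. Vt S (Suc t) 0 (\<phi> (\<sigma>2 k (up t \<omega> x))) (up t \<omega> x))"
            by (simp only: Vu s2 \<Phi>_def \<sigma>1_def inner_diff_left diff_add_cancel)
          also have "Vt S t 0 \<psi> \<omega> + (0 + \<psi>' \<omega> \<bullet> dS t \<omega> x) = Vt S (Suc t) 0 \<psi>2 (up t \<omega> x)"
            by (simp only: Vu V\<psi>2) (simp add: \<psi>2_def)
          finally show "(\<lambda>k. Vt S (Suc t) 0 (\<phi> (\<sigma>2 k (up t \<omega> x))) (up t \<omega> x)) \<longlonglongrightarrow> Vt S (Suc t) 0 \<psi>2 (up t \<omega> x)" .
        qed
      qed
    qed
  qed
  have "qs Om Qr (Suc t) (\<lambda>z. \<forall>k. k \<le> \<sigma>2 k z)"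
    unfolding \<sigma>2_def by (rule qs_lift[OF _ qs_mono[OF good]]) auto
  from qs_conj[OF this conv] \<psi>2 \<sigma>2m show ?case
    by (intro exI[of _ \<psi>2] exI[of _ \<sigma>2]) simp
qed

text \<open>Since \<open>\<sigma> k z \<ge> k\<close>, an inequality valid for all large
  \<open>n\<close> passes to the random subsequence, along which wealth converges. The capital
  \<open>y\<close> serves to keep all wealths nonnegative, hence bounded; \<open>c\<close> is the
  capital from which the limit strategy superreplicates.\<close>

theorem superreplication_closed:
  fixes G :: "(nat \<Rightarrow> 'a) \<Rightarrow> ereal"
  assumes \<phi>: "\<And>n. \<phi> n \<in> strategies Om T" and nn: "\<And>n. qs Om Qr T (\<lambda>z. 0 \<le> Vt S T y (\<phi> n) z)"
    and ev: "qs Om Qr T (\<lambda>z. \<forall>\<^sub>F n in sequentially. G z \<le> ereal (Vt S T c (\<phi> n) z))"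
  shows "Aset Om Qr S T G c \<noteq> {}"
proof -
  obtain \<psi> \<sigma> where \<psi>: "\<forall>s<T. \<psi> (Suc s) \<in> borel_measurable (umeas (\<Omega> s))"
    and lim: "qs Om Qr T (\<lambda>z. (\<forall>k :: nat. k \<le> \<sigma> k z) \<and> (\<lambda>k. Vt S T 0 (\<phi> (\<sigma> k z)) z) \<longlonglongrightarrow> Vt S T 0 \<psi> z)"
    using limit_strategy[of \<phi> y T, OF \<phi> nn order_refl] by (elim exE conjE) (rule that)
  have "\<psi> \<in> strategies Om T" by (rule strategiesI) (use \<psi> in simp)
  moreover have "qs Om Qr T (\<lambda>z. G z \<le> ereal (Vt S T c \<psi> z))"
    using qs_conj[OF lim ev]
  proof (rule qs_mono)
    fix z assume *: "((\<forall>k :: nat. k \<le> \<sigma> k z) \<and> (\<lambda>k. Vt S T 0 (\<phi> (\<sigma> k z)) z) \<longlonglongrightarrow> Vt S T 0 \<psi> z) \<and>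
      (\<forall>\<^sub>F n in sequentially. G z \<le> ereal (Vt S T c (\<phi> n) z))"
    have "filterlim (\<lambda>k. \<sigma> k z) at_top sequentially"
      by (rule filterlim_at_top_mono[OF filterlim_ident]) (use * in simp)
    with * have "\<forall>\<^sub>F k in sequentially. G z \<le> ereal (Vt S T c (\<phi> (\<sigma> k z)) z)"
      by (auto simp: filterlim_iff)
    moreover have "(\<lambda>k. ereal (Vt S T c (\<phi> (\<sigma> k z)) z)) \<longlonglongrightarrow> ereal (Vt S T c \<psi> z)"
      unfolding Vt_const[of T c] by (intro tendsto_ereal tendsto_add tendsto_const) (use * in blast)
    ultimately show "G z \<le> ereal (Vt S T c \<psi> z)"
      by (intro tendsto_lowerbound[OF _ _ sequentially_bot])
  qed
  ultimately show ?thesis unfolding Aset_def by blast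
qed

end

subsection \<open>Utility functions\<close>

lemma Uext_real: "0 < y \<Longrightarrow> Uext u \<omega> (ereal y) = ereal (u \<omega> y)"
  by (simp add: Uext_def)

lemma Uext_0:
  assumes mono: "strict_mono_on {0<..} (u \<omega>)"
  shows "Uext u \<omega> (ereal 0) = (INF z\<in>{0<..}. ereal (u \<omega> z))"
proof -
  have m: "u \<omega> x \<le> u \<omega> y" if "0 < x" "x \<le> y" for x y
    using that strict_mono_onD[OF mono, of x y] by (cases "x = y") auto
  have "((\<lambda>z. ereal (u \<omega> z)) \<longlongrightarrow> (INF z\<in>{0<..}. ereal (u \<omega> z))) (at_right 0)"
  proof (rule order_tendstoI)
    fix a assume a: "a < (INF z\<in>{0<..}. ereal (u \<omega> z))"
    have "a < ereal (u \<omega> z)" if "0 < z" for z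
      using a INF_lower[of z "{0<..}" "\<lambda>z. ereal (u \<omega> z)"] that by (simp add: order.strict_trans2)
    then show "\<forall>\<^sub>F z in at_right 0. a < ereal (u \<omega> z)"
      by (simp add: eventually_at_right_field) (metis zero_less_one)
  next
    fix a assume "(INF z\<in>{0<..}. ereal (u \<omega> z)) < a"
    then obtain z0 where z0: "0 < z0" "ereal (u \<omega> z0) < a" by (auto simp: INF_less_iff)
    have "ereal (u \<omega> z) < a" if "0 < z" "z < z0" for z
      using m[of z z0] that z0 by (meson ereal_less_eq(3) le_less_trans less_imp_le)
    then show "\<forall>\<^sub>F z in at_right 0. ereal (u \<omega> z) < a"
      using z0(1) by (auto simp: eventually_at_right_field)
  qed
  then show ?thesis
    by (simp add: Uext_def tendsto_Lim trivial_limit_at_right_real)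
qed

lemma Uext_mono:
  assumes mono: "strict_mono_on {0<..} (u \<omega>)" and le: "y \<le> y'" and fin: "y' \<noteq> \<infinity>"
  shows "Uext u \<omega> y \<le> Uext u \<omega> y'"
proof -
  have m: "u \<omega> x \<le> u \<omega> y" if "0 < x" "x \<le> y" for x y
    using that strict_mono_onD[OF mono, of x y] by (cases "x = y") auto
  show ?thesis
  proof (cases "y < 0")
    case True
    then have "Uext u \<omega> y = - \<infinity>" by (cases y) (auto simp: Uext_def)
    then show ?thesis by simp
  next
    case False
    then obtain r r' where r: "y = ereal r" "y' = ereal r'" "0 \<le> r" "r \<le> r'"
      using le fin by (cases y; cases y') auto
    show ?thesis
    proof (cases "r = 0")
      case True
      show ?thesis
      proof (cases "r' = 0")
        case False
        then have "0 < r'" using r by simp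
        then show ?thesis unfolding r True Uext_0[where u=u and \<omega>=\<omega>, OF mono] Uext_real[OF \<open>0 < r'\<close>] by (intro INF_lower) simp
      qed (simp add: r True)
    next
      case False
      with r show ?thesis by (simp add: Uext_real m)
    qed
  qed
qed

lemma C2_on_deriv:
  assumes "C2_on {0<..} f" "0 < x0"
  shows "(f has_real_derivative deriv f x0) (at x0)"
proof -
  from assms(1) obtain f' f'' where "\<forall>x\<in>{0<..}. (f has_real_derivative f' x) (at x) \<and> (f' has_real_derivative f'' x) (at x)"
    unfolding C2_on_def by (elim exE conjE) (rule that)
  with assms(2) have "(f has_real_derivative f' x0) (at x0)" by simp
  then show ?thesis by (simp add: DERIV_imp_deriv)
qed

text \<open>Concavity puts the graph below the tangent at \<open>x0\<close>, and monotonicity covers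
  arguments below \<open>x0\<close>. The bound uses the utility only through its value and
  derivative at \<open>x0\<close>, the quantities controlled by (A5).\<close>

lemma utility_upper_bound:
  assumes conc: "concave_on {0<..} (u \<omega>)" and mono: "strict_mono_on {0<..} (u \<omega>)" and C2: "C2_on {0<..} (u \<omega>)"
    and x0: "0 < x0" and y: "0 \<le> y" "y \<le> Y"
  shows "e2ennreal (Uext u \<omega> (ereal y)) \<le> ennreal (u \<omega> x0) + ennreal (\<bar>deriv (u \<omega>) x0\<bar> * Y)"
proof -
  have pos: "u \<omega> x \<le> u \<omega> x0 + \<bar>deriv (u \<omega>) x0\<bar> * x" if x: "0 < x" for x
  proof -
    have d: "((\<lambda>x. - u \<omega> x) has_real_derivative - deriv (u \<omega>) x0) (at x0 within {0<..})"
      by (rule DERIV_subset[OF DERIV_minus[OF C2_on_deriv[OF C2 x0]]]) simp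
    have "- u \<omega> x - (- u \<omega> x0) \<ge> (- deriv (u \<omega>) x0) * (x - x0)"
      by (rule convex_on_imp_above_tangent[OF conc[unfolded concave_on_def] _ _ _ d]) (use x x0 in \<open>auto simp: interior_open\<close>)
    then have t: "u \<omega> x \<le> u \<omega> x0 + deriv (u \<omega>) x0 * (x - x0)" by simp
    show ?thesis
    proof (cases "x \<le> x0")
      case True
      then have "u \<omega> x \<le> u \<omega> x0" using x strict_mono_onD[OF mono, of x x0] by (cases "x = x0") auto
      moreover have "0 \<le> \<bar>deriv (u \<omega>) x0\<bar> * x" using x by simp
      ultimately show ?thesis by linarith
    next
      case False
      have "deriv (u \<omega>) x0 * (x - x0) \<le> \<bar>deriv (u \<omega>) x0\<bar> * (x - x0)" using False by (intro mult_right_mono) auto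
      also have "\<dots> \<le> \<bar>deriv (u \<omega>) x0\<bar> * x" using x0 by (intro mult_left_mono) auto
      finally show ?thesis using t by linarith
    qed
  qed
  have "Uext u \<omega> (ereal y) \<le> ereal (u \<omega> x0 + \<bar>deriv (u \<omega>) x0\<bar> * Y)"
  proof (cases "y = 0")
    case True
    have "Uext u \<omega> (ereal y) \<le> ereal (u \<omega> x0)"
      unfolding True Uext_0[where u=u and \<omega>=\<omega>, OF mono] by (rule INF_lower) (use x0 in simp)
    also have "\<dots> \<le> ereal (u \<omega> x0 + \<bar>deriv (u \<omega>) x0\<bar> * Y)" using y by simp
    finally show ?thesis .
  next
    case False
    then have "0 < y" using y by simp
    have "u \<omega> y \<le> u \<omega> x0 + \<bar>deriv (u \<omega>) x0\<bar> * y" by (rule pos[OF \<open>0 < y\<close>])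
    also have "\<dots> \<le> u \<omega> x0 + \<bar>deriv (u \<omega>) x0\<bar> * Y" using y by (intro add_left_mono mult_left_mono) auto
    finally show ?thesis using \<open>0 < y\<close> by (simp add: Uext_real)
  qed
  then have "e2ennreal (Uext u \<omega> (ereal y)) \<le> e2ennreal (ereal (u \<omega> x0 + \<bar>deriv (u \<omega>) x0\<bar> * Y))" by (rule e2ennreal_mono)
  also have "\<dots> = ennreal (u \<omega> x0 + \<bar>deriv (u \<omega>) x0\<bar> * Y)" by simp
  also have "\<dots> \<le> ennreal (u \<omega> x0) + ennreal (\<bar>deriv (u \<omega>) x0\<bar> * Y)"
  proof (cases "0 \<le> u \<omega> x0")
    case True
    then show ?thesis using y by (subst ennreal_plus[symmetric]) auto
  next
    case False
    then have "ennreal (u \<omega> x0 + \<bar>deriv (u \<omega>) x0\<bar> * Y) \<le> ennreal (\<bar>deriv (u \<omega>) x0\<bar> * Y)" by (intro ennreal_leI) simp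
    then show ?thesis using False by (simp add: ennreal_neg)
  qed
  finally show ?thesis .
qed

lemma deriv_measurable:
  assumes m: "\<And>x. 0 < x \<Longrightarrow> (\<lambda>\<omega>. u \<omega> x) \<in> borel_measurable M"
    and C2: "\<And>\<omega>. \<omega> \<in> space M \<Longrightarrow> C2_on {0<..} (u \<omega>)" and x0: "0 < (x0 :: real)"
  shows "(\<lambda>\<omega>. deriv (u \<omega>) x0) \<in> borel_measurable M"
proof (rule borel_measurable_LIMSEQ_real)
  show "(\<lambda>\<omega>. (u \<omega> (x0 + 1 / Suc n) - u \<omega> x0) / (1 / Suc n)) \<in> borel_measurable M" for n
    using x0 by (intro borel_measurable_divide borel_measurable_diff m borel_measurable_const) (auto intro: add_pos_pos)
  fix \<omega> assume "\<omega> \<in> space M"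
  have "(\<lambda>h. (u \<omega> (x0 + h) - u \<omega> x0) / h) \<midarrow>0\<rightarrow> deriv (u \<omega>) x0"
    by (rule DERIV_D[OF C2_on_deriv[OF C2[OF \<open>\<omega> \<in> space M\<close>] x0]])
  moreover have "filterlim (\<lambda>n. 1 / real (Suc n)) (at 0) sequentially"
    by (rule filterlim_atI) (use LIMSEQ_inverse_real_of_nat in \<open>auto simp: inverse_eq_divide\<close>)
  ultimately show "(\<lambda>n. (u \<omega> (x0 + 1 / Suc n) - u \<omega> x0) / (1 / Suc n)) \<longlonglongrightarrow> deriv (u \<omega>) x0"
    by (rule filterlim_compose)
qed

text \<open>Young's inequality without optimal constants: according to whether
  \<open>b \<le> a powr (q - 1)\<close>, one of the two terms alone dominates the product.\<close>

lemma young_powr: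
  fixes a b q :: real
  assumes a: "0 \<le> a" and b: "0 \<le> b" and q: "1 < q"
  shows "a * b \<le> a powr q + b powr (q / (q - 1))"
proof (cases "a = 0 \<or> b = 0")
  case False
  then have ab: "0 < a" "0 < b" using a b by auto
  show ?thesis
  proof (cases "b \<le> a powr (q - 1)")
    case True
    then have "a * b \<le> a powr 1 * a powr (q - 1)" using ab by (simp add: mult_left_mono)
    also have "\<dots> = a powr q" by (subst powr_add[symmetric]) simp
    finally show ?thesis by (simp add: add_increasing2)
  next
    case False
    then have "(a powr (q - 1)) powr (1 / (q - 1)) \<le> b powr (1 / (q - 1))" using q by (intro powr_mono2) auto
    then have "a \<le> b powr (1 / (q - 1))" using ab q by (simp add: powr_powr)
    then have "a * b \<le> b powr (1 / (q - 1)) * b powr 1" using ab by (simp add: mult_right_mono)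
    also have "\<dots> = b powr (1 / (q - 1) + 1)" by (rule powr_add[symmetric])
    also have "1 / (q - 1) + 1 = q / (q - 1)" using q by (simp add: field_simps)
    finally show ?thesis by (simp add: add_increasing)
  qed
qed auto

lemma Eext_mono:
  assumes P: "AE x in P. f x \<le> g x"
  shows "Eext P f \<le> Eext P g"
  unfolding Eext_def nn_integral_completion
proof (rule ereal_minus_mono)
  show "enn2ereal (\<integral>\<^sup>+x. e2ennreal (f x) \<partial>P) \<le> enn2ereal (\<integral>\<^sup>+x. e2ennreal (g x) \<partial>P)"
    unfolding less_eq_ennreal.rep_eq[symmetric]
    by (rule nn_integral_mono_AE, rule eventually_mono[OF P], rule e2ennreal_mono)
  show "enn2ereal (\<integral>\<^sup>+x. e2ennreal (- g x) \<partial>P) \<le> enn2ereal (\<integral>\<^sup>+x. e2ennreal (- f x) \<partial>P)"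
    unfolding less_eq_ennreal.rep_eq[symmetric]
    by (rule nn_integral_mono_AE, rule eventually_mono[OF P], rule e2ennreal_mono) simp
qed

lemma Eext_le: "Eext P f \<le> enn2ereal (\<integral>\<^sup>+x. e2ennreal (f x) \<partial>P)"
  unfolding Eext_def nn_integral_completion by (rule ereal_diff_le_self) simp

subsection \<open>Moments of the wealth bound\<close>

context arbitrage_free_market
begin

text \<open>The integrands are measurable for the completion only; additivity is applied there,
  where the integral has the same value.\<close>

lemma nn_integral_add_umeas:
  fixes f g :: "(nat \<Rightarrow> 'a) \<Rightarrow> ennreal"
  assumes P: "P \<in> Q t" and "f \<in> borel_measurable (umeas (\<Omega> t))" "g \<in> borel_measurable (umeas (\<Omega> t))"
  shows "(\<integral>\<^sup>+z. f z + g z \<partial>P) = (\<integral>\<^sup>+z. f z \<partial>P) + (\<integral>\<^sup>+z. g z \<partial>P)"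
  unfolding nn_integral_completion[of P, symmetric]
  using measurable_umeas_completion[OF assms(2) Qset_probs[OF P]] measurable_umeas_completion[OF assms(3) Qset_probs[OF P]]
  by (rule nn_integral_add)

lemma nn_integral_cmult_umeas:
  fixes f :: "(nat \<Rightarrow> 'a) \<Rightarrow> ennreal"
  assumes P: "P \<in> Q t" and "f \<in> borel_measurable (umeas (\<Omega> t))"
  shows "(\<integral>\<^sup>+z. c * f z \<partial>P) = c * (\<integral>\<^sup>+z. f z \<partial>P)"
  unfolding nn_integral_completion[of P, symmetric]
  using measurable_umeas_completion[OF assms(2) Qset_probs[OF P]]
  by (rule nn_integral_cmult)

text \<open>The substitution rule asks for a Borel integrand, so \<open>f\<close> is exchanged for a
  Borel version under the image law and exchanged back afterwards.\<close>

lemma nn_integral_marginal: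
  fixes f :: "(nat \<Rightarrow> 'a) \<Rightarrow> ennreal"
  assumes P: "P \<in> Q t'" and t: "t \<le> t'" and f: "f \<in> borel_measurable (umeas (\<Omega> t))"
  shows "(\<integral>\<^sup>+z. f (res t z) \<partial>P) = (\<integral>\<^sup>+\<omega>. f \<omega> \<partial>distr P (\<Omega> t) (res t))"
proof -
  let ?M = "distr P (\<Omega> t) (res t)"
  have M: "?M \<in> probs (\<Omega> t)" by (rule Qset_probs[OF Qset_marginal[OF t P]])
  have rm: "res t \<in> P \<rightarrow>\<^sub>M \<Omega> t"
    using measurable_res[OF t, of Om] by (simp only: measurable_cong_sets[OF probsD(2)[OF Qset_probs[OF P]] refl])
  obtain f' where f': "f' \<in> borel_measurable ?M" "AE \<omega> in ?M. f \<omega> = f' \<omega>"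
    using completion_ex_borel_measurable[OF measurable_umeas_completion[OF f M]] by blast
  have "(\<integral>\<^sup>+\<omega>. f \<omega> \<partial>?M) = (\<integral>\<^sup>+\<omega>. f' \<omega> \<partial>?M)" by (rule nn_integral_cong_AE[OF f'(2)])
  also have "\<dots> = (\<integral>\<^sup>+z. f' (res t z) \<partial>P)" by (rule nn_integral_distr[OF rm f'(1)])
  also have "\<dots> = (\<integral>\<^sup>+z. f (res t z) \<partial>P)"
    by (rule nn_integral_cong_AE, rule eventually_mono[OF AE_distrD[OF rm f'(2)]]) simp
  finally show ?thesis ..
qed

text \<open>Every exponent is demanded at once: this makes the class closed under products, as the
  product \<open>wealth_factor\<close> requires.\<close>

definition bounded_moments :: "((nat \<Rightarrow> 'a) \<Rightarrow> real) \<Rightarrow> bool" where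
  "bounded_moments X \<longleftrightarrow> X \<in> borel_measurable (umeas (\<Omega> T)) \<and> (\<forall>z\<in>space (\<Omega> T). 0 \<le> X z) \<and>
     (\<forall>r>0. \<exists>C<\<infinity>. \<forall>P\<in>Q T. (\<integral>\<^sup>+z. ennreal (X z powr r) \<partial>P) \<le> C)"

lemma bounded_momentsD:
  assumes "bounded_moments X"
  shows "X \<in> borel_measurable (umeas (\<Omega> T))" "\<And>z. z \<in> space (\<Omega> T) \<Longrightarrow> 0 \<le> X z"
    "\<And>r. 0 < r \<Longrightarrow> \<exists>C<\<infinity>. \<forall>P\<in>Q T. (\<integral>\<^sup>+z. ennreal (X z powr r) \<partial>P) \<le> C"
proof -
  note * = assms[unfolded bounded_moments_def]
  show "X \<in> borel_measurable (umeas (\<Omega> T))" by (rule conjunct1[OF *])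
  show "0 \<le> X z" if "z \<in> space (\<Omega> T)" for z
    using conjunct1[OF conjunct2[OF *]] that by (rule bspec)
  show "\<exists>C<\<infinity>. \<forall>P\<in>Q T. (\<integral>\<^sup>+z. ennreal (X z powr r) \<partial>P) \<le> C" if "0 < r" for r
    using conjunct2[OF conjunct2[OF *]] that by simp
qed

lemma bounded_moments_const: "0 \<le> c \<Longrightarrow> bounded_moments (\<lambda>_. c)"
  unfolding bounded_moments_def
proof (intro conjI ballI allI impI)
  fix r :: real assume "0 < r"
  have "(\<integral>\<^sup>+z. ennreal (c powr r) \<partial>P) \<le> ennreal (c powr r)" if "P \<in> Q T" for P
    using prob_space.emeasure_space_1[OF probsD(1)[OF Qset_probs[OF that]]] by simp
  then show "\<exists>C<\<infinity>. \<forall>P\<in>Q T. (\<integral>\<^sup>+z. ennreal (c powr r) \<partial>P) \<le> C"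
    by (intro exI[of _ "ennreal (c powr r)"]) simp
qed auto

text \<open>The exponent \<open>s\<close> may depend on \<open>r\<close>. For products it is
  \<open>2 * r\<close>, by bounding a product by a sum of squares; for sums it is \<open>r\<close>
  itself.\<close>

lemma bounded_moments_dominated:
  assumes X: "bounded_moments X" and Y: "bounded_moments Y"
    and m: "Z \<in> borel_measurable (umeas (\<Omega> T))" and nn: "\<And>z. z \<in> space (\<Omega> T) \<Longrightarrow> 0 \<le> Z z"
    and c: "\<And>r. 0 < r \<Longrightarrow> \<exists>c s. 0 < s \<and> 0 \<le> c \<and> (\<forall>z\<in>space (\<Omega> T). Z z powr r \<le> c * (X z powr s + Y z powr s))"
  shows "bounded_moments Z"
  unfolding bounded_moments_def
proof (intro conjI ballI allI impI m nn)
  fix r :: real assume "0 < r"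
  from c[OF this] obtain c s where s: "0 < s" "0 \<le> c" "\<And>z. z \<in> space (\<Omega> T) \<Longrightarrow> Z z powr r \<le> c * (X z powr s + Y z powr s)"
    by blast
  obtain C1 where C1: "C1 < \<infinity>" "\<And>P. P \<in> Q T \<Longrightarrow> (\<integral>\<^sup>+z. ennreal (X z powr s) \<partial>P) \<le> C1" using bounded_momentsD(3)[OF X s(1)] by blast
  obtain C2 where C2: "C2 < \<infinity>" "\<And>P. P \<in> Q T \<Longrightarrow> (\<integral>\<^sup>+z. ennreal (Y z powr s) \<partial>P) \<le> C2" using bounded_momentsD(3)[OF Y s(1)] by blast
  have "(\<integral>\<^sup>+z. ennreal (Z z powr r) \<partial>P) \<le> ennreal c * (C1 + C2)" if P: "P \<in> Q T" for P
  proof -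
    note [measurable] = bounded_momentsD(1)[OF X] bounded_momentsD(1)[OF Y]
    have "(\<integral>\<^sup>+z. ennreal (Z z powr r) \<partial>P) \<le> (\<integral>\<^sup>+z. ennreal (c * X z powr s) + ennreal (c * Y z powr s) \<partial>P)"
    proof (rule nn_integral_mono)
      fix z assume "z \<in> space P"
      then have "z \<in> space (\<Omega> T)" by (simp add: probsD[OF Qset_probs[OF P]])
      then have "ennreal (Z z powr r) \<le> ennreal (c * X z powr s + c * Y z powr s)"
        using s(3) by (intro ennreal_leI) (simp add: distrib_left)
      also have "\<dots> = ennreal (c * X z powr s) + ennreal (c * Y z powr s)"
        by (rule ennreal_plus) (use s(2) in auto)
      finally show "ennreal (Z z powr r) \<le> ennreal (c * X z powr s) + ennreal (c * Y z powr s)" .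
    qed
    also have "\<dots> = (\<integral>\<^sup>+z. ennreal (c * X z powr s) \<partial>P) + (\<integral>\<^sup>+z. ennreal (c * Y z powr s) \<partial>P)"
      by (rule nn_integral_add_umeas[OF P]) measurable
    also have "(\<integral>\<^sup>+z. ennreal (c * X z powr s) \<partial>P) = ennreal c * (\<integral>\<^sup>+z. ennreal (X z powr s) \<partial>P)"
      unfolding ennreal_mult[OF s(2) powr_ge_zero] by (rule nn_integral_cmult_umeas[OF P]) measurable
    also have "(\<integral>\<^sup>+z. ennreal (c * Y z powr s) \<partial>P) = ennreal c * (\<integral>\<^sup>+z. ennreal (Y z powr s) \<partial>P)"
      unfolding ennreal_mult[OF s(2) powr_ge_zero] by (rule nn_integral_cmult_umeas[OF P]) measurable
    also have "ennreal c * (\<integral>\<^sup>+z. ennreal (X z powr s) \<partial>P) + ennreal c * (\<integral>\<^sup>+z. ennreal (Y z powr s) \<partial>P) \<le>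
        ennreal c * C1 + ennreal c * C2"
      by (intro add_mono mult_left_mono C1(2) C2(2) P) auto
    finally show ?thesis by (simp only: distrib_left)
  qed
  moreover have "ennreal c * (C1 + C2) < \<infinity>" using C1(1) C2(1) by (simp add: ennreal_mult_less_top)
  ultimately show "\<exists>C<\<infinity>. \<forall>P\<in>Q T. (\<integral>\<^sup>+z. ennreal (Z z powr r) \<partial>P) \<le> C" by blast
qed

lemma bounded_moments_mult:
  assumes X: "bounded_moments X" and Y: "bounded_moments Y"
  shows "bounded_moments (\<lambda>z. X z * Y z)"
proof (rule bounded_moments_dominated[OF X Y])
  show "(\<lambda>z. X z * Y z) \<in> borel_measurable (umeas (\<Omega> T))"
    using bounded_momentsD(1)[OF X] bounded_momentsD(1)[OF Y] by (rule borel_measurable_times)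
  show "0 \<le> X z * Y z" if "z \<in> space (\<Omega> T)" for z
    using bounded_momentsD(2)[OF X that] bounded_momentsD(2)[OF Y that] by simp
  fix r :: real assume r: "0 < r"
  have "(X z * Y z) powr r \<le> 1 * (X z powr (2 * r) + Y z powr (2 * r))" if z: "z \<in> space (\<Omega> T)" for z
  proof -
    have sq: "a powr (2 * r) = (a powr r)\<^sup>2" for a :: real
      by (simp add: power2_eq_square powr_add[symmetric])
    have "(X z * Y z) powr r = X z powr r * Y z powr r"
      using bounded_momentsD(2)[OF X z] bounded_momentsD(2)[OF Y z] by (simp add: powr_mult)
    also have "\<dots> \<le> (X z powr r)\<^sup>2 + (Y z powr r)\<^sup>2"
    proof -
      have "0 \<le> X z powr r * Y z powr r" by simp
      with sum_squares_bound[of "X z powr r" "Y z powr r"] show ?thesis by linarith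
    qed
    finally show ?thesis by (simp add: sq)
  qed
  with r show "\<exists>c s. 0 < s \<and> 0 \<le> c \<and> (\<forall>z\<in>space (\<Omega> T). (X z * Y z) powr r \<le> c * (X z powr s + Y z powr s))"
    by (intro exI[of _ 1] exI[of _ "2 * r"]) simp
qed

lemma bounded_moments_add:
  assumes X: "bounded_moments X" and Y: "bounded_moments Y"
  shows "bounded_moments (\<lambda>z. X z + Y z)"
proof (rule bounded_moments_dominated[OF X Y])
  show "(\<lambda>z. X z + Y z) \<in> borel_measurable (umeas (\<Omega> T))"
    using bounded_momentsD(1)[OF X] bounded_momentsD(1)[OF Y] by (rule borel_measurable_add)
  show "0 \<le> X z + Y z" if "z \<in> space (\<Omega> T)" for z
    using bounded_momentsD(2)[OF X that] bounded_momentsD(2)[OF Y that] by simp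
  fix r :: real assume r: "0 < r"
  have "(X z + Y z) powr r \<le> 2 powr r * (X z powr r + Y z powr r)" if z: "z \<in> space (\<Omega> T)" for z
  proof -
    note nn = bounded_momentsD(2)[OF X z] bounded_momentsD(2)[OF Y z]
    have "(X z + Y z) powr r \<le> (2 * max (X z) (Y z)) powr r" using r nn by (intro powr_mono2) auto
    also have "\<dots> = 2 powr r * max (X z) (Y z) powr r" using nn by (simp add: powr_mult)
    also have "\<dots> \<le> 2 powr r * (X z powr r + Y z powr r)" by (intro mult_left_mono) (auto simp: max_def)
    finally show ?thesis .
  qed
  with r show "\<exists>c s. 0 < s \<and> 0 \<le> c \<and> (\<forall>z\<in>space (\<Omega> T). (X z + Y z) powr r \<le> c * (X z powr s + Y z powr s))"
    by (intro exI[of _ "2 powr r"] exI[of _ r]) simp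
qed

lemma bounded_moments_lift:
  assumes t: "t \<le> T" and W: "\<And>r. 0 < r \<Longrightarrow> in_W Om Qr t r (\<lambda>\<omega>. ereal (X \<omega>))"
    and nn: "\<And>\<omega>. \<omega> \<in> space (\<Omega> t) \<Longrightarrow> 0 \<le> X \<omega>"
  shows "bounded_moments (\<lambda>z. X (res t z))"
  unfolding bounded_moments_def
proof (intro conjI ballI allI impI)
  have "(\<lambda>\<omega>. ereal (X \<omega>)) \<in> borel_measurable (umeas (\<Omega> t))"
    using W[of 1] by (simp add: in_W_def univ_meas_iff)
  then have "(\<lambda>\<omega>. real_of_ereal (ereal (X \<omega>))) \<in> borel_measurable (umeas (\<Omega> t))" by measurable
  then have Xm: "X \<in> borel_measurable (umeas (\<Omega> t))" by simp
  show "(\<lambda>z. X (res t z)) \<in> borel_measurable (umeas (\<Omega> T))"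
    by (rule measurable_compose[OF res_umeas[OF t] Xm])
  show "0 \<le> X (res t z)" if "z \<in> space (\<Omega> T)" for z
    by (rule nn[OF measurable_space[OF measurable_res[OF t] that]])
  fix r :: real assume r: "0 < r"
  let ?C = "SUP P\<in>Q t. \<integral>\<^sup>+\<omega>. abspow r (ereal (X \<omega>)) \<partial>completion P"
  have "?C < \<infinity>" using W[OF r] by (simp add: in_W_def)
  moreover have "(\<integral>\<^sup>+z. ennreal (X (res t z) powr r) \<partial>P) \<le> ?C" if P: "P \<in> Q T" for P
  proof -
    have "(\<integral>\<^sup>+z. ennreal (X (res t z) powr r) \<partial>P) = (\<integral>\<^sup>+\<omega>. ennreal (X \<omega> powr r) \<partial>distr P (\<Omega> t) (res t))"
      by (rule nn_integral_marginal[OF P t]) (use Xm in measurable)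
    also have "\<dots> = (\<integral>\<^sup>+\<omega>. abspow r (ereal (X \<omega>)) \<partial>distr P (\<Omega> t) (res t))"
      by (rule nn_integral_cong) (auto simp: abspow_def nn)
    also have "\<dots> \<le> ?C"
      unfolding nn_integral_completion by (rule SUP_upper[OF Qset_marginal[OF t P]])
    finally show ?thesis .
  qed
  ultimately show "\<exists>C<\<infinity>. \<forall>P\<in>Q T. (\<integral>\<^sup>+z. ennreal (X (res t z) powr r) \<partial>P) \<le> C" by blast
qed

lemma bounded_moments_wealth_factor:
  assumes dS_W: "\<And>r t. 0 < r \<Longrightarrow> t \<in> {1..T} \<Longrightarrow> in_W Om Qr t r (\<lambda>\<omega>. ereal (norm (S t \<omega> - S (t - 1) (restrict \<omega> {1..t - 1}))))"
    and \<alpha>_W: "\<And>r t. 0 < r \<Longrightarrow> t \<in> {1..T - 1} \<Longrightarrow> in_W Om Qr t r (\<lambda>\<omega>. ereal (1 / \<alpha> t \<omega>))"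
  shows "t \<le> T \<Longrightarrow> bounded_moments (wealth_factor t)"
proof (induction t)
  case 0
  show ?case using bounded_moments_const[of 1] by (simp add: wealth_factor_def[abs_def])
next
  case (Suc t)
  then have t: "t < T" by simp
  have 1: "bounded_moments (\<lambda>z. norm (S (Suc t) (res (Suc t) z) - S t (res t z)))"
  proof -
    have "bounded_moments (\<lambda>z. (\<lambda>\<omega>. norm (S (Suc t) \<omega> - S (Suc t - 1) (restrict \<omega> {1..Suc t - 1}))) (res (Suc t) z))"
      by (rule bounded_moments_lift[OF Suc.prems dS_W]) (use t in auto)
    also have "(\<lambda>z. (\<lambda>\<omega>. norm (S (Suc t) \<omega> - S (Suc t - 1) (restrict \<omega> {1..Suc t - 1}))) (res (Suc t) z)) =
        (\<lambda>z. norm (S (Suc t) (res (Suc t) z) - S t (res t z)))"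
      by (simp only: diff_Suc_1 res_res[of t "Suc t"] le_SucI order_refl)
    finally show ?thesis .
  qed
  have 2: "bounded_moments (\<lambda>z. 1 / \<alpha> t (res t z))"
  proof (cases "t = 0")
    \<comment> \<open>(A4) says nothing about \<open>\<alpha> 0\<close>, but there is only one
      history at date 0, so \<open>1 / \<alpha> 0\<close> is a constant.\<close>
    case True
    have "res 0 z = (\<lambda>_. undefined)" for z :: "nat \<Rightarrow> 'a" by (auto simp: restrict_def)
    moreover have "(\<lambda>_. undefined) \<in> space (\<Omega> 0)" by (simp add: Omt_def space_PiM)
    ultimately show ?thesis
      using bounded_moments_const[of "1 / \<alpha> 0 (\<lambda>_. undefined)"] alpha_pos[of 0] t True
      by (simp add: less_imp_le del: One_nat_def)
  next
    case False
    show ?thesis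
      by (rule bounded_moments_lift[where X="\<lambda>\<omega>. 1 / \<alpha> t \<omega>", OF _ \<alpha>_W])
        (use t False alpha_pos[OF t] in \<open>auto simp: less_imp_le\<close>)
  qed
  have "bounded_moments (\<lambda>z. wealth_factor t z * (1 + norm (S (Suc t) (res (Suc t) z) - S t (res t z)) * (1 / \<alpha> t (res t z))))"
    by (intro bounded_moments_mult bounded_moments_add bounded_moments_const 1 2 Suc.IH) (use t in auto)
  then show ?case by (simp add: wealth_factor_Suc[abs_def] del: One_nat_def)
qed

end

subsection \<open>Utility indifference prices\<close>

locale utility_sequence = arbitrage_free_market T Om Qr S NA \<alpha>
  for T :: nat
    and Om :: "nat \<Rightarrow> 'a::polish_space set"
    and Qr :: "nat \<Rightarrow> (nat \<Rightarrow> 'a) \<Rightarrow> 'a measure set"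
    and S :: "nat \<Rightarrow> (nat \<Rightarrow> 'a) \<Rightarrow> 'b::euclidean_space"
    and NA :: "nat \<Rightarrow> (nat \<Rightarrow> 'a) set" and \<alpha> :: "nat \<Rightarrow> (nat \<Rightarrow> 'a) \<Rightarrow> real" +
  fixes u :: "nat \<Rightarrow> (nat \<Rightarrow> 'a) \<Rightarrow> real \<Rightarrow> real" and x0 :: real
  assumes dS_W: "\<And>r t. 0 < r \<Longrightarrow> t \<in> {1..T} \<Longrightarrow> in_W Om Qr t r (\<lambda>\<omega>. ereal (norm (S t \<omega> - S (t - 1) (restrict \<omega> {1..t - 1}))))"
    and \<alpha>_W: "\<And>r t. 0 < r \<Longrightarrow> t \<in> {1..T - 1} \<Longrightarrow> in_W Om Qr t r (\<lambda>\<omega>. ereal (1 / \<alpha> t \<omega>))"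
    and util: "\<forall>n\<ge>1. random_utility (Omt Om T) (u n)"
    and x0_pos: "0 < x0"
    and A5_plus: "(SUP n\<in>{1..}. SUP P\<in>Qset Om Qr T.
         \<integral>\<^sup>+\<omega>. ennreal (u n \<omega> x0) \<partial>(completion P)) < \<infinity>"
    and A5_minus: "(SUP n\<in>{1..}. SUP P\<in>Qset Om Qr T.
         \<integral>\<^sup>+\<omega>. ennreal (- u n \<omega> x0) \<partial>(completion P)) < \<infinity>"
    and A5_deriv: "\<exists>q>1. (SUP n\<in>{1..}. SUP P\<in>Qset Om Qr T.
         \<integral>\<^sup>+\<omega>. ennreal (\<bar>deriv (u n \<omega>) x0\<bar> powr q) \<partial>(completion P)) < \<infinity>"
    and A6: "\<forall>x M. 0 \<le> x \<and> x < x0 \<and> 0 \<le> M \<longrightarrow>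
         (\<lambda>n. INF P\<in>Qset Om Qr T. measure (completion P)
             {\<omega> \<in> space (Omt Om T). Uext (u n) \<omega> (ereal x) \<le> - ereal M}) \<longlonglongrightarrow> 1"
    and Q_ne: "Qset Om Qr T \<noteq> {}"
begin

lemma u_meas: "1 \<le> n \<Longrightarrow> 0 < x \<Longrightarrow> (\<lambda>\<omega>. u n \<omega> x) \<in> borel_measurable (umeas (\<Omega> T))"
  using util by (simp add: random_utility_def univ_meas_iff)

lemma u_props:
  assumes "1 \<le> n" "\<omega> \<in> space (\<Omega> T)"
  shows "concave_on {0<..} (u n \<omega>)" "strict_mono_on {0<..} (u n \<omega>)" "C2_on {0<..} (u n \<omega>)"
  using util assms by (simp_all add: random_utility_def)

lemma deriv_meas:
  assumes "1 \<le> n"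
  shows "(\<lambda>\<omega>. deriv (u n \<omega>) x0) \<in> borel_measurable (umeas (\<Omega> T))"
  using u_meas[OF assms] u_props(3)[OF assms] x0_pos by (intro deriv_measurable) auto

lemma space_Q: "P \<in> Q T \<Longrightarrow> space P = space (\<Omega> T)"
  using probsD(3) Qset_probs by blast

text \<open>The tangent bound evaluated at the largest possible wealth
  \<open>y * wealth_factor T z\<close>: one majorant of the positive part of utility for all
  superreplicating strategies with capital \<open>y\<close>.\<close>

definition upper where
  "upper n y z = ennreal (u n z x0) + ennreal (\<bar>deriv (u n z) x0\<bar> * (y * wealth_factor T z))"

lemma SUP_SUP_le:
  assumes "1 \<le> n" "P \<in> Q T"
  shows "(\<integral>\<^sup>+\<omega>. f n \<omega> \<partial>P) \<le> (SUP n\<in>{1..}. SUP P\<in>Q T. \<integral>\<^sup>+\<omega>. (f n \<omega> :: ennreal) \<partial>completion P)"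
proof -
  have "(\<integral>\<^sup>+\<omega>. f n \<omega> \<partial>completion P) \<le> (SUP P\<in>Q T. \<integral>\<^sup>+\<omega>. f n \<omega> \<partial>completion P)"
    by (rule SUP_upper[OF assms(2)])
  also have "\<dots> \<le> (SUP n\<in>{1..}. SUP P\<in>Q T. \<integral>\<^sup>+\<omega>. f n \<omega> \<partial>completion P)"
    by (rule SUP_upper) (use assms(1) in simp)
  finally show ?thesis by (simp only: nn_integral_completion)
qed

text \<open>Young's inequality splits derivative times wealth into the \<open>q\<close>-th power of
  the derivative, bounded by (A5), and the conjugate power of the wealth bound, which has all
  moments.\<close>

lemma upper_bound:
  assumes y: "0 \<le> y"
  shows "\<exists>B<\<infinity>. \<forall>n\<ge>1. \<forall>P\<in>Q T. (\<integral>\<^sup>+z. upper n y z \<partial>P) \<le> B"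
proof -
  from A5_deriv obtain q where q: "1 < q" and
    C3: "(SUP n\<in>{1..}. SUP P\<in>Q T. \<integral>\<^sup>+\<omega>. ennreal (\<bar>deriv (u n \<omega>) x0\<bar> powr q) \<partial>(completion P)) < \<infinity>" (is "?C3 < _")
    by blast
  let ?C1 = "SUP n\<in>{1..}. SUP P\<in>Q T. \<integral>\<^sup>+\<omega>. ennreal (u n \<omega> x0) \<partial>(completion P)"
  define p where "p = q / (q - 1)"
  have p: "0 < p" using q by (simp add: p_def)
  have yK: "bounded_moments (\<lambda>z. y * wealth_factor T z)"
    using bounded_moments_mult[OF bounded_moments_const[OF y] bounded_moments_wealth_factor[OF dS_W \<alpha>_W order_refl]] by simp
  obtain C2 where C2: "C2 < \<infinity>" "\<And>P. P \<in> Q T \<Longrightarrow> (\<integral>\<^sup>+z. ennreal ((y * wealth_factor T z) powr p) \<partial>P) \<le> C2"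
    using bounded_momentsD(3)[OF yK p] by blast
  have "(\<integral>\<^sup>+z. upper n y z \<partial>P) \<le> ?C1 + (?C3 + C2)" if n: "1 \<le> n" and P: "P \<in> Q T" for n P
  proof -
    note [measurable] = u_meas[OF n x0_pos] deriv_meas[OF n] bounded_momentsD(1)[OF yK]
    have m1: "(\<lambda>z. ennreal (u n z x0)) \<in> borel_measurable (umeas (\<Omega> T))" by measurable
    have m2: "(\<lambda>z. ennreal (\<bar>deriv (u n z) x0\<bar> powr q)) \<in> borel_measurable (umeas (\<Omega> T))" by measurable
    have m3: "(\<lambda>z. ennreal ((y * wealth_factor T z) powr p)) \<in> borel_measurable (umeas (\<Omega> T))" by measurable
    have "(\<integral>\<^sup>+z. upper n y z \<partial>P) \<le>
        (\<integral>\<^sup>+z. ennreal (u n z x0) + (ennreal (\<bar>deriv (u n z) x0\<bar> powr q) + ennreal ((y * wealth_factor T z) powr p)) \<partial>P)"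
    proof (rule nn_integral_mono)
      fix z assume "z \<in> space P"
      then have "0 \<le> y * wealth_factor T z" using bounded_momentsD(2)[OF yK] by (simp add: space_Q[OF P])
      from ennreal_leI[OF young_powr[OF abs_ge_zero this q, of "deriv (u n z) x0"]]
      show "upper n y z \<le> ennreal (u n z x0) + (ennreal (\<bar>deriv (u n z) x0\<bar> powr q) + ennreal ((y * wealth_factor T z) powr p))"
        unfolding upper_def p_def by (intro add_left_mono) simp
    qed
    also have "\<dots> = (\<integral>\<^sup>+z. ennreal (u n z x0) \<partial>P) +
        ((\<integral>\<^sup>+z. ennreal (\<bar>deriv (u n z) x0\<bar> powr q) \<partial>P) + (\<integral>\<^sup>+z. ennreal ((y * wealth_factor T z) powr p) \<partial>P))"
      by (simp only: nn_integral_add_umeas[OF P m1 borel_measurable_add[OF m2 m3]] nn_integral_add_umeas[OF P m2 m3])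
    also have "\<dots> \<le> ?C1 + (?C3 + C2)"
      by (intro add_mono C2(2) P) (rule SUP_SUP_le[OF n P])+
    finally show ?thesis .
  qed
  moreover have "?C1 + (?C3 + C2) < \<infinity>" using A5_plus C3 C2(1) by simp
  ultimately show ?thesis by blast
qed

lemma AsetD:
  assumes "\<phi> \<in> Aset Om Qr S T G y"
  shows "\<phi> \<in> strategies Om T" "qs Om Qr T (\<lambda>\<omega>. G \<omega> \<le> ereal (Vt S T y \<phi> \<omega>))"
  using assms by (simp_all add: Aset_def)

lemma Aset_nonneg:
  assumes \<phi>: "\<phi> \<in> Aset Om Qr S T G y" and G: "\<forall>\<omega>\<in>space (\<Omega> T). 0 \<le> G \<omega>"
  shows "qs Om Qr T (\<lambda>\<omega>. 0 \<le> Vt S T y \<phi> \<omega>)"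
  by (rule qs_mono[OF AsetD(2)[OF \<phi>]]) (use G in \<open>metis ereal_less_eq(5) order.trans\<close>)

text \<open>Nonnegativity of terminal wealth propagates back to date 0, where wealth is the constant
  \<open>y\<close>. Since a prior exists, the quasi-sure inequality there is a plain one.\<close>

lemma Aset_capital_nonneg:
  assumes \<phi>: "\<phi> \<in> Aset Om Qr S T G y" and G: "\<forall>\<omega>\<in>space (\<Omega> T). 0 \<le> G \<omega>"
  shows "0 \<le> y"
proof -
  have "qs Om Qr 0 (\<lambda>\<omega>. 0 \<le> Vt S 0 y \<phi> \<omega>)"
    by (rule V_nonneg[OF AsetD(1)[OF \<phi>] Aset_nonneg[OF \<phi> G]]) simp_all
  moreover obtain P where "P \<in> Q T" using Q_ne by blast
  ultimately have "AE \<omega> in distr P (\<Omega> 0) (res 0). 0 \<le> y" "prob_space (distr P (\<Omega> 0) (res 0))"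
    using Qset_marginal[of 0 T P Om Qr] probsD(1)[OF Qset_probs, of _ Om Qr 0]
    by (auto simp: qs_iff Vt_0 simp del: One_nat_def Qset.simps)
  then show ?thesis using prob_space.AE_const by blast
qed

lemma AE_upper:
  assumes \<phi>: "\<phi> \<in> Aset Om Qr S T G y" and G: "\<forall>\<omega>\<in>space (\<Omega> T). 0 \<le> G \<omega>"
    and n: "1 \<le> n" and P: "P \<in> Q T"
  shows "AE z in P. e2ennreal (Uext (u n) z (ereal (Vt S T y \<phi> z) - G z)) \<le> upper n y z"
proof -
  have "AE z in P. G z \<le> ereal (Vt S T y \<phi> z) \<and> Vt S T y \<phi> z \<le> y * wealth_factor T z"
    using qs_conj[OF AsetD(2)[OF \<phi>] wealth_bound[OF AsetD(1)[OF \<phi>] Aset_nonneg[OF \<phi> G] order_refl]] P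
    by (simp add: qs_iff)
  then show ?thesis
  proof (rule AE_mp, intro AE_I2 impI)
    fix z assume "z \<in> space P" and *: "G z \<le> ereal (Vt S T y \<phi> z) \<and> Vt S T y \<phi> z \<le> y * wealth_factor T z"
    then have z: "z \<in> space (\<Omega> T)" by (simp add: space_Q[OF P])
    obtain g where g: "G z = ereal g" "0 \<le> g" "g \<le> Vt S T y \<phi> z"
      using bspec[OF G z] * by (cases "G z") auto
    show "e2ennreal (Uext (u n) z (ereal (Vt S T y \<phi> z) - G z)) \<le> upper n y z"
      unfolding upper_def g(1) ereal_minus(1)
      by (rule utility_upper_bound[where u="u n" and \<omega>=z, OF u_props[OF n z] x0_pos]) (use * g in auto)
  qed
qed

text \<open>The integrability condition is automatic, because \<open>upper\<close> dominates the
  positive part and has finite expectation under every prior.\<close>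

lemma AUset_eq:
  assumes G: "\<forall>\<omega>\<in>space (\<Omega> T). 0 \<le> G \<omega>" and n: "1 \<le> n"
  shows "AUset Om Qr S T (u n) G y = Aset Om Qr S T G y"
proof -
  have "(\<integral>\<^sup>+\<omega>. e2ennreal (Uext (u n) \<omega> (ereal (Vt S T y \<phi> \<omega>) - G \<omega>)) \<partial>completion P) < \<infinity>"
    if \<phi>: "\<phi> \<in> Aset Om Qr S T G y" and P: "P \<in> Q T" for \<phi> P
  proof -
    obtain B where B: "B < \<infinity>" "\<forall>n\<ge>1. \<forall>P\<in>Q T. (\<integral>\<^sup>+z. upper n y z \<partial>P) \<le> B"
      using upper_bound[OF Aset_capital_nonneg[OF \<phi> G]] by blast
    have "(\<integral>\<^sup>+\<omega>. e2ennreal (Uext (u n) \<omega> (ereal (Vt S T y \<phi> \<omega>) - G \<omega>)) \<partial>P) \<le> (\<integral>\<^sup>+z. upper n y z \<partial>P)"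
      by (rule nn_integral_mono_AE[OF AE_upper[OF \<phi> G n P]])
    also have "\<dots> \<le> B" using B(2) n P by blast
    finally show ?thesis using B(1) by (simp only: nn_integral_completion)
  qed
  then show ?thesis unfolding AUset_def by blast
qed

lemma uval_alt:
  assumes G: "\<forall>\<omega>\<in>space (\<Omega> T). 0 \<le> G \<omega>" and n: "1 \<le> n"
  shows "uval Om Qr S T (u n) G y = (SUP \<phi>\<in>Aset Om Qr S T G y. INF P\<in>Q T.
      Eext P (\<lambda>\<omega>. Uext (u n) \<omega> (ereal (Vt S T y \<phi> \<omega>) - G \<omega>)))"
  by (simp add: uval_def AUset_eq[OF G n])

lemma uval_upper:
  assumes G: "\<forall>\<omega>\<in>space (\<Omega> T). 0 \<le> G \<omega>" and n: "1 \<le> n" and y: "0 \<le> y"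
  shows "uval Om Qr S T (u n) G y < \<infinity>"
proof -
  obtain B where B: "B < \<infinity>" "\<forall>n\<ge>1. \<forall>P\<in>Q T. (\<integral>\<^sup>+z. upper n y z \<partial>P) \<le> B" using upper_bound[OF y] by blast
  obtain P where P: "P \<in> Q T" using Q_ne by blast
  have "uval Om Qr S T (u n) G y \<le> enn2ereal B"
    unfolding uval_alt[OF G n]
  proof (rule SUP_least)
    fix \<phi> assume \<phi>: "\<phi> \<in> Aset Om Qr S T G y"
    let ?f = "\<lambda>\<omega>. Uext (u n) \<omega> (ereal (Vt S T y \<phi> \<omega>) - G \<omega>)"
    have "(INF P\<in>Q T. Eext P ?f) \<le> Eext P ?f" by (rule INF_lower[OF P])
    also have "\<dots> \<le> enn2ereal (\<integral>\<^sup>+\<omega>. e2ennreal (?f \<omega>) \<partial>P)" by (rule Eext_le)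
    also have "\<dots> \<le> enn2ereal B"
      unfolding less_eq_ennreal.rep_eq[symmetric]
      by (rule order.trans[OF nn_integral_mono_AE[OF AE_upper[OF \<phi> G n P]]]) (use B(2) n P in blast)
    finally show "(INF P\<in>Q T. Eext P ?f) \<le> enn2ereal B" .
  qed
  also have "\<dots> < \<infinity>" using B(1) by (cases B) auto
  finally show ?thesis .
qed

text \<open>Not trading leaves wealth \<open>x0\<close>, whose negative utility has expectation
  bounded uniformly in \<open>n\<close> and the prior by (A5).\<close>

lemma uval_lower: "\<exists>C\<ge>0. \<forall>n\<ge>1. ereal (- C) \<le> uval Om Qr S T (u n) (\<lambda>_. 0) x0"
proof -
  let ?C = "SUP n\<in>{1..}. SUP P\<in>Q T. \<integral>\<^sup>+\<omega>. ennreal (- u n \<omega> x0) \<partial>(completion P)"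
  obtain C where C: "0 \<le> C" "?C = ennreal C" using A5_minus less_top_ennreal[of ?C] unfolding infinity_ennreal_def by blast
  have "ereal (- C) \<le> uval Om Qr S T (u n) (\<lambda>_. 0) x0" if n: "1 \<le> n" for n
  proof -
    define \<phi> where "\<phi> = (\<lambda>(s :: nat) (\<omega> :: nat \<Rightarrow> 'a). 0 :: 'b)"
    have V: "Vt S T x0 \<phi> \<omega> = x0" for \<omega> by (simp add: Vt_def \<phi>_def)
    have "\<phi> \<in> strategies Om T" by (rule strategiesI) (simp add: \<phi>_def)
    then have \<phi>: "\<phi> \<in> Aset Om Qr S T (\<lambda>_. 0) x0"
      using x0_pos by (simp add: Aset_def V qs_iff)
    have "ereal (- C) \<le> (INF P\<in>Q T. Eext P (\<lambda>\<omega>. Uext (u n) \<omega> (ereal (Vt S T x0 \<phi> \<omega>) - 0)))"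
    proof (rule INF_greatest)
      fix P assume P: "P \<in> Q T"
      have eq: "(\<lambda>\<omega>. Uext (u n) \<omega> (ereal (Vt S T x0 \<phi> \<omega>) - 0)) = (\<lambda>\<omega>. ereal (u n \<omega> x0))"
        using x0_pos by (simp add: V Uext_real)
      have "(\<integral>\<^sup>+\<omega>. ennreal (- u n \<omega> x0) \<partial>P) \<le> ennreal C"
        using SUP_SUP_le[OF n P, where f="\<lambda>n \<omega>. ennreal (- u n \<omega> x0)"] C(2) by simp
      then have "enn2ereal (\<integral>\<^sup>+\<omega>. ennreal (- u n \<omega> x0) \<partial>P) \<le> ereal C"
        using C(1) by (simp add: less_eq_ennreal.rep_eq enn2ereal_ennreal)
      then have "0 - ereal C \<le> enn2ereal (\<integral>\<^sup>+\<omega>. ennreal (u n \<omega> x0) \<partial>P) - enn2ereal (\<integral>\<^sup>+\<omega>. ennreal (- u n \<omega> x0) \<partial>P)"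
        by (intro ereal_minus_mono) simp_all
      then show "ereal (- C) \<le> Eext P (\<lambda>\<omega>. Uext (u n) \<omega> (ereal (Vt S T x0 \<phi> \<omega>) - 0))"
        unfolding eq Eext_def by (simp add: nn_integral_completion)
    qed
    also have "\<dots> \<le> uval Om Qr S T (u n) (\<lambda>_. 0) x0"
      by (subst uval_alt[OF _ n]) (simp, rule SUP_upper[OF \<phi>])
    finally show ?thesis .
  qed
  with C(1) show ?thesis by blast
qed

lemma uval_finite: "1 \<le> n \<Longrightarrow> \<bar>uval Om Qr S T (u n) (\<lambda>_. 0) x0\<bar> \<noteq> \<infinity>"
  using uval_upper[of "\<lambda>_. 0" n x0] uval_lower x0_pos by fastforce

text \<open>A value comparable with the finite value of the zero claim cannot be a supremum over the
  empty set, so capital \<open>x0 + z\<close> superreplicates \<open>G\<close> and is therefore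
  nonnegative.\<close>

lemma pval_lower:
  assumes G: "\<forall>\<omega>\<in>space (\<Omega> T). 0 \<le> G \<omega>" and n: "1 \<le> n"
  shows "ereal (- x0) \<le> pval Om Qr S T (u n) G x0"
  unfolding pval_def
proof (rule Inf_greatest)
  fix w assume "w \<in> ereal ` {z. uval Om Qr S T (u n) (\<lambda>_. 0) x0 \<le> uval Om Qr S T (u n) G (x0 + z)}"
  then obtain z where z: "w = ereal z" "uval Om Qr S T (u n) (\<lambda>_. 0) x0 \<le> uval Om Qr S T (u n) G (x0 + z)" by blast
  have "Aset Om Qr S T G (x0 + z) \<noteq> {}"
  proof
    assume "Aset Om Qr S T G (x0 + z) = {}"
    then have "uval Om Qr S T (u n) G (x0 + z) = - \<infinity>" by (simp add: uval_alt[OF G n] bot_ereal_def)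
    with z(2) uval_finite[OF n] show False by auto
  qed
  then obtain \<phi> where "\<phi> \<in> Aset Om Qr S T G (x0 + z)" by blast
  from Aset_capital_nonneg[OF this G] show "ereal (- x0) \<le> w" by (simp add: z(1))
qed

lemma pval_upper:
  assumes G: "\<forall>\<omega>\<in>space (\<Omega> T). 0 \<le> G \<omega>" and n: "1 \<le> n"
  shows "pval Om Qr S T (u n) G x0 \<le> superrep Om Qr S T G"
  unfolding superrep_def
proof (rule Inf_greatest)
  fix w assume "w \<in> ereal ` {z. Aset Om Qr S T G z \<noteq> {}}"
  then obtain z \<psi> where z: "w = ereal z" and \<psi>: "\<psi> \<in> Aset Om Qr S T G z" by blast
  have "uval Om Qr S T (u n) (\<lambda>_. 0) x0 \<le> uval Om Qr S T (u n) G (x0 + z)"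
  proof (subst uval_alt[OF _ n], simp, rule SUP_least)
    fix \<phi> assume \<phi>: "\<phi> \<in> Aset Om Qr S T (\<lambda>_. 0) x0"
    define \<theta> where "\<theta> = (\<lambda>s \<omega>. \<phi> s \<omega> + \<psi> s \<omega>)"
    have V: "Vt S T (x0 + z) \<theta> \<omega> = Vt S T x0 \<phi> \<omega> + Vt S T z \<psi> \<omega>" for \<omega>
      unfolding \<theta>_def by (rule Vt_add)
    have "\<theta> \<in> strategies Om T"
      unfolding \<theta>_def
      by (rule strategiesI) (intro borel_measurable_add strategiesD AsetD(1)[OF \<phi>] AsetD(1)[OF \<psi>])
    moreover have nn: "qs Om Qr T (\<lambda>\<omega>. 0 \<le> Vt S T x0 \<phi> \<omega> \<and> G \<omega> \<le> ereal (Vt S T z \<psi> \<omega>))"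
      by (rule qs_conj[OF Aset_nonneg[OF \<phi>] AsetD(2)[OF \<psi>]]) simp
    then have "qs Om Qr T (\<lambda>\<omega>. G \<omega> \<le> ereal (Vt S T (x0 + z) \<theta> \<omega>))"
      by (rule qs_mono) (auto simp: V intro: order.trans)
    ultimately have \<theta>: "\<theta> \<in> Aset Om Qr S T G (x0 + z)" by (simp add: Aset_def)
    have "(INF P\<in>Q T. Eext P (\<lambda>\<omega>. Uext (u n) \<omega> (ereal (Vt S T x0 \<phi> \<omega>) - 0))) \<le>
        (INF P\<in>Q T. Eext P (\<lambda>\<omega>. Uext (u n) \<omega> (ereal (Vt S T (x0 + z) \<theta> \<omega>) - G \<omega>)))"
    proof (rule INF_superset_mono[OF order_refl])
      fix P assume P: "P \<in> Q T"
      have ae: "AE \<omega> in P. 0 \<le> Vt S T x0 \<phi> \<omega> \<and> G \<omega> \<le> ereal (Vt S T z \<psi> \<omega>)" using nn P by (simp add: qs_iff)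
      show "Eext P (\<lambda>\<omega>. Uext (u n) \<omega> (ereal (Vt S T x0 \<phi> \<omega>) - 0)) \<le>
          Eext P (\<lambda>\<omega>. Uext (u n) \<omega> (ereal (Vt S T (x0 + z) \<theta> \<omega>) - G \<omega>))"
      proof (rule Eext_mono, rule AE_mp[OF ae], rule AE_I2, rule impI)
        fix \<omega> assume "\<omega> \<in> space P" and *: "0 \<le> Vt S T x0 \<phi> \<omega> \<and> G \<omega> \<le> ereal (Vt S T z \<psi> \<omega>)"
        then have w: "\<omega> \<in> space (\<Omega> T)" by (simp add: space_Q[OF P])
        obtain g where g: "G \<omega> = ereal g" "0 \<le> g" "g \<le> Vt S T z \<psi> \<omega>"
          using bspec[OF G w] * by (cases "G \<omega>") auto
        show "Uext (u n) \<omega> (ereal (Vt S T x0 \<phi> \<omega>) - 0) \<le> Uext (u n) \<omega> (ereal (Vt S T (x0 + z) \<theta> \<omega>) - G \<omega>)"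
          by (rule Uext_mono[where u="u n" and \<omega>=\<omega>, OF u_props(2)[OF n w]]) (use g in \<open>simp_all add: V\<close>)
      qed
    qed
    also have "\<dots> \<le> uval Om Qr S T (u n) G (x0 + z)"
      unfolding uval_alt[OF G n] by (rule SUP_upper[OF \<theta>])
    finally show "(INF P\<in>Q T. Eext P (\<lambda>\<omega>. Uext (u n) \<omega> (ereal (Vt S T x0 \<phi> \<omega>) - 0))) \<le> uval Om Qr S T (u n) G (x0 + z)" .
  qed
  then show "pval Om Qr S T (u n) G x0 \<le> w"
    unfolding pval_def z by (intro Inf_lower) blast
qed

text \<open>Near-optimal wealth has bounded negative utility, hence its excess over G rarely falls below
  x0 - \<epsilon> where the utility of x0 - \<epsilon> is very negative.\<close>

lemma shortfall_strategy:
  assumes G: "\<forall>\<omega>\<in>space (\<Omega> T). 0 \<le> G \<omega>" and Gm: "G \<in> borel_measurable (umeas (\<Omega> T))"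
    and e: "0 < \<epsilon>" "\<epsilon> < x0" and c: "0 \<le> x0 + c"
  shows "\<exists>C\<ge>0. \<forall>n\<ge>1. \<forall>z\<le>c. uval Om Qr S T (u n) (\<lambda>_. 0) x0 \<le> uval Om Qr S T (u n) G (x0 + z) \<longrightarrow>
    (\<exists>\<phi>\<in>strategies Om T. qs Om Qr T (\<lambda>\<omega>. 0 \<le> Vt S T (x0 + c) \<phi> \<omega>) \<and>
      (\<forall>P\<in>Q T. \<forall>M>0. M * measure (completion P)
        {\<omega> \<in> space (\<Omega> T). ereal (Vt S T (c + \<epsilon>) \<phi> \<omega>) < G \<omega> \<and> Uext (u n) \<omega> (ereal (x0 - \<epsilon>)) \<le> - ereal M} \<le> C))"
proof -
  obtain C0 where C0: "0 \<le> C0" "\<forall>n\<ge>1. ereal (- C0) \<le> uval Om Qr S T (u n) (\<lambda>_. 0) x0" using uval_lower by blast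
  obtain B' where B': "B' < \<infinity>" "\<forall>n\<ge>1. \<forall>P\<in>Q T. (\<integral>\<^sup>+z. upper n (x0 + c) z \<partial>P) \<le> B'" using upper_bound[OF c] by blast
  obtain B where B: "0 \<le> B" "\<And>n P. 1 \<le> n \<Longrightarrow> P \<in> Q T \<Longrightarrow> (\<integral>\<^sup>+z. upper n (x0 + c) z \<partial>P) \<le> ennreal B"
    using B' by (cases B') auto
  \<comment> \<open>\<open>B\<close> bounds the expected positive utility, \<open>- C0\<close>
    bounds the value of the zero claim from below, and 1 is the slack of a near-optimal
    strategy.\<close>
  define C where "C = B + C0 + 1"
  show ?thesis
  proof (intro exI[of _ C] conjI allI impI)
    show "0 \<le> C" using B C0 by (simp add: C_def)
    fix n :: nat and z assume n: "1 \<le> n" and z: "z \<le> c"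
      and le: "uval Om Qr S T (u n) (\<lambda>_. 0) x0 \<le> uval Om Qr S T (u n) G (x0 + z)"
    have "ereal (- C0 - 1) < ereal (- C0)" by simp
    also have "\<dots> \<le> uval Om Qr S T (u n) G (x0 + z)" using C0(2) n le by (meson order.trans)
    finally obtain \<phi> where \<phi>: "\<phi> \<in> Aset Om Qr S T G (x0 + z)"
      and lb: "ereal (- C0 - 1) < (INF P\<in>Q T. Eext P (\<lambda>\<omega>. Uext (u n) \<omega> (ereal (Vt S T (x0 + z) \<phi> \<omega>) - G \<omega>)))"
      unfolding uval_alt[OF G n] less_SUP_iff by blast
    note \<phi>s = AsetD(1)[OF \<phi>]
    let ?f = "\<lambda>\<omega>. Uext (u n) \<omega> (ereal (Vt S T (x0 + z) \<phi> \<omega>) - G \<omega>)"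
    have nn: "qs Om Qr T (\<lambda>\<omega>. 0 \<le> Vt S T (x0 + c) \<phi> \<omega>)"
      by (rule qs_mono[OF Aset_nonneg[OF \<phi> G]]) (use z Vt_const[of T "x0 + z" \<phi>] Vt_const[of T "x0 + c" \<phi>] in simp_all)
    have "M * measure (completion P)
        {\<omega> \<in> space (\<Omega> T). ereal (Vt S T (c + \<epsilon>) \<phi> \<omega>) < G \<omega> \<and> Uext (u n) \<omega> (ereal (x0 - \<epsilon>)) \<le> - ereal M} \<le> C"
      (is "M * measure _ ?A \<le> C") if P: "P \<in> Q T" and M: "0 < M" for P M
    proof -
      interpret cP: prob_space "completion P"
        using probsD(1)[OF Qset_probs[OF P]] by (simp add: prob_space.prob_space_completion)
      have upper_mono: "upper n (x0 + z) \<omega> \<le> upper n (x0 + c) \<omega>" if "\<omega> \<in> space (\<Omega> T)" for \<omega>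
        unfolding upper_def using z bounded_momentsD(2)[OF bounded_moments_wealth_factor[OF dS_W \<alpha>_W order_refl] that]
        by (intro add_left_mono ennreal_leI mult_left_mono mult_right_mono) auto
      have "(\<integral>\<^sup>+\<omega>. e2ennreal (?f \<omega>) \<partial>P) \<le> (\<integral>\<^sup>+\<omega>. upper n (x0 + z) \<omega> \<partial>P)"
        by (rule nn_integral_mono_AE[OF AE_upper[OF \<phi> G n P]])
      also have "\<dots> \<le> (\<integral>\<^sup>+\<omega>. upper n (x0 + c) \<omega> \<partial>P)"
        by (rule nn_integral_mono) (simp add: upper_mono space_Q[OF P])
      also have "\<dots> \<le> ennreal B" by (rule B(2)[OF n P])
      finally have "enn2ereal (\<integral>\<^sup>+\<omega>. e2ennreal (?f \<omega>) \<partial>P) \<le> ereal B"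
        using B(1) by (simp add: less_eq_ennreal.rep_eq enn2ereal_ennreal)
      moreover have "ereal (- C0 - 1) < Eext P ?f"
        using lb INF_lower[OF P, of "\<lambda>P. Eext P ?f"] by (rule order.strict_trans2)
      then have "ereal (- C0 - 1) < enn2ereal (\<integral>\<^sup>+\<omega>. e2ennreal (?f \<omega>) \<partial>P) - enn2ereal (\<integral>\<^sup>+\<omega>. e2ennreal (- ?f \<omega>) \<partial>P)"
        unfolding Eext_def nn_integral_completion .
      ultimately have neg: "enn2ereal (\<integral>\<^sup>+\<omega>. e2ennreal (- ?f \<omega>) \<partial>P) \<le> ereal C"
        unfolding C_def using enn2ereal_nonneg[of "\<integral>\<^sup>+\<omega>. e2ennreal (?f \<omega>) \<partial>P"]
        by (cases "enn2ereal (\<integral>\<^sup>+\<omega>. e2ennreal (?f \<omega>) \<partial>P)"; cases "enn2ereal (\<integral>\<^sup>+\<omega>. e2ennreal (- ?f \<omega>) \<partial>P)") auto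
      have xe: "0 < x0 - \<epsilon>" using e by simp
      have A: "?A \<in> sets (completion P)"
      proof -
        have [measurable]: "Vt S T (c + \<epsilon>) \<phi> \<in> borel_measurable (umeas (\<Omega> T))" "(\<lambda>\<omega>. u n \<omega> (x0 - \<epsilon>)) \<in> borel_measurable (umeas (\<Omega> T))"
          by (rule Vt_meas[OF \<phi>s order_refl], rule u_meas[OF n xe])
        note [measurable] = Gm
        have "{\<omega> \<in> space (umeas (\<Omega> T)). ereal (Vt S T (c + \<epsilon>) \<phi> \<omega>) < G \<omega> \<and> ereal (u n \<omega> (x0 - \<epsilon>)) \<le> - ereal M} \<in> sets (umeas (\<Omega> T))"
          by measurable
        then show ?thesis
          using Qset_probs[OF P] by (simp add: Uext_real[OF xe] sets_umeas univ_sets_def)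
      qed
      have "ennreal M * emeasure (completion P) ?A = (\<integral>\<^sup>+\<omega>. ennreal M * indicator ?A \<omega> \<partial>completion P)"
        by (rule nn_integral_cmult_indicator[OF A, symmetric])
      also have "\<dots> = (\<integral>\<^sup>+\<omega>. ennreal M * indicator ?A \<omega> \<partial>P)" by (rule nn_integral_completion)
      also have "\<dots> \<le> (\<integral>\<^sup>+\<omega>. e2ennreal (- ?f \<omega>) \<partial>P)"
      proof (rule nn_integral_mono)
        fix \<omega> assume "\<omega> \<in> space P"
        then have w: "\<omega> \<in> space (\<Omega> T)" by (simp add: space_Q[OF P])
        show "ennreal M * indicator ?A \<omega> \<le> e2ennreal (- ?f \<omega>)"
        proof (cases "\<omega> \<in> ?A")
          case True
          then have a: "ereal (Vt S T (c + \<epsilon>) \<phi> \<omega>) < G \<omega>" "Uext (u n) \<omega> (ereal (x0 - \<epsilon>)) \<le> - ereal M" by auto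
          \<comment> \<open>Wealth from \<open>c + \<epsilon>\<close> is below \<open>G\<close> on
            \<open>?A\<close>, and passing to the capital \<open>x0 + z \<le> x0 + c\<close> adds at
            most \<open>x0 - \<epsilon>\<close>.\<close>
          have "ereal (Vt S T (x0 + z) \<phi> \<omega>) - G \<omega> \<le> ereal (x0 - \<epsilon>)"
            using a(1) z Vt_const[of T "x0 + z" \<phi> \<omega>] Vt_const[of T "c + \<epsilon>" \<phi> \<omega>] by (cases "G \<omega>") auto
          then have "?f \<omega> \<le> Uext (u n) \<omega> (ereal (x0 - \<epsilon>))"
            by (intro Uext_mono u_props(2)[OF n w]) auto
          also note a(2)
          finally have "ereal M \<le> - ?f \<omega>" by (metis ereal_minus_le_minus ereal_uminus_uminus)
          from e2ennreal_mono[OF this] show ?thesis using True by simp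
        qed simp
      qed
      finally have "ennreal M * ennreal (measure (completion P) ?A) \<le> (\<integral>\<^sup>+\<omega>. e2ennreal (- ?f \<omega>) \<partial>P)"
        by (simp only: cP.emeasure_eq_measure)
      then have "enn2ereal (ennreal (M * measure (completion P) ?A)) \<le> enn2ereal (\<integral>\<^sup>+\<omega>. e2ennreal (- ?f \<omega>) \<partial>P)"
        using M by (simp only: less_eq_ennreal.rep_eq ennreal_mult[OF less_imp_le measure_nonneg])
      also note neg
      finally show ?thesis using M by (simp add: enn2ereal_ennreal)
    qed
    with \<phi>s nn show "\<exists>\<phi>\<in>strategies Om T. qs Om Qr T (\<lambda>\<omega>. 0 \<le> Vt S T (x0 + c) \<phi> \<omega>) \<and>
      (\<forall>P\<in>Q T. \<forall>M>0. M * measure (completion P)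
        {\<omega> \<in> space (\<Omega> T). ereal (Vt S T (c + \<epsilon>) \<phi> \<omega>) < G \<omega> \<and> Uext (u n) \<omega> (ereal (x0 - \<epsilon>)) \<le> - ereal M} \<le> C)"
      by (intro bexI[of _ \<phi>] conjI ballI allI impI)
  qed
qed

text \<open>For each \<open>k\<close>, (A6) supplies an index among the infinitely many with price
  below \<open>c\<close> at which the threshold \<open>2 ^ k\<close> is met, and hence a strategy
  with failure probability of order \<open>1 / 2 ^ k\<close> under all priors. These strategies do
  not depend on the prior, so Borel-Cantelli under each prior gives a quasi-sure conclusion.\<close>

lemma superrep_le_limit:
  assumes G: "\<forall>\<omega>\<in>space (\<Omega> T). 0 \<le> G \<omega>" and Gm: "G \<in> borel_measurable (umeas (\<Omega> T))"
    and e: "0 < \<epsilon>" "\<epsilon> < x0"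
    and freq: "\<exists>\<^sub>F n in sequentially. 1 \<le> n \<and> pval Om Qr S T (u n) G x0 < ereal c"
  shows "Aset Om Qr S T G (c + \<epsilon>) \<noteq> {}"
proof -
  obtain n0 where n0: "1 \<le> n0" "pval Om Qr S T (u n0) G x0 < ereal c" using frequently_ex[OF freq] by blast
  have c: "0 \<le> x0 + c" using pval_lower[of G, OF G n0(1)] n0(2) by (cases "pval Om Qr S T (u n0) G x0") auto
  obtain C where C: "0 \<le> C" and st: "\<And>n z. 1 \<le> n \<Longrightarrow> z \<le> c \<Longrightarrow>
      uval Om Qr S T (u n) (\<lambda>_. 0) x0 \<le> uval Om Qr S T (u n) G (x0 + z) \<Longrightarrow>
      \<exists>\<phi>\<in>strategies Om T. qs Om Qr T (\<lambda>\<omega>. 0 \<le> Vt S T (x0 + c) \<phi> \<omega>) \<and>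
      (\<forall>P\<in>Q T. \<forall>M>0. M * measure (completion P)
        {\<omega> \<in> space (\<Omega> T). ereal (Vt S T (c + \<epsilon>) \<phi> \<omega>) < G \<omega> \<and> Uext (u n) \<omega> (ereal (x0 - \<epsilon>)) \<le> - ereal M} \<le> C)"
    using shortfall_strategy[OF G Gm e c] by blast
  have xe: "0 < x0 - \<epsilon>" using e by simp
  define bad where "bad \<phi> = {\<omega> \<in> space (\<Omega> T). ereal (Vt S T (c + \<epsilon>) \<phi> \<omega>) < G \<omega>}" for \<phi>
  have bad_sets: "bad \<phi> \<in> sets (umeas (\<Omega> T))" if "\<phi> \<in> strategies Om T" for \<phi>
  proof -
    note [measurable] = Vt_meas[OF that order_refl] Gm
    have "{\<omega> \<in> space (umeas (\<Omega> T)). ereal (Vt S T (c + \<epsilon>) \<phi> \<omega>) < G \<omega>} \<in> sets (umeas (\<Omega> T))" by measurable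
    then show ?thesis by (simp add: bad_def)
  qed
  have "\<exists>\<phi>. \<phi> \<in> strategies Om T \<and> qs Om Qr T (\<lambda>\<omega>. 0 \<le> Vt S T (x0 + c) \<phi> \<omega>) \<and>
      (\<forall>P\<in>Q T. measure (completion P) (bad \<phi>) \<le> (C + 1) * (1 / 2) ^ k)" for k :: nat
  proof -
    \<comment> \<open>Failure has probability at most \<open>C / M\<close> where the utility of
      \<open>x0 - \<epsilon>\<close> is below \<open>- M\<close>, plus at most \<open>1 / M\<close>
      elsewhere by (A6); powers of 2 make the sum over \<open>k\<close> finite.\<close>
    define M where "M = (2 :: real) ^ k"
    have M: "0 < M" by (simp add: M_def)
    let ?L = "\<lambda>n. {\<omega> \<in> space (\<Omega> T). Uext (u n) \<omega> (ereal (x0 - \<epsilon>)) \<le> - ereal M}"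
    have "(\<lambda>n. INF P\<in>Q T. measure (completion P) (?L n)) \<longlonglongrightarrow> 1"
      using A6[rule_format, of "x0 - \<epsilon>" M] xe e M by simp
    then have "\<forall>\<^sub>F n in sequentially. 1 - 1 / M < (INF P\<in>Q T. measure (completion P) (?L n))"
      by (rule order_tendstoD(1)) (use M in simp)
    from frequently_eventually_conj[OF freq this] obtain n where n: "1 \<le> n" "pval Om Qr S T (u n) G x0 < ereal c"
      and L: "1 - 1 / M < (INF P\<in>Q T. measure (completion P) (?L n))"
      by (auto dest: frequently_ex)
    from n(2) obtain z where "z < c" "uval Om Qr S T (u n) (\<lambda>_. 0) x0 \<le> uval Om Qr S T (u n) G (x0 + z)"
      unfolding pval_def Inf_less_iff by auto
    with st[OF n(1), of z] obtain \<phi> where \<phi>: "\<phi> \<in> strategies Om T" "qs Om Qr T (\<lambda>\<omega>. 0 \<le> Vt S T (x0 + c) \<phi> \<omega>)"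
      and sf: "\<And>P M. P \<in> Q T \<Longrightarrow> 0 < M \<Longrightarrow> M * measure (completion P)
        {\<omega> \<in> space (\<Omega> T). ereal (Vt S T (c + \<epsilon>) \<phi> \<omega>) < G \<omega> \<and> Uext (u n) \<omega> (ereal (x0 - \<epsilon>)) \<le> - ereal M} \<le> C"
      by auto
    have "measure (completion P) (bad \<phi>) \<le> (C + 1) * (1 / 2) ^ k" if P: "P \<in> Q T" for P
    proof -
      interpret cP: prob_space "completion P"
        using probsD(1)[OF Qset_probs[OF P]] by (simp add: prob_space.prob_space_completion)
      have us: "A \<in> sets (umeas (\<Omega> T)) \<Longrightarrow> A \<in> sets (completion P)" for A
        using Qset_probs[OF P] by (auto simp: sets_umeas univ_sets_def)
      have Ls: "?L n \<in> sets (completion P)"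
      proof (rule us)
        note [measurable] = u_meas[OF n(1) xe]
        have "{\<omega> \<in> space (umeas (\<Omega> T)). ereal (u n \<omega> (x0 - \<epsilon>)) \<le> - ereal M} \<in> sets (umeas (\<Omega> T))" by measurable
        then show "?L n \<in> sets (umeas (\<Omega> T))" by (simp add: Uext_real[OF xe])
      qed
      have bs: "bad \<phi> \<in> sets (completion P)" by (rule us[OF bad_sets[OF \<phi>(1)]])
      have "(INF P\<in>Q T. measure (completion P) (?L n)) \<le> measure (completion P) (?L n)"
        by (rule cINF_lower[OF _ P]) (auto intro!: bdd_belowI[of _ 0])
      with L have L': "1 - 1 / M < measure (completion P) (?L n)" by linarith
      have "measure (completion P) (bad \<phi>) \<le> measure (completion P) (bad \<phi> \<inter> ?L n) + measure (completion P) (space (completion P) - ?L n)"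
      proof (rule order.trans[OF cP.finite_measure_mono measure_Un_le])
        show "bad \<phi> \<subseteq> (bad \<phi> \<inter> ?L n) \<union> (space (completion P) - ?L n)"
          by (auto simp: bad_def space_Q[OF P])
      qed (use bs Ls in auto)
      moreover have "bad \<phi> \<inter> ?L n = {\<omega> \<in> space (\<Omega> T). ereal (Vt S T (c + \<epsilon>) \<phi> \<omega>) < G \<omega> \<and> Uext (u n) \<omega> (ereal (x0 - \<epsilon>)) \<le> - ereal M}"
        by (auto simp: bad_def)
      then have "M * measure (completion P) (bad \<phi> \<inter> ?L n) \<le> C" using sf[OF P M] by (simp only:)
      then have "measure (completion P) (bad \<phi> \<inter> ?L n) \<le> C / M" using M by (simp add: pos_le_divide_eq mult.commute)
      moreover have "measure (completion P) (space (completion P) - ?L n) = 1 - measure (completion P) (?L n)"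
        by (rule cP.prob_compl[OF Ls])
      ultimately have "measure (completion P) (bad \<phi>) \<le> C / M + 1 / M" using L' by linarith
      also have "\<dots> = (C + 1) * (1 / 2) ^ k" by (simp add: M_def power_divide add_divide_distrib)
      finally show ?thesis .
    qed
    with \<phi> show ?thesis by blast
  qed
  then obtain \<phi> where \<phi>: "\<And>k. \<phi> k \<in> strategies Om T" "\<And>k. qs Om Qr T (\<lambda>\<omega>. 0 \<le> Vt S T (x0 + c) (\<phi> k) \<omega>)"
    and small: "\<And>k P. P \<in> Q T \<Longrightarrow> measure (completion P) (bad (\<phi> k)) \<le> (C + 1) * (1 / 2) ^ k"
    by metis
  have "qs Om Qr T (\<lambda>\<omega>. \<forall>\<^sub>F k in sequentially. G \<omega> \<le> ereal (Vt S T (c + \<epsilon>) (\<phi> k) \<omega>))"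
    unfolding qs_iff
  proof
    fix P assume P: "P \<in> Q T"
    interpret cP: prob_space "completion P"
      using probsD(1)[OF Qset_probs[OF P]] by (simp add: prob_space.prob_space_completion)
    have "AE \<omega> in completion P. \<forall>\<^sub>F k in sequentially. \<omega> \<in> space (completion P) - bad (\<phi> k)"
    proof (rule borel_cantelli_AE1)
      show "bad (\<phi> k) \<in> sets (completion P)" for k
        using bad_sets[OF \<phi>(1)] Qset_probs[OF P] by (auto simp: sets_umeas univ_sets_def)
      show "emeasure (completion P) (bad (\<phi> k)) < \<infinity>" for k
        by (simp add: cP.emeasure_eq_measure del: emeasure_completion)
      show "summable (\<lambda>k. measure (completion P) (bad (\<phi> k)))"
        by (rule summable_comparison_test'[where g="\<lambda>k. (C + 1) * (1 / 2) ^ k" and N=0])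
          (use small[OF P] in \<open>auto intro!: summable_mult summable_geometric\<close>)
    qed
    then have "AE \<omega> in completion P. \<forall>\<^sub>F k in sequentially. G \<omega> \<le> ereal (Vt S T (c + \<epsilon>) (\<phi> k) \<omega>)"
      by (rule eventually_mono) (erule eventually_mono, auto simp: bad_def space_Q[OF P] not_less)
    then show "AE \<omega> in P. \<forall>\<^sub>F k in sequentially. G \<omega> \<le> ereal (Vt S T (c + \<epsilon>) (\<phi> k) \<omega>)"
      by (simp only: AE_completion_iff)
  qed
  with \<phi> show ?thesis by (rule superreplication_closed)
qed

theorem pval_tendsto:
  assumes G: "\<forall>\<omega>\<in>space (\<Omega> T). 0 \<le> G \<omega>" and Gm: "G \<in> borel_measurable (umeas (\<Omega> T))"
  shows "(\<lambda>n. pval Om Qr S T (u n) G x0) \<longlonglongrightarrow> superrep Om Qr S T G"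
proof (rule order_tendstoI)
  fix a assume a: "superrep Om Qr S T G < a"
  show "\<forall>\<^sub>F n in sequentially. pval Om Qr S T (u n) G x0 < a"
    using eventually_ge_at_top[of 1] by (rule eventually_mono) (use pval_upper[of G, OF G] a in \<open>auto intro: order.strict_trans1\<close>)
next
  fix a assume "a < superrep Om Qr S T G"
  then obtain c where c: "a < ereal c" "ereal c < superrep Om Qr S T G" using ereal_dense2 by blast
  then obtain c' where c': "ereal c < ereal c'" "ereal c' < superrep Om Qr S T G" using ereal_dense2 by blast
  \<comment> \<open>The gap between \<open>c\<close> and \<open>c'\<close> pays for
    \<open>\<epsilon>\<close>; the cap \<open>x0 / 2\<close> keeps \<open>x0 - \<epsilon>\<close>
    positive, so that the utility there is real-valued and (A6) applies.\<close>
  define \<epsilon> where "\<epsilon> = min (c' - c) (x0 / 2)"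
  have e: "0 < \<epsilon>" "\<epsilon> < x0" "c + \<epsilon> \<le> c'" using c'(1) x0_pos by (auto simp: \<epsilon>_def)
  have "Aset Om Qr S T G (c + \<epsilon>) = {}"
  proof (rule ccontr)
    assume "Aset Om Qr S T G (c + \<epsilon>) \<noteq> {}"
    then have "superrep Om Qr S T G \<le> ereal (c + \<epsilon>)" unfolding superrep_def by (intro Inf_lower) blast
    also have "\<dots> \<le> ereal c'" using e by simp
    finally show False using c'(2) by simp
  qed
  with superrep_le_limit[of G, OF G Gm e(1,2), of c]
  have "\<not> (\<exists>\<^sub>F n in sequentially. 1 \<le> n \<and> pval Om Qr S T (u n) G x0 < ereal c)" by blast
  then have "\<forall>\<^sub>F n in sequentially. \<not> (1 \<le> n \<and> pval Om Qr S T (u n) G x0 < ereal c)" by (simp only: not_frequently)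
  with eventually_ge_at_top[of 1] show "\<forall>\<^sub>F n in sequentially. a < pval Om Qr S T (u n) G x0"
    by eventually_elim (use c(1) in \<open>auto simp: not_less intro: order.strict_trans2\<close>)
qed

end

theorem theorem4p9:
  fixes T :: nat
    and Om :: "nat \<Rightarrow> 'a::polish_space set"
    and Qr :: "nat \<Rightarrow> (nat \<Rightarrow> 'a) \<Rightarrow> 'a measure set"
    and S :: "nat \<Rightarrow> (nat \<Rightarrow> 'a) \<Rightarrow> 'b::euclidean_space"
    and u :: "nat \<Rightarrow> (nat \<Rightarrow> 'a) \<Rightarrow> real \<Rightarrow> real"
    and G :: "(nat \<Rightarrow> 'a) \<Rightarrow> ereal"
    and x0 :: real
  assumes T_pos: "1 \<le> T"
    and polish: "\<forall>s\<in>{1..T}. closed (Om s)"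
    \<comment> \<open>(A1)\<close>
    and A1_values: "\<forall>t<T. \<forall>\<omega>\<in>space (Omt Om t). Qr (Suc t) \<omega> \<noteq> {} \<and>
         Qr (Suc t) \<omega> \<subseteq> probs (Mcoord Om (Suc t)) \<and> convex_probs (Qr (Suc t) \<omega>)"
    and A1_graph: "\<forall>t<T. analytic (Omt Om t \<Otimes>\<^sub>M prob_algebra (Mcoord Om (Suc t)))
         {(\<omega>, P). \<omega> \<in> space (Omt Om t) \<and> P \<in> Qr (Suc t) \<omega>}"
    \<comment> \<open>(A2)\<close>
    and A2: "\<forall>t\<le>T. S t \<in> borel_measurable (Omt Om t)"
    \<comment> \<open>(A3)\<close>
    and A3: "\<forall>\<phi>\<in>strategies Om T. qs Om Qr T (\<lambda>\<omega>. 0 \<le> Vt S T 0 \<phi> \<omega>) \<longrightarrow>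
         qs Om Qr T (\<lambda>\<omega>. Vt S T 0 \<phi> \<omega> = 0)"
    \<comment> \<open>fixed Omega^t_NA, alpha_t, and (A4)\<close>
    and A4: "\<exists>NA \<alpha>. NA_witness Om Qr S T NA \<alpha> \<and>
         (\<forall>r>0. (\<forall>t\<in>{1..T}. in_W Om Qr t r
                    (\<lambda>\<omega>. ereal (norm (S t \<omega> - S (t - 1) (restrict \<omega> {1..t - 1}))))) \<and>
                 (\<forall>t\<in>{1..T - 1}. in_W Om Qr t r (\<lambda>\<omega>. ereal (1 / \<alpha> t \<omega>))))"
    \<comment> \<open>random utilities\<close>
    and util: "\<forall>n\<ge>1. random_utility (Omt Om T) (u n)"
    and x0_pos: "0 < x0"
    \<comment> \<open>(A5) at x0\<close>
    and A5_plus: "(SUP n\<in>{1..}. SUP P\<in>Qset Om Qr T.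
         \<integral>\<^sup>+\<omega>. ennreal (u n \<omega> x0) \<partial>(completion P)) < \<infinity>"
    and A5_minus: "(SUP n\<in>{1..}. SUP P\<in>Qset Om Qr T.
         \<integral>\<^sup>+\<omega>. ennreal (- u n \<omega> x0) \<partial>(completion P)) < \<infinity>"
    and A5_deriv: "\<exists>q>1. (SUP n\<in>{1..}. SUP P\<in>Qset Om Qr T.
         \<integral>\<^sup>+\<omega>. ennreal (\<bar>deriv (u n \<omega>) x0\<bar> powr q) \<partial>(completion P)) < \<infinity>"
    \<comment> \<open>(A6) at x0\<close>
    and A6: "\<forall>x M. 0 \<le> x \<and> x < x0 \<and> 0 \<le> M \<longrightarrow>
         (\<lambda>n. INF P\<in>Qset Om Qr T. measure (completion P)
             {\<omega> \<in> space (Omt Om T). Uext (u n) \<omega> (ereal x) \<le> - ereal M}) \<longlonglongrightarrow> 1"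
    \<comment> \<open>the claim G\<close>
    and G_meas: "univ_meas (Omt Om T) borel G"
    and G_nonneg: "\<forall>\<omega>\<in>space (Omt Om T). 0 \<le> G \<omega>"
    and G_nonzero: "\<not> qs Om Qr T (\<lambda>\<omega>. G \<omega> = 0)"
  shows "(\<forall>n\<ge>1. \<bar>uval Om Qr S T (u n) (\<lambda>_. 0) x0\<bar> \<noteq> \<infinity> \<and> pval Om Qr S T (u n) G x0 \<noteq> - \<infinity>)
       \<and> (\<lambda>n. pval Om Qr S T (u n) G x0) \<longlonglongrightarrow> superrep Om Qr S T G"
proof -
  obtain NA \<alpha> where witness: "NA_witness Om Qr S T NA \<alpha>"
    and W: "\<And>r. 0 < r \<Longrightarrow> (\<forall>t\<in>{1..T}. in_W Om Qr t r
                    (\<lambda>\<omega>. ereal (norm (S t \<omega> - S (t - 1) (restrict \<omega> {1..t - 1}))))) \<and>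
                 (\<forall>t\<in>{1..T - 1}. in_W Om Qr t r (\<lambda>\<omega>. ereal (1 / \<alpha> t \<omega>)))"
    using A4 by blast
  \<comment> \<open>Over an empty set of priors every property would hold quasi-surely,
    \<open>G = 0\<close> included.\<close>
  have Q_ne: "Qset Om Qr T \<noteq> {}"
    using G_nonzero by (auto simp: qs_iff)
  interpret utility_sequence T Om Qr S NA \<alpha> u x0
  proof unfold_locales
    show "in_W Om Qr t r (\<lambda>\<omega>. ereal (norm (S t \<omega> - S (t - 1) (restrict \<omega> {1..t - 1}))))"
      if "0 < r" "t \<in> {1..T}" for r t
      using W[OF that(1)] that(2) by blast
    show "in_W Om Qr t r (\<lambda>\<omega>. ereal (1 / \<alpha> t \<omega>))" if "0 < r" "t \<in> {1..T - 1}" for r t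
      using W[OF that(1)] that(2) by blast
  qed (fact polish A1_values A1_graph A2 A3 witness util x0_pos A5_plus A5_minus A5_deriv A6 Q_ne)+
  note G = G_nonneg
  have Gm: "G \<in> borel_measurable (umeas (Omt Om T))" using G_meas by (simp add: univ_meas_iff)
  show ?thesis
  proof (intro conjI allI impI)
    fix n :: nat assume n: "1 \<le> n"
    show "\<bar>uval Om Qr S T (u n) (\<lambda>_. 0) x0\<bar> \<noteq> \<infinity>" by (rule uval_finite[OF n])
    show "pval Om Qr S T (u n) G x0 \<noteq> - \<infinity>" using pval_lower[of G, OF G n] by auto
  next
    show "(\<lambda>n. pval Om Qr S T (u n) G x0) \<longlonglongrightarrow> superrep Om Qr S T G" by (rule pval_tendsto[OF G Gm])
  qed
qed

end
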